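(* Let $d=2$, and for $N\in\mathbb{N}_0$, $K>0$ let $\mathcal{K}_{N,K}$ be the reproducing kernel of the space $\Pi_{N,K}\subset L^2(\mathbb{R}^2)$. Let $\{N_i\}_{i\in\mathbb{N}}\subset\mathbb{N}_0$ and $\{K_i\}_{i\in\mathbb{N}}\subset(0,\infty)$ satisfy $N_i\to\infty$, $K_i\to\infty$ and $N_i/K_i\to\kappa\in(0,\infty)$. Then for every $x\in\mathbb{R}^2$, $$\lim_{i\to\infty}\frac{\mathcal{K}_{N_i,K_i}(x,x)}{K_i^2}=\frac{1}{\pi}\,\frac{1}{\|x\|^2}\int_0^{\|x\|} t\,U(t/\kappa)\,dt,$$ where at $x=0$ the right-hand side is understood by continuous extension, with value $1/(4\pi)$.
   Context: Definition of $U$: $U:[0,\infty)\to\mathbb{R}$, $U(r)=\tfrac12$ for $r\le 1$ and $U(r)=\tfrac12-\tfrac1\pi\operatorname{arcsec}(r)$ for $r>1$. Spherical Fourier--Bessel truncation spaces (general $d\ge2$): Let $S^{d-1}\subset\mathbb{R}^d$ be the unit sphere with surface measure $\omega$. For $n\in\mathbb{N}_0$ let $H_n^d$ be the space of spherical harmonics of degree $n$ on $S^{d-1}$, and let $\{Y_{n,m}: m=1,\dots,\dim H_n^d\}$ be an orthonormal basis of $H_n^d$ in $L^2(S^{d-1},\omega)$. For $f\in L^2(\mathbb{R}^d)$ put, for $r>0$, $f_{n,m}(r)=\int_{S^{d-1}} f(r\xi)\overline{Y_{n,m}(\xi)}\,d\omega(\xi)$, $g_{n,m}(r)=r^{\frac{d-2}{2}}f_{n,m}(r)\in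 L^2((0,\infty),r\,dr)$, and $\nu_n=n+\frac{d-2}{2}$. For $\alpha\ge-\tfrac12$ let $\mathcal{H}_\alpha$ be the unitary Hankel transform on $L^2((0,\infty),r\,dr)$, $(\mathcal{H}_\alpha g)(k)=\int_0^\infty g(r)J_\alpha(kr)\,r\,dr$ (interpreted via the standard $L^2$ extension), where $J_\alpha$ is the Bessel function of the first kind. For $N\in\mathbb{N}_0$, $K>0$, $$\Pi_{N,K}=\{f\in L^2(\mathbb{R}^d): f_{n,m}=0 \text{ for all } n>N,\ \text{and } \operatorname{ess\,supp}\mathcal{H}_{\nu_n}g_{n,m}\subset[0,K]\text{ for all }0\le n\le N\}.$$ (The definition does not depend on the choice of the bases $Y_{n,m}$.) Its reproducing kernel $\mathcal{K}_{N,K}$ is the unique continuous function on $\mathbb{R}^d\times\mathbb{R}^d$ such that the orthogonal projection of $L^2(\mathbb{R}^d)$ onto $\Pi_{N,K}$ is given by $f\mapsto\int_{\mathbb{R}^d}f(y)\overline{\mathcal{K}_{N,K}(x,y)}\,dy$. *)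

theory Defs
  imports "HOL-Analysis.Analysis"
begin

definition arcsec :: "real \<Rightarrow> real" where
  "arcsec r = arccos (1 / r)"

definition U :: "real \<Rightarrow> real" where
  "U r = (if r \<le> 1 then 1/2 else 1/2 - 1 / pi * arcsec r)"

text \<open>The value \<open>1 / (4 \<pi>)\<close> at the origin is the continuous extension of the limit profile.\<close>

lemma limit_profile_at_0:
  assumes "\<kappa> > 0"
  shows "((\<lambda>\<rho>. 1 / pi * (1 / \<rho>\<^sup>2) * integral {0..\<rho>} (\<lambda>t. t * U (t / \<kappa>))) \<longlongrightarrow> 1 / (4 * pi))
           (at_right 0)"
proof -
  have "1 / (4 * pi) = 1 / pi * (1 / \<rho>\<^sup>2) * integral {0..\<rho>} (\<lambda>t. t * U (t / \<kappa>))"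
    if "\<rho> > 0" "\<rho> < \<kappa>" for \<rho>
  proof -
    have "((\<lambda>t::real. t / 2) has_integral (\<rho>\<^sup>2 / 4 - 0\<^sup>2 / 4)) {0..\<rho>}"
      using that
      by (intro fundamental_theorem_of_calculus)
         (auto intro!: derivative_eq_intros simp flip: has_real_derivative_iff_has_vector_derivative)
    hence "((\<lambda>t. t * U (t / \<kappa>)) has_integral (\<rho>\<^sup>2 / 4)) {0..\<rho>}"
      using that assms by (subst has_integral_cong [where g = "\<lambda>t. t / 2"]) (auto simp: U_def)
    thus ?thesis
      using that by (simp add: integral_unique field_simps)
  qed
  hence "\<forall>\<^sub>F \<rho> in at_right 0. 1 / (4 * pi) =
           1 / pi * (1 / \<rho>\<^sup>2) * integral {0..\<rho>} (\<lambda>t. t * U (t / \<kappa>))"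
    using assms by (auto simp: eventually_at_right_field intro!: exI [of _ \<kappa>])
  thus ?thesis
    by (rule Lim_transform_eventually [OF tendsto_const])
qed

definition L2 :: "'a measure \<Rightarrow> ('a \<Rightarrow> complex) set" where
  "L2 M = {f \<in> borel_measurable M. integrable M (\<lambda>x. (cmod (f x))\<^sup>2)}"

definition L2_inner :: "'a measure \<Rightarrow> ('a \<Rightarrow> complex) \<Rightarrow> ('a \<Rightarrow> complex) \<Rightarrow> complex" where
  "L2_inner M f g = (\<integral>x. f x * cnj (g x) \<partial>M)"

text \<open>The complement of the largest open set on which \<open>f\<close> vanishes almost everywhere.\<close>

definition ess_supp :: "'a::topological_space measure \<Rightarrow> ('a \<Rightarrow> complex) \<Rightarrow> 'a set" where
  "ess_supp M f = - \<Union> {V. open V \<and> (AE x in M. x \<in> V \<longrightarrow> f x = 0)}"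

text \<open>Surface measure on the unit sphere of a Euclidean space of dimension \<open>d\<close>, normalised by
  \<open>\<omega>(A) = d \<cdot> \<lambda>({t \<xi>. 0 < t < 1, \<xi> \<in> A})\<close>, so that \<open>dx = r\<^sup>d\<^sup>-\<^sup>1 dr d\<omega>(\<xi>)\<close> in polar
  coordinates. Recall that \<open>sgn x = x / \<parallel>x\<parallel>\<close>.\<close>

definition surface_measure :: "'a::euclidean_space measure" where
  "surface_measure =
     distr (density (restrict_space lborel (ball 0 1 - {0})) (\<lambda>_. of_nat DIM('a)))
           (restrict_space borel (sphere 0 1)) sgn"

text \<open>Check of the normalisation: the total mass is \<open>d\<close> times the volume of the unit ball.\<close>

lemma emeasure_surface_measure_sphere:
  "emeasure (surface_measure :: 'a::euclidean_space measure) (sphere 0 1) =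
     ennreal (real DIM('a) * unit_ball_vol (real DIM('a)))"
proof -
  let ?B = "ball 0 1 - {0} :: 'a set"
  let ?D = "density (restrict_space lborel ?B) (\<lambda>_. of_nat DIM('a))"
  have sgn: "sgn \<in> ?D \<rightarrow>\<^sub>M restrict_space borel (sphere 0 (1::real))"
    by (intro measurable_restrict_space2)
       (auto simp: space_restrict_space norm_sgn intro!: measurable_restrict_space1)
  have "emeasure lborel ?B = emeasure lborel (ball 0 1 :: 'a set)"
    by (subst emeasure_Diff_null_set) auto
  also have "\<dots> = ennreal (unit_ball_vol (real DIM('a)))"
    by (simp add: emeasure_ball)
  finally have vol: "emeasure lborel ?B = ennreal (unit_ball_vol (real DIM('a)))" .
  have pre: "sgn -` sphere 0 1 \<inter> ?B = ?B"
    by (auto simp: space_restrict_space norm_sgn)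
  have "emeasure surface_measure (sphere 0 1 :: 'a set) = emeasure ?D ?B"
    unfolding surface_measure_def
    by (subst emeasure_distr [OF sgn]) (auto simp: pre sets_restrict_space space_restrict_space)
  also have "\<dots> = of_nat DIM('a) * emeasure (restrict_space lborel ?B) ?B"
    by (subst emeasure_density_const) (auto simp: sets_restrict_space)
  also have "\<dots> = of_nat DIM('a) * emeasure lborel ?B"
    by (subst emeasure_restrict_space) auto
  finally show ?thesis
    by (simp add: vol ennreal_mult flip: ennreal_of_nat_eq_real_of_nat)
qed

definition laplacian :: "('a::euclidean_space \<Rightarrow> complex) \<Rightarrow> 'a \<Rightarrow> complex" where
  "laplacian p x = (\<Sum>b\<in>Basis.
     vector_derivative
       (\<lambda>t. vector_derivative (\<lambda>s. p (x + s *\<^sub>R b)) (at t)) (at (0::real)))"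

text \<open>Restrictions to the unit sphere of homogeneous harmonic polynomials of degree \<open>n\<close>. Only the
  values on the sphere are relevant; off the sphere the elements of this set are arbitrary.\<close>

definition spherical_harmonics :: "nat \<Rightarrow> ('a::euclidean_space \<Rightarrow> complex) set" where
  "spherical_harmonics n =
     {Y. \<exists>p. polynomial_function p \<and>
             (\<forall>(t::real) x. p (t *\<^sub>R x) = of_real (t ^ n) * p x) \<and>
             (\<forall>x. laplacian p x = 0) \<and>
             (\<forall>\<xi>\<in>sphere 0 1. Y \<xi> = p \<xi>)}"

text \<open>\<open>Y 1, \<dots>, Y M\<close> is an orthonormal basis of the spherical harmonics of degree \<open>n\<close>; in
  particular \<open>M\<close> is the dimension of that space.\<close>

definition is_harmonic_onb :: "nat \<Rightarrow> nat \<Rightarrow> (nat \<Rightarrow> 'a::euclidean_space \<Rightarrow> complex) \<Rightarrow> bool" where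
  "is_harmonic_onb n M Y \<longleftrightarrow>
     (\<forall>m\<in>{1..M}. Y m \<in> spherical_harmonics n) \<and>
     (\<forall>m\<in>{1..M}. \<forall>m'\<in>{1..M}.
        L2_inner surface_measure (Y m) (Y m') = (if m = m' then 1 else 0)) \<and>
     (\<forall>Z\<in>spherical_harmonics n. \<exists>c :: nat \<Rightarrow> complex.
        \<forall>\<xi>\<in>sphere 0 1. Z \<xi> = (\<Sum>m=1..M. c m * Y m \<xi>))"

definition harmonic_coeff :: "('a::euclidean_space \<Rightarrow> complex) \<Rightarrow> ('a \<Rightarrow> complex) \<Rightarrow> real \<Rightarrow> complex"
  where "harmonic_coeff Y f r = (\<integral>\<xi>. f (r *\<^sub>R \<xi>) * cnj (Y \<xi>) \<partial>surface_measure)"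

text \<open>The measure \<open>r dr\<close> on \<open>(0, \<infinity>)\<close>, as a Borel measure on the real line.\<close>

definition radial_measure :: "real measure" where
  "radial_measure = density lborel (\<lambda>r. ennreal (r * indicator {0<..} r))"

text \<open>The Bessel function of the first kind, for real order and positive argument. (At \<open>x = 0\<close>
  the convention \<open>0 powr \<alpha> = 0\<close> gives the wrong value when \<open>\<alpha> = 0\<close>.)\<close>

definition bessel_J :: "real \<Rightarrow> real \<Rightarrow> real" where
  "bessel_J \<alpha> x =
     (\<Sum>m. (-1) ^ m / (fact m * Gamma (real m + \<alpha> + 1)) * (x / 2) powr (2 * real m + \<alpha>))"

text \<open>The integral of the Hankel transform truncated to \<open>(0, R]\<close>. For \<open>\<alpha> \<ge> -1/2\<close> it converges
  absolutely whenever \<open>g \<in> L\<^sup>2(r dr)\<close> and \<open>k > 0\<close>.\<close>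

definition truncated_hankel :: "real \<Rightarrow> real \<Rightarrow> (real \<Rightarrow> complex) \<Rightarrow> real \<Rightarrow> complex" where
  "truncated_hankel \<alpha> R g k =
     (\<integral>r. indicator {..R} r *\<^sub>R (g r * of_real (bessel_J \<alpha> (k * r))) \<partial>radial_measure)"

text \<open>The Hankel transform on \<open>L\<^sup>2(r dr)\<close>: \<open>h\<close> is the limit in mean of the truncated integrals. The
  \<open>L\<^sup>2\<close> distance is a nonnegative integral, so it is infinite (and not 0 by convention)
  when the difference is not square integrable.\<close>

definition has_hankel_transform :: "real \<Rightarrow> (real \<Rightarrow> complex) \<Rightarrow> (real \<Rightarrow> complex) \<Rightarrow> bool" where
  "has_hankel_transform \<alpha> g h \<longleftrightarrow>
     g \<in> L2 radial_measure \<and> h \<in> L2 radial_measure \<and>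
     ((\<lambda>R. \<integral>\<^sup>+k. ennreal ((cmod (truncated_hankel \<alpha> R g k - h k))\<^sup>2) \<partial>radial_measure)
        \<longlongrightarrow> 0) at_top"

text \<open>The space \<open>\<Pi>\<^sub>N\<^sub>,\<^sub>K\<close> of functions on a Euclidean space, relative to bases \<open>Y n 1, \<dots>, Y n (M n)\<close>
  of the spherical harmonics of each degree \<open>n\<close>. Elements of \<open>L\<^sup>2\<close> are represented by Borel
  functions, so identities between them hold almost everywhere.\<close>

definition fourier_bessel_space ::
  "(nat \<Rightarrow> nat) \<Rightarrow> (nat \<Rightarrow> nat \<Rightarrow> 'a::euclidean_space \<Rightarrow> complex) \<Rightarrow> nat \<Rightarrow> real \<Rightarrow> ('a \<Rightarrow> complex) set"
  where
  "fourier_bessel_space M Y N K =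
     {f \<in> L2 lborel.
        (\<forall>n>N. \<forall>m\<in>{1..M n}. AE r in radial_measure. harmonic_coeff (Y n m) f r = 0) \<and>
        (\<forall>n\<le>N. \<forall>m\<in>{1..M n}. \<exists>h.
           has_hankel_transform (real n + (real DIM('a) - 2) / 2)
             (\<lambda>r. of_real (r powr ((real DIM('a) - 2) / 2)) * harmonic_coeff (Y n m) f r) h \<and>
           ess_supp radial_measure h \<subseteq> {0..K})}"

definition is_orthogonal_projection ::
  "'a measure \<Rightarrow> ('a \<Rightarrow> complex) set \<Rightarrow> ('a \<Rightarrow> complex) \<Rightarrow> ('a \<Rightarrow> complex) \<Rightarrow> bool" where
  "is_orthogonal_projection M V f p \<longleftrightarrow>
     p \<in> V \<and> (\<forall>v\<in>V. L2_inner M (\<lambda>x. f x - p x) v = 0)"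

definition is_reproducing_kernel ::
  "('a::euclidean_space \<Rightarrow> complex) set \<Rightarrow> ('a \<Rightarrow> 'a \<Rightarrow> complex) \<Rightarrow> bool" where
  "is_reproducing_kernel V k \<longleftrightarrow>
     continuous_on UNIV (\<lambda>(x, y). k x y) \<and>
     (\<forall>f \<in> L2 lborel.
        (\<forall>x. integrable lborel (\<lambda>y. f y * cnj (k x y))) \<and>
        is_orthogonal_projection lborel V f (\<lambda>x. \<integral>y. f y * cnj (k x y) \<partial>lborel))"

definition reproducing_kernel ::
  "('a::euclidean_space \<Rightarrow> complex) set \<Rightarrow> 'a \<Rightarrow> 'a \<Rightarrow> complex" where
  "reproducing_kernel V = (THE k. is_reproducing_kernel V k)"

end

theory Submission
  imports Defs "HOL-Probability.Probability"
begin

text \<open>In polar coordinates the projection onto the space acts on each angular coefficient as the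
  Hankel transform, followed by the restriction to \<open>[0, K]\<close> and the inverse transform. Hence
  \<open>\<K>(x, x) = 1 / (2 \<pi>) \<Sum>\<^bsub>\<bar>n\<bar> \<le> N\<^esub> \<integral>\<^sub>0\<^sup>K J\<^sub>n(k \<parallel>x\<parallel>)\<^sup>2 k dk\<close>. For fixed \<open>z\<close> the
  numbers \<open>J\<^sub>n(z)\<^sup>2\<close> are the weights of a probability distribution on \<open>\<int>\<close>; its characteristic
  function shows that, scaled by \<open>1 / z\<close>, it tends to the arcsine law as \<open>z \<rightarrow> \<infinity>\<close>. So the sum over
  \<open>\<bar>n\<bar> \<le> N\<close> tends to an arcsine probability, which is \<open>2 U\<close>, and dominated convergence concludes.

  The Hankel transform is unitary because it maps \<open>r\<^sup>n exp (- c r\<^sup>2)\<close> to a function of the same kind,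
  preserves the inner products of these functions, and they span a dense subspace.\<close>

section \<open>Square integrable functions\<close>

text \<open>The difficulty is that order and argument grow together, a regime in which the single
  values \<open>J_n(z)\<close> oscillate and turn into decay near \<open>n = z\<close>. The
  characteristic function averages over all orders: Parseval turns it into the circle integral of
  \<open>exp (\<i> z (sin \<theta> - sin (\<theta> - t)))\<close>, and with \<open>t / N\<close> in
  place of \<open>t\<close> the phase is \<open>t z / N\<close> times a difference quotient of the
  sine. Its limit involves only the cosine of a uniform angle. The factor
  \<open>1 / (2 \<pi>)\<close> is the inverse squared norm of \<open>exp (\<i> k \<theta>)\<close>
  on the circle; with the 2 of \<open>2 U\<close> it gives the \<open>1 / \<pi>\<close> of the
  limit. Parseval also yields \<open>\<bar>J_n\<bar> \<le> 1\<close>, the bound by which Bessel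
  integrands are dominated. The kernel is given by a definite description, so a candidate must be
  shown to reproduce and to be the only continuous function that does. It has to be continuous at
  the origin as well, where polar coordinates degenerate, and independent of the chosen bases, which
  is the addition theorem for circular harmonics.\<close>

definition L2_norm :: "'a measure \<Rightarrow> ('a \<Rightarrow> complex) \<Rightarrow> real" where
  "L2_norm M f = sqrt (\<integral>x. (cmod (f x))\<^sup>2 \<partial>M)"

lemma L2I: "f \<in> borel_measurable M \<Longrightarrow> integrable M (\<lambda>x. (cmod (f x))\<^sup>2) \<Longrightarrow> f \<in> L2 M"
  by (simp add: L2_def)

lemma borel_measurable_cnj [measurable (raw)]:
  "f \<in> borel_measurable M \<Longrightarrow> (\<lambda>x. cnj (f x)) \<in> borel_measurable M"
  by (rule measurable_compose[OF _ borel_measurable_continuous_onI])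
    (auto intro: continuous_intros)

lemma L2_measurable: "f \<in> L2 M \<Longrightarrow> f \<in> borel_measurable M"
  by (simp add: L2_def)

lemma L2_integrable: "f \<in> L2 M \<Longrightarrow> integrable M (\<lambda>x. (cmod (f x))\<^sup>2)"
  by (simp add: L2_def)

lemma L2_bound:
  assumes "f \<in> borel_measurable M" "integrable M g" "AE x in M. (cmod (f x))\<^sup>2 \<le> g x"
  shows "f \<in> L2 M"
proof (rule L2I)
  show "integrable M (\<lambda>x. (cmod (f x))\<^sup>2)"
    by (rule Bochner_Integration.integrable_bound[OF assms(2)])
      (use assms in \<open>auto elim!: eventually_mono\<close>)
qed fact

lemma L2_add:
  assumes "f \<in> L2 M" "g \<in> L2 M"
  shows "(\<lambda>x. f x + g x) \<in> L2 M"
proof (rule L2_bound)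
  show "integrable M (\<lambda>x. 2 * (cmod (f x))\<^sup>2 + 2 * (cmod (g x))\<^sup>2)"
    using assms by (intro Bochner_Integration.integrable_add integrable_mult_right L2_integrable)
  have "(cmod (a + b))\<^sup>2 \<le> 2 * (cmod a)\<^sup>2 + 2 * (cmod b)\<^sup>2" for a b
  proof -
    have "(cmod (a + b))\<^sup>2 \<le> (cmod a + cmod b)\<^sup>2"
      by (intro power_mono norm_triangle_ineq) auto
    also have "\<dots> \<le> 2 * (cmod a)\<^sup>2 + 2 * (cmod b)\<^sup>2"
      using sum_squares_bound[of "cmod a" "cmod b"] by (simp add: power2_sum)
    finally show ?thesis .
  qed
  thus "AE x in M. (cmod (f x + g x))\<^sup>2 \<le> 2 * (cmod (f x))\<^sup>2 + 2 * (cmod (g x))\<^sup>2" by simp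
qed (use L2_measurable[OF assms(1)] L2_measurable[OF assms(2)] in measurable)

lemma L2_cmult: "f \<in> L2 M \<Longrightarrow> (\<lambda>x. c * f x) \<in> L2 M"
  by (auto simp: L2_def norm_mult power_mult_distrib)

lemma L2_diff: "f \<in> L2 M \<Longrightarrow> g \<in> L2 M \<Longrightarrow> (\<lambda>x. f x - g x) \<in> L2 M"
  using L2_add[of f M "\<lambda>x. (-1) * g x"] L2_cmult[of g M "-1"] by simp

lemma L2_zero: "(\<lambda>x. 0) \<in> L2 M"
  by (simp add: L2_def)

lemma L2_sum: "(\<And>i. i \<in> I \<Longrightarrow> f i \<in> L2 M) \<Longrightarrow> (\<lambda>x. \<Sum>i\<in>I. f i x) \<in> L2 M"
  by (induction I rule: infinite_finite_induct) (auto intro: L2_zero L2_add)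

lemma L2_cong_AE:
  assumes "f \<in> L2 M" "AE x in M. f x = g x" "g \<in> borel_measurable M"
  shows "g \<in> L2 M"
  by (rule L2_bound[OF assms(3) L2_integrable[OF assms(1)]]) (use assms(2) in auto)

lemma L2_indicator:
  assumes "f \<in> L2 M" "A \<in> sets M"
  shows "(\<lambda>x. indicator A x * f x) \<in> L2 M"
  by (rule L2_bound[OF _ L2_integrable[OF assms(1)]])
    (use assms L2_measurable[OF assms(1)] in \<open>auto split: split_indicator intro!: borel_measurable_times\<close>)

lemma L2_integrable_mult:
  assumes "f \<in> L2 M" "g \<in> L2 M"
  shows "integrable M (\<lambda>x. f x * cnj (g x))"
proof (rule Bochner_Integration.integrable_bound)
  show "integrable M (\<lambda>x. (cmod (f x))\<^sup>2 + (cmod (g x))\<^sup>2)"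
    using assms by (auto intro: L2_integrable)
  have "cmod a * cmod b \<le> (cmod a)\<^sup>2 + (cmod b)\<^sup>2" for a b
    using sum_squares_bound[of "cmod a" "cmod b"]
      mult_nonneg_nonneg[OF norm_ge_zero[of a] norm_ge_zero[of b]] by linarith
  thus "AE x in M. norm (f x * cnj (g x)) \<le> norm ((cmod (f x))\<^sup>2 + (cmod (g x))\<^sup>2)"
    by (simp add: norm_mult)
qed (use L2_measurable[OF assms(1)] L2_measurable[OF assms(2)] in measurable)

lemma L2_norm_nonneg [simp]: "L2_norm M f \<ge> 0"
  by (simp add: L2_norm_def)

lemma L2_norm_power2: "(L2_norm M f)\<^sup>2 = (\<integral>x. (cmod (f x))\<^sup>2 \<partial>M)"
  by (simp add: L2_norm_def)

lemma L2_inner_self: "L2_inner M f f = of_real ((L2_norm M f)\<^sup>2)"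
  unfolding L2_norm_power2 L2_inner_def
  by (simp add: complex_norm_square[symmetric] del: of_real_power flip: integral_complex_of_real)

lemma L2_inner_diff_left:
  "f \<in> L2 M \<Longrightarrow> g \<in> L2 M \<Longrightarrow> h \<in> L2 M \<Longrightarrow>
   L2_inner M (\<lambda>x. f x - g x) h = L2_inner M f h - L2_inner M g h"
  by (simp add: L2_inner_def ring_distribs L2_integrable_mult)

lemma L2_inner_diff_right:
  "f \<in> L2 M \<Longrightarrow> g \<in> L2 M \<Longrightarrow> h \<in> L2 M \<Longrightarrow>
   L2_inner M h (\<lambda>x. f x - g x) = L2_inner M h f - L2_inner M h g"
  by (simp add: L2_inner_def ring_distribs L2_integrable_mult)

lemma L2_inner_commute: "L2_inner M g f = cnj (L2_inner M f g)"
  unfolding L2_inner_def by (subst Bochner_Integration.integral_cnj[symmetric]) (simp add: mult.commute)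

lemma L2_inner_sum_right:
  "finite I \<Longrightarrow> (\<And>i. i \<in> I \<Longrightarrow> f i \<in> L2 M) \<Longrightarrow> h \<in> L2 M \<Longrightarrow>
   L2_inner M h (\<lambda>x. \<Sum>i\<in>I. f i x) = (\<Sum>i\<in>I. L2_inner M h (f i))"
  by (simp add: L2_inner_def sum_distrib_left L2_integrable_mult)

lemma L2_inner_sum_left:
  "finite I \<Longrightarrow> (\<And>i. i \<in> I \<Longrightarrow> f i \<in> L2 M) \<Longrightarrow> h \<in> L2 M \<Longrightarrow>
   L2_inner M (\<lambda>x. \<Sum>i\<in>I. f i x) h = (\<Sum>i\<in>I. L2_inner M (f i) h)"
  by (simp add: L2_inner_def sum_distrib_right L2_integrable_mult)

lemma L2_inner_cong_AE:
  assumes "AE x in M. f x = f' x" "AE x in M. g x = g' x"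
    "f \<in> borel_measurable M" "f' \<in> borel_measurable M"
    "g \<in> borel_measurable M" "g' \<in> borel_measurable M"
  shows "L2_inner M f g = L2_inner M f' g'"
  unfolding L2_inner_def
  by (rule integral_cong_AE) (use assms in \<open>auto intro!: borel_measurable_times borel_measurable_cnj\<close>)

lemma L2_nn_integral:
  assumes "f \<in> L2 M"
  shows "(\<integral>\<^sup>+x. ennreal ((cmod (f x))\<^sup>2) \<partial>M) = ennreal ((L2_norm M f)\<^sup>2)"
  unfolding L2_norm_power2
  by (rule nn_integral_eq_integral) (use assms in \<open>auto intro: L2_integrable\<close>)

text \<open>Membership is tested through this criterion because the nonnegative integral reports a
  divergence as infinity, where the Bochner integral would report 0.\<close>

lemma L2_iff_nn_integral:
  assumes "f \<in> borel_measurable M"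
  shows "f \<in> L2 M \<longleftrightarrow> (\<integral>\<^sup>+x. ennreal ((cmod (f x))\<^sup>2) \<partial>M) < \<infinity>"
  using assms by (auto simp: L2_def integrable_iff_bounded)

lemma L2_Cauchy_Schwarz:
  assumes "f \<in> L2 M" "g \<in> L2 M"
  shows "(\<integral>x. cmod (f x) * cmod (g x) \<partial>M) \<le> L2_norm M f * L2_norm M g"
proof -
  note [measurable] = L2_measurable[OF assms(1)] L2_measurable[OF assms(2)]
  have int: "integrable M (\<lambda>x. cmod (f x) * cmod (g x))"
    using integrable_norm[OF L2_integrable_mult[OF assms]] by (simp add: norm_mult)
  let ?I = "\<integral>x. cmod (f x) * cmod (g x) \<partial>M"
  have "(ennreal ?I)\<^sup>2 = (\<integral>\<^sup>+x. ennreal (cmod (f x)) * ennreal (cmod (g x)) \<partial>M)\<^sup>2"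
    by (subst nn_integral_eq_integral[OF int, symmetric]) (auto simp: ennreal_mult)
  also have "\<dots> \<le> (\<integral>\<^sup>+x. (ennreal (cmod (f x)))\<^sup>2 \<partial>M) * (\<integral>\<^sup>+x. (ennreal (cmod (g x)))\<^sup>2 \<partial>M)"
    by (rule Cauchy_Schwarz_nn_integral) auto
  also have "\<dots> = ennreal ((L2_norm M f * L2_norm M g)\<^sup>2)"
    by (simp add: ennreal_power L2_nn_integral assms power_mult_distrib ennreal_mult)
  finally have "ennreal (?I\<^sup>2) \<le> ennreal ((L2_norm M f * L2_norm M g)\<^sup>2)"
    by (simp add: ennreal_power)
  hence "?I\<^sup>2 \<le> (L2_norm M f * L2_norm M g)\<^sup>2"
    by (simp add: ennreal_le_iff)
  thus ?thesis
    by (rule power2_le_imp_le) auto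
qed

lemma L2_inner_bound:
  assumes "f \<in> L2 M" "g \<in> L2 M"
  shows "cmod (L2_inner M f g) \<le> L2_norm M f * L2_norm M g"
proof -
  have "cmod (L2_inner M f g) \<le> (\<integral>x. cmod (f x * cnj (g x)) \<partial>M)"
    unfolding L2_inner_def by (rule integral_norm_bound)
  also have "\<dots> \<le> L2_norm M f * L2_norm M g"
    using L2_Cauchy_Schwarz[OF assms] by (simp add: norm_mult)
  finally show ?thesis .
qed

lemma L2_norm_triangle:
  assumes "f \<in> L2 M" "g \<in> L2 M"
  shows "L2_norm M (\<lambda>x. f x + g x) \<le> L2_norm M f + L2_norm M g"
proof (rule power2_le_imp_le)
  have int: "integrable M (\<lambda>x. cmod (f x) * cmod (g x))"
    using integrable_norm[OF L2_integrable_mult[OF assms]] by (simp add: norm_mult)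
  have "(L2_norm M (\<lambda>x. f x + g x))\<^sup>2 \<le>
      (\<integral>x. (cmod (f x))\<^sup>2 + 2 * (cmod (f x) * cmod (g x)) + (cmod (g x))\<^sup>2 \<partial>M)"
    unfolding L2_norm_power2
  proof (rule integral_mono)
    fix x
    have "(cmod (f x + g x))\<^sup>2 \<le> (cmod (f x) + cmod (g x))\<^sup>2"
      by (intro power_mono norm_triangle_ineq) auto
    thus "(cmod (f x + g x))\<^sup>2 \<le> (cmod (f x))\<^sup>2 + 2 * (cmod (f x) * cmod (g x)) + (cmod (g x))\<^sup>2"
      by (simp add: power2_sum)
  qed (use assms int in \<open>auto intro!: L2_integrable L2_add Bochner_Integration.integrable_add\<close>)
  also have "\<dots> = (L2_norm M f)\<^sup>2 + 2 * (\<integral>x. cmod (f x) * cmod (g x) \<partial>M) + (L2_norm M g)\<^sup>2"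
    using assms int by (simp add: L2_norm_power2 L2_integrable)
  also have "\<dots> \<le> (L2_norm M f + L2_norm M g)\<^sup>2"
    using L2_Cauchy_Schwarz[OF assms] by (simp add: power2_sum)
  finally show "(L2_norm M (\<lambda>x. f x + g x))\<^sup>2 \<le> (L2_norm M f + L2_norm M g)\<^sup>2" .
qed simp

lemma L2_norm_minus_commute: "L2_norm M (\<lambda>x. f x - g x) = L2_norm M (\<lambda>x. g x - f x)"
  by (simp add: L2_norm_def norm_minus_commute)

lemma L2_norm_triangle_diff:
  assumes "f \<in> L2 M" "g \<in> L2 M" "h \<in> L2 M"
  shows "L2_norm M (\<lambda>x. f x - h x) \<le> L2_norm M (\<lambda>x. f x - g x) + L2_norm M (\<lambda>x. g x - h x)"
  using L2_norm_triangle[of "\<lambda>x. f x - g x" M "\<lambda>x. g x - h x"] assms by (simp add: L2_diff)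

lemma L2_norm_diff_norm:
  assumes "f \<in> L2 M" "g \<in> L2 M"
  shows "\<bar>L2_norm M f - L2_norm M g\<bar> \<le> L2_norm M (\<lambda>x. f x - g x)"
  using L2_norm_triangle[of "\<lambda>x. f x - g x" M g] L2_norm_triangle[of "\<lambda>x. g x - f x" M f] assms
  by (simp add: L2_diff L2_norm_minus_commute[of M f g] abs_le_iff)

lemma L2_norm_cong_AE:
  "AE x in M. f x = g x \<Longrightarrow> f \<in> borel_measurable M \<Longrightarrow> g \<in> borel_measurable M \<Longrightarrow>
    L2_norm M f = L2_norm M g"
  unfolding L2_norm_def by (subst integral_cong_AE[where g = "\<lambda>x. (cmod (g x))\<^sup>2"]) auto

lemma L2_norm_eq_0:
  assumes "f \<in> L2 M" "L2_norm M f = 0"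
  shows "AE x in M. f x = 0"
proof -
  have "(\<integral>x. (cmod (f x))\<^sup>2 \<partial>M) = 0"
    using assms(2) by (simp add: L2_norm_def)
  thus ?thesis
    using integral_nonneg_eq_0_iff_AE[OF L2_integrable[OF assms(1)]] by simp
qed

text \<open>The difference splits into the pairing of \<open>f i - f'\<close> with
  \<open>g i\<close> and that of \<open>f'\<close> with \<open>g i - g'\<close>, and the norm of
  \<open>g i\<close> is at most that of \<open>g'\<close> plus a null term. The filter is arbitrary
  because the cutoffs below are indexed by a real radius.\<close>

lemma L2_inner_tendsto:
  assumes f: "\<And>i. f i \<in> L2 M" "f' \<in> L2 M" "((\<lambda>i. L2_norm M (\<lambda>x. f i x - f' x)) \<longlongrightarrow> 0) F"
    and g: "\<And>i. g i \<in> L2 M" "g' \<in> L2 M" "((\<lambda>i. L2_norm M (\<lambda>x. g i x - g' x)) \<longlongrightarrow> 0) F"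
  shows "((\<lambda>i. L2_inner M (f i) (g i)) \<longlongrightarrow> L2_inner M f' g') F"
proof (rule Lim_null_comparison[THEN LIM_zero_cancel])
  let ?a = "\<lambda>i. L2_norm M (\<lambda>x. f i x - f' x)" and ?b = "\<lambda>i. L2_norm M (\<lambda>x. g i x - g' x)"
  have "cmod (L2_inner M (f i) (g i) - L2_inner M f' g') \<le> ?a i * (?b i + L2_norm M g') + L2_norm M f' * ?b i" for i
  proof -
    have "L2_inner M (f i) (g i) - L2_inner M f' g' =
        L2_inner M (\<lambda>x. f i x - f' x) (g i) + L2_inner M f' (\<lambda>x. g i x - g' x)"
      using f g by (simp add: L2_inner_diff_left L2_inner_diff_right)
    also have "cmod \<dots> \<le> ?a i * L2_norm M (g i) + L2_norm M f' * ?b i"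
      using f g by (intro norm_triangle_mono L2_inner_bound L2_diff)
    also have "L2_norm M (g i) \<le> ?b i + L2_norm M g'"
      using L2_norm_triangle[of "\<lambda>x. g i x - g' x" M g'] f g by (simp add: L2_diff)
    finally show ?thesis by (simp add: mult_left_mono)
  qed
  thus "\<forall>\<^sub>F i in F. norm (L2_inner M (f i) (g i) - L2_inner M f' g') \<le>
      ?a i * (?b i + L2_norm M g') + L2_norm M f' * ?b i" by simp
  have "((\<lambda>i. ?a i * (?b i + L2_norm M g') + L2_norm M f' * ?b i) \<longlongrightarrow>
     0 * (0 + L2_norm M g') + L2_norm M f' * 0) F"
    by (intro tendsto_intros f g)
  thus "((\<lambda>i. ?a i * (?b i + L2_norm M g') + L2_norm M f' * ?b i) \<longlongrightarrow> 0) F" by simp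
qed

text \<open>Fatou's lemma for the squared moduli. Besides the bound it delivers square integrability
  of the limit, which is how pointwise limits enter \<open>L2 M\<close>.\<close>

lemma L2_norm_Fatou:
  assumes f: "\<And>i. f i \<in> L2 M" and g: "g \<in> borel_measurable M"
    and lim: "AE x in M. (\<lambda>i. f i x) \<longlonglongrightarrow> g x"
    and bound: "\<forall>\<^sub>F i in sequentially. L2_norm M (f i) \<le> C"
  shows "g \<in> L2 M" "L2_norm M g \<le> C"
proof -
  have C: "C \<ge> 0"
    using eventually_happens[OF bound] L2_norm_nonneg order_trans by (auto; blast)
  have "(\<integral>\<^sup>+x. ennreal ((cmod (g x))\<^sup>2) \<partial>M) = (\<integral>\<^sup>+x. liminf (\<lambda>i. ennreal ((cmod (f i x))\<^sup>2)) \<partial>M)"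
  proof (rule nn_integral_cong_AE, use lim in eventually_elim)
    case (elim x)
    hence "(\<lambda>i. ennreal ((cmod (f i x))\<^sup>2)) \<longlonglongrightarrow> ennreal ((cmod (g x))\<^sup>2)"
      by (intro tendsto_intros)
    from lim_imp_Liminf[OF _ this] show ?case by simp
  qed
  also have "\<dots> \<le> liminf (\<lambda>i. \<integral>\<^sup>+x. ennreal ((cmod (f i x))\<^sup>2) \<partial>M)"
    by (rule nn_integral_liminf) (use L2_measurable[OF f] in measurable)
  also have "\<dots> \<le> liminf (\<lambda>i. ennreal (C\<^sup>2))"
    by (rule Liminf_mono, use bound in eventually_elim)
      (simp add: L2_nn_integral[OF f] ennreal_leI power_mono)
  also have "\<dots> = ennreal (C\<^sup>2)"
    by (simp add: Liminf_const)
  finally have *: "(\<integral>\<^sup>+x. ennreal ((cmod (g x))\<^sup>2) \<partial>M) \<le> ennreal (C\<^sup>2)" .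
  show "g \<in> L2 M"
    unfolding L2_iff_nn_integral[OF g] using le_less_trans[OF *] by simp
  hence "(L2_norm M g)\<^sup>2 \<le> C\<^sup>2"
    using * by (simp add: L2_nn_integral)
  thus "L2_norm M g \<le> C"
    using C by (rule power2_le_imp_le)
qed

text \<open>Under a map that preserves the norms of all differences, mean convergence of the arguments
  and pointwise convergence of the images already give mean convergence of the images.\<close>

lemma L2_isometry_limit:
  assumes f: "\<And>i. f i \<in> L2 M" "g \<in> L2 M" "(\<lambda>i. L2_norm M (\<lambda>x. f i x - g x)) \<longlonglongrightarrow> 0"
    and F: "\<And>i. F i \<in> L2 M'" "G \<in> borel_measurable M'" "AE x in M'. (\<lambda>i. F i x) \<longlonglongrightarrow> G x"
    and iso: "\<And>i. L2_norm M' (F i) = L2_norm M (f i)"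
      "\<And>i j. L2_norm M' (\<lambda>x. F i x - F j x) = L2_norm M (\<lambda>x. f i x - f j x)"
  shows "G \<in> L2 M'" "L2_norm M' G = L2_norm M g"
proof -
  have lim_norm: "(\<lambda>i. L2_norm M (f i)) \<longlonglongrightarrow> L2_norm M g"
    by (rule LIM_zero_cancel, rule Lim_null_comparison[OF _ f(3)])
      (auto intro!: always_eventually L2_norm_diff_norm f)
  show G: "G \<in> L2 M'"
  proof (rule L2_norm_Fatou(1))
    show "\<forall>\<^sub>F i in sequentially. L2_norm M' (F i) \<le> L2_norm M g + 1"
      using order_tendstoD(2)[OF lim_norm, of "L2_norm M g + 1"] iso(1)
      by (auto elim!: eventually_mono)
  qed fact+
  \<comment> \<open>For fixed \<open>i\<close>, \<open>F i - G\<close> is the pointwise limit of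
    \<open>F i - F j\<close> in \<open>j\<close>. By Fatou its norm is controlled by those of
    \<open>f i - f j\<close>, which the triangle inequality through \<open>g\<close> bounds by twice
    \<open>e / 3\<close>.\<close>
  have "(\<lambda>i. L2_norm M' (\<lambda>x. F i x - G x)) \<longlonglongrightarrow> 0"
  proof (rule LIMSEQ_I)
    fix e :: real assume "e > 0"
    then obtain n0 where n0: "\<And>i. i \<ge> n0 \<Longrightarrow> L2_norm M (\<lambda>x. f i x - g x) < e / 3"
      using LIMSEQ_D[OF f(3), of "e / 3"] by auto
    have "L2_norm M' (\<lambda>x. F i x - G x) < e" if "i \<ge> n0" for i
    proof -
      have "L2_norm M' (\<lambda>x. F i x - G x) \<le> 2 * e / 3"
      proof (rule L2_norm_Fatou(2))
        show "AE x in M'. (\<lambda>j. F i x - F j x) \<longlonglongrightarrow> F i x - G x"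
          using F(3) by eventually_elim (intro tendsto_intros)
        show "\<forall>\<^sub>F j in sequentially. L2_norm M' (\<lambda>x. F i x - F j x) \<le> 2 * e / 3"
          using eventually_ge_at_top[of n0]
        proof eventually_elim
          case (elim j)
          show ?case
            using L2_norm_triangle_diff[OF f(1)[of i] f(2) f(1)[of j]] n0[OF that] n0[OF elim]
            by (simp add: iso L2_norm_minus_commute[of M g])
        qed
      qed (use F(1) G in \<open>auto intro!: L2_diff L2_measurable\<close>)
      thus ?thesis using \<open>e > 0\<close> by simp
    qed
    thus "\<exists>no. \<forall>n\<ge>no. norm (L2_norm M' (\<lambda>x. F n x - G x) - 0) < e" by auto
  qed
  from Lim_null_comparison[OF _ this, of "\<lambda>i. L2_norm M' (F i) - L2_norm M' G"]
  have "(\<lambda>i. L2_norm M' (F i)) \<longlonglongrightarrow> L2_norm M' G"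
    by (auto simp: LIM_zero_iff L2_norm_diff_norm F G)
  thus "L2_norm M' G = L2_norm M g"
    using lim_norm by (simp add: iso LIMSEQ_unique)
qed

text \<open>On an infinite measure space \<open>L2\<close> is not contained in \<open>L1\<close>.
  Multiplication by a nowhere vanishing square integrable weight \<open>w\<close> sends a Cauchy
  sequence in \<open>L2\<close> to one in \<open>L1\<close>, which has an almost everywhere
  convergent subsequence; dividing by \<open>w\<close> carries this pointwise limit back.\<close>

lemma L2_complete:
  assumes w: "(\<lambda>x. of_real (w x)) \<in> L2 M" "\<And>x. x \<in> space M \<Longrightarrow> w x \<noteq> 0"
    and f: "\<And>i::nat. f i \<in> L2 M"
    and cauchy: "\<And>e. e > 0 \<Longrightarrow> \<exists>n. \<forall>i\<ge>n. \<forall>j\<ge>n. L2_norm M (\<lambda>x. f i x - f j x) < e"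
  shows "\<exists>g\<in>L2 M. (\<lambda>i. L2_norm M (\<lambda>x. f i x - g x)) \<longlonglongrightarrow> 0"
proof -
  note [measurable] = L2_measurable[OF f] L2_measurable[OF w(1)]
  let ?s = "\<lambda>i x. f i x * of_real (w x)"
  have int: "integrable M (?s i)" for i
    using L2_integrable_mult[OF f[of i] w(1)] by simp
  have "\<exists>n. \<forall>i\<ge>n. \<forall>j\<ge>n. (LINT x|M. norm (?s i x - ?s j x)) < e" if "e > 0" for e
  proof -
    let ?W = "L2_norm M (\<lambda>x. of_real (w x))"
    obtain n where n: "\<And>i j. i \<ge> n \<Longrightarrow> j \<ge> n \<Longrightarrow> L2_norm M (\<lambda>x. f i x - f j x) < e / (?W + 1)"
      using cauchy[of "e / (?W + 1)"] \<open>e > 0\<close> by (auto simp: add_nonneg_pos)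
    have "(LINT x|M. norm (?s i x - ?s j x)) < e" if "i \<ge> n" "j \<ge> n" for i j
    proof -
      have "(LINT x|M. norm (?s i x - ?s j x)) \<le> L2_norm M (\<lambda>x. f i x - f j x) * ?W"
        using L2_Cauchy_Schwarz[OF L2_diff[OF f[of i] f[of j]] w(1)]
        by (simp add: norm_mult flip: left_diff_distrib)
      also have "\<dots> \<le> e / (?W + 1) * ?W"
        using n[OF that] by (intro mult_right_mono) auto
      also have "\<dots> < e"
        using \<open>e > 0\<close> L2_norm_nonneg[of M "\<lambda>x. of_real (w x)"]
        by (simp add: divide_less_eq algebra_simps not_less)
      finally show ?thesis .
    qed
    thus ?thesis by blast
  qed
  then obtain r where r: "strict_mono r" "AE x in M. Cauchy (\<lambda>i. ?s (r i) x)"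
    by (rule cauchy_L1_AE_cauchy_subseq[OF int])
  define g where "g x = lim (\<lambda>i. f (r i) x)" for x
  have g_meas [measurable]: "g \<in> borel_measurable M"
    unfolding g_def by measurable
  have lim: "AE x in M. (\<lambda>i. f (r i) x) \<longlonglongrightarrow> g x"
    using r(2) AE_space
  proof eventually_elim
    case (elim x)
    then obtain l where "(\<lambda>i. ?s (r i) x) \<longlonglongrightarrow> l"
      by (auto simp: Cauchy_convergent_iff convergent_def)
    hence "(\<lambda>i. ?s (r i) x / of_real (w x)) \<longlonglongrightarrow> l / of_real (w x)"
      using w(2)[OF elim(2)] by (intro tendsto_intros) auto
    hence "(\<lambda>i. f (r i) x) \<longlonglongrightarrow> l / of_real (w x)"
      using w(2)[OF elim(2)] by simp
    thus ?case
      unfolding g_def by (simp add: limI)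
  qed
  \<comment> \<open>With \<open>i\<close> fixed, Fatou is applied to \<open>f i - f (r j)\<close>;
    the subsequence stays beyond \<open>n\<close> because \<open>r j \<ge> j\<close>.\<close>
  have close: "(\<lambda>x. f i x - g x) \<in> L2 M \<and> L2_norm M (\<lambda>x. f i x - g x) \<le> e"
    if n: "\<forall>i\<ge>n. \<forall>j\<ge>n. L2_norm M (\<lambda>x. f i x - f j x) < e" and "i \<ge> n" for n e i
  proof -
    have 1: "AE x in M. (\<lambda>j. f i x - f (r j) x) \<longlonglongrightarrow> f i x - g x"
      using lim by eventually_elim (intro tendsto_intros)
    have 2: "\<forall>\<^sub>F j in sequentially. L2_norm M (\<lambda>x. f i x - f (r j) x) \<le> e"
      using eventually_ge_at_top[of n]
    proof eventually_elim
      case (elim j)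
      have "r j \<ge> n" using seq_suble[OF r(1), of j] elim by simp
      thus ?case using n \<open>i \<ge> n\<close> by (simp add: less_imp_le)
    qed
    have 3: "(\<lambda>x. f i x - g x) \<in> borel_measurable M" by measurable
    show ?thesis
      using L2_norm_Fatou[where f = "\<lambda>j x. f i x - f (r j) x", OF L2_diff[OF f f] 3 1 2] by blast
  qed
  obtain n1 where n1: "\<forall>i\<ge>n1. \<forall>j\<ge>n1. L2_norm M (\<lambda>x. f i x - f j x) < 1"
    using cauchy[of 1] zero_less_one by blast
  have "(\<lambda>x. f n1 x - (f n1 x - g x)) \<in> L2 M"
    by (rule L2_diff[OF f conjunct1[OF close[OF n1 order_refl]]])
  hence "g \<in> L2 M" by simp
  moreover have "(\<lambda>i. L2_norm M (\<lambda>x. f i x - g x)) \<longlonglongrightarrow> 0"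
  proof (rule LIMSEQ_I)
    fix e :: real assume "e > 0"
    then obtain n where "\<forall>i\<ge>n. \<forall>j\<ge>n. L2_norm M (\<lambda>x. f i x - f j x) < e / 2"
      using cauchy[OF half_gt_zero] by blast
    hence "L2_norm M (\<lambda>x. f i x - g x) \<le> e / 2" if "i \<ge> n" for i
      using close that by blast
    hence "\<forall>i\<ge>n. norm (L2_norm M (\<lambda>x. f i x - g x) - 0) < e"
      using \<open>e > 0\<close> by fastforce
    thus "\<exists>no. \<forall>n\<ge>no. norm (L2_norm M (\<lambda>x. f n x - g x) - 0) < e" by blast
  qed
  ultimately show ?thesis by blast
qed

section \<open>Bessel functions of integer order\<close>

text \<open>Splitting \<open>J_n(x)\<close> into \<open>x ^ n\<close> and a power series in
  \<open>x\<^sup>2\<close> pays off in the plane: the second factor becomes an entire function of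
  the squared norm, and the first combines with the angular part into a polynomial.\<close>

definition bessel_coeff :: "nat \<Rightarrow> nat \<Rightarrow> real" where
  "bessel_coeff n m = (-1) ^ m / (fact m * fact (m + n) * 2 ^ (2 * m + n))"

definition bessel_entire :: "nat \<Rightarrow> real \<Rightarrow> real" where
  "bessel_entire n u = (\<Sum>m. bessel_coeff n m * u ^ m)"

text \<open>In contrast to \<^const>\<open>bessel_J\<close>, this has the right value also at the origin.\<close>

definition bessel_nat :: "nat \<Rightarrow> real \<Rightarrow> real" where
  "bessel_nat n x = x ^ n * bessel_entire n (x\<^sup>2)"

text \<open>Every factor of the denominator is at least 1. Keeping only \<open>fact m\<close> puts
  the series below the exponential series, which settles absolute convergence everywhere.\<close>

lemma abs_bessel_coeff_le: "\<bar>bessel_coeff n m\<bar> \<le> 1 / fact m"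
proof -
  have "(1::real) \<le> fact (m + n) * 2 ^ (2 * m + n)"
    using mult_mono[of 1 "fact (m + n)" 1 "2 ^ (2 * m + n) :: real"]
    by (simp add: fact_ge_1)
  hence "(fact m :: real) * 1 \<le> fact m * (fact (m + n) * 2 ^ (2 * m + n))"
    by (intro mult_left_mono) auto
  hence "1 / (fact m * (fact (m + n) * 2 ^ (2 * m + n))) \<le> 1 / (fact m :: real)"
    by (intro divide_left_mono) auto
  thus ?thesis
    by (simp add: bessel_coeff_def abs_mult power_abs mult.assoc)
qed

lemma summable_abs_bessel: "summable (\<lambda>m. \<bar>bessel_coeff n m * u ^ m\<bar>)"
proof (rule summable_comparison_test')
  show "summable (\<lambda>m. inverse (fact m) * \<bar>u\<bar> ^ m)" by (rule summable_exp)
  show "norm \<bar>bessel_coeff n m * u ^ m\<bar> \<le> inverse (fact m) * \<bar>u\<bar> ^ m" for m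
    using mult_right_mono[OF abs_bessel_coeff_le[of n m], of "\<bar>u\<bar> ^ m"]
    by (simp add: abs_mult power_abs inverse_eq_divide)
qed

lemma bessel_entire_sums: "(\<lambda>m. bessel_coeff n m * u ^ m) sums bessel_entire n u"
  unfolding bessel_entire_def by (rule summable_sums[OF summable_rabs_cancel[OF summable_abs_bessel]])

lemma isCont_bessel_entire: "isCont (bessel_entire n) u"
  unfolding bessel_entire_def[abs_def]
  by (rule isCont_powser_converges_everywhere) (rule sums_summable[OF bessel_entire_sums])

lemma continuous_on_bessel_entire [continuous_intros]:
  "continuous_on S f \<Longrightarrow> continuous_on S (\<lambda>x. bessel_entire n (f x))"
  by (rule continuous_on_compose2[OF continuous_at_imp_continuous_on[of UNIV]])
    (auto simp: isCont_bessel_entire)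

lemma continuous_on_bessel_nat [continuous_intros]:
  "continuous_on S f \<Longrightarrow> continuous_on S (\<lambda>x. bessel_nat n (f x))"
  unfolding bessel_nat_def by (intro continuous_intros)

lemma borel_measurable_bessel_nat [measurable (raw)]:
  "f \<in> borel_measurable M \<Longrightarrow> (\<lambda>x. bessel_nat n (f x)) \<in> borel_measurable M"
  by (rule measurable_compose[OF _ borel_measurable_continuous_onI])
    (auto intro: continuous_intros)

lemma power_commuting: "(x ^ m) ^ n = (x ^ n) ^ m" for x :: "'a :: monoid_mult"
  by (simp add: mult.commute flip: power_mult)

lemma bessel_nat_sums: "(\<lambda>m. (-1) ^ m / (fact m * fact (m + n)) * (x / 2) ^ (2 * m + n)) sums bessel_nat n x"
proof -
  have "(\<lambda>m. x ^ n * (bessel_coeff n m * (x\<^sup>2) ^ m)) sums bessel_nat n x"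
    unfolding bessel_nat_def by (intro sums_mult bessel_entire_sums)
  also have "(\<lambda>m. x ^ n * (bessel_coeff n m * (x\<^sup>2) ^ m)) =
     (\<lambda>m. (-1) ^ m / (fact m * fact (m + n)) * (x / 2) ^ (2 * m + n))"
    by (simp add: bessel_coeff_def power_divide power_add power_mult power_commuting[of x 2] mult_ac)
  finally show ?thesis .
qed

lemma summable_abs_bessel_nat:
  "summable (\<lambda>m. \<bar>(-1) ^ m / (fact m * fact (m + n)) * (x / 2) ^ (2 * m + n)\<bar>)" for x :: real
proof -
  have "summable (\<lambda>m. \<bar>x\<bar> ^ n * \<bar>bessel_coeff n m * (x\<^sup>2) ^ m\<bar>)"
    by (intro summable_mult summable_abs_bessel)
  also have "(\<lambda>m. \<bar>x\<bar> ^ n * \<bar>bessel_coeff n m * (x\<^sup>2) ^ m\<bar>) =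
     (\<lambda>m. \<bar>(-1) ^ m / (fact m * fact (m + n)) * (x / 2) ^ (2 * m + n)\<bar>)"
    by (simp add: bessel_coeff_def power_divide power_add power_mult power_commuting[of x 2] abs_mult power_abs mult_ac)
  finally show ?thesis .
qed

lemma bessel_nat_has_sum:
  "((\<lambda>m. (-1) ^ m / (fact m * fact (m + n)) * (x / 2) ^ (2 * m + n)) has_sum bessel_nat n x) UNIV"
  by (rule norm_summable_imp_has_sum[OF _ bessel_nat_sums], unfold real_norm_def, rule summable_abs_bessel_nat)

lemma bessel_J_of_nat:
  assumes "x > 0"
  shows "bessel_J (real n) x = bessel_nat n x"
proof -
  have "Gamma (real m + real n + 1) = fact (m + n)" for m
    using Gamma_fact[of "m + n", where ?'a = real] by (simp add: add_ac)
  moreover have "(x / 2) powr (2 * real m + real n) = (x / 2) ^ (2 * m + n)" for m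
    using assms powr_realpow[of "x / 2" "2 * m + n"] by simp
  ultimately show ?thesis
    unfolding bessel_J_def sums_unique[OF bessel_nat_sums] by simp
qed

lemma bessel_nat_0: "bessel_nat n 0 = (if n = 0 then 1 else 0)"
  using powser_sums_zero_iff[of "bessel_coeff n" "bessel_entire n 0"] bessel_entire_sums[of n 0]
  by (auto simp: bessel_nat_def bessel_coeff_def)

section \<open>The generating function of the Bessel functions of integer order\<close>

definition bessel_int :: "real \<Rightarrow> int \<Rightarrow> real" where
  "bessel_int z n = (if n \<ge> 0 then bessel_nat (nat n) z else (-1) ^ nat (- n) * bessel_nat (nat (- n)) z)"

lemma bessel_int_power2: "(bessel_int z n)\<^sup>2 = (bessel_nat (nat \<bar>n\<bar>) z)\<^sup>2"
  by (auto simp: bessel_int_def power_mult_distrib simp flip: power_mult)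

text \<open>Over the complex numbers unconditional summability is absolute, so the norms of the
  products are summable on the whole rectangle; the value is then found by summing in one variable
  after the other.\<close>

lemma has_sum_times:
  fixes f :: "'a \<Rightarrow> complex" and g :: "'b \<Rightarrow> complex"
  assumes f: "(f has_sum a) A" and g: "(g has_sum b) B"
  shows "((\<lambda>(x, y). f x * g y) has_sum (a * b)) (A \<times> B)"
proof (rule has_sum_SigmaI)
  show "((\<lambda>y. case (x, y) of (x, y) \<Rightarrow> f x * g y) has_sum f x * b) B" for x
    using has_sum_cmult_right[OF g] by simp
  show "((\<lambda>x. f x * b) has_sum a * b) A"
    by (rule has_sum_cmult_left[OF f])
  have "(\<lambda>(x, y). norm (f x) * norm (g y)) summable_on A \<times> B"
  proof (rule summable_on_SigmaI)
    have g': "(\<lambda>y. norm (g y)) summable_on B"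
      using has_sum_imp_summable[OF g] by (simp add: summable_on_iff_abs_summable_on_complex)
    show "((\<lambda>y. case (x, y) of (x, y) \<Rightarrow> norm (f x) * norm (g y)) has_sum
        norm (f x) * infsum (\<lambda>y. norm (g y)) B) B" for x
      using has_sum_cmult_right[OF has_sum_infsum[OF g']] by simp
    have "(\<lambda>x. norm (f x)) summable_on A"
      using has_sum_imp_summable[OF f] by (simp add: summable_on_iff_abs_summable_on_complex)
    thus "(\<lambda>x. norm (f x) * infsum (\<lambda>y. norm (g y)) B) summable_on A"
      by (rule summable_on_cmult_left)
  qed auto
  hence "(\<lambda>x. norm (case x of (x, y) \<Rightarrow> f x * g y)) summable_on A \<times> B"
    by (simp add: case_prod_unfold norm_mult)
  thus "(\<lambda>(x, y). f x * g y) summable_on A \<times> B"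
    by (rule abs_summable_summable)
qed

lemma exp_has_sum: "((\<lambda>n. x ^ n / fact n) has_sum exp x) UNIV" for x :: complex
proof (rule norm_summable_imp_has_sum)
  show "summable (\<lambda>n. norm (x ^ n / fact n))"
    using summable_exp[of "norm x"] by (simp add: norm_divide norm_power divide_inverse norm_mult norm_inverse mult.commute)
  show "(\<lambda>n. x ^ n / fact n) sums exp x"
    using exp_converges[of x] by (simp add: scaleR_conv_of_real divide_inverse mult.commute)
qed

text \<open>The Jacobi-Anger expansion. Since
  \<open>2 \<i> sin \<theta> = cis \<theta> - cis (- \<theta>)\<close>, the right-hand side is a
  product of two exponential series, hence a double series over \<open>(p, q)\<close>; the terms
  with \<open>p - q = n\<close> add up to the series of \<open>J_n\<close>. For negative
  \<open>n\<close> the surplus of factors with a minus sign produces the sign in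
  \<open>bessel_int\<close>, that is, \<open>J_{-n} = (-1)^n J_n\<close>.\<close>

lemma bessel_generating_function:
  "((\<lambda>n. of_real (bessel_int z n) * cis (of_int n * \<theta>)) has_sum exp (\<i> * of_real (z * sin \<theta>))) UNIV"
proof -
  define a where "a p = (of_real (z / 2) * cis \<theta>) ^ p / fact p" for p
  define b where "b q = (of_real (- (z / 2)) * cis (- \<theta>)) ^ q / fact q" for q
  \<comment> \<open>Pairs \<open>(p, q)\<close> are recoded by \<open>n = p - q\<close> and
    \<open>k = min p q\<close>.\<close>
  define h :: "int \<times> nat \<Rightarrow> nat \<times> nat" where
    "h = (\<lambda>(n, k). (k + nat n, k + nat (- n)))"
  have ab: "((\<lambda>(p, q). a p * b q) has_sum
      (exp (of_real (z / 2) * cis \<theta>) * exp (of_real (- (z / 2)) * cis (- \<theta>)))) (UNIV \<times> UNIV)"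
    unfolding a_def b_def by (intro has_sum_times exp_has_sum)
  have ex: "exp (of_real (z / 2) * cis \<theta>) * exp (of_real (- (z / 2)) * cis (- \<theta>)) =
      exp (\<i> * of_real (z * sin \<theta>))"
  proof -
    have "of_real (z / 2) * cis \<theta> + of_real (- (z / 2)) * cis (- \<theta>) = \<i> * of_real (z * sin \<theta>)"
      by (simp add: complex_eq_iff)
    thus ?thesis by (simp only: exp_add[symmetric])
  qed
  have bij: "bij_betw h (UNIV \<times> UNIV) (UNIV \<times> UNIV)"
    by (rule bij_betwI[where g = "\<lambda>(p, q). (int p - int q, min p q)"]) (auto simp: h_def)
  have "((\<lambda>x. case h x of (p, q) \<Rightarrow> a p * b q) has_sum exp (\<i> * of_real (z * sin \<theta>))) (UNIV \<times> UNIV)"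
    using ab unfolding ex has_sum_reindex_bij_betw[OF bij] .
  thus ?thesis
  proof (rule has_sum_SigmaD)
    fix n :: int
    have *: "a p * b q = of_real ((-1) ^ q / (fact q * fact p) * (z / 2) ^ (p + q)) * cis (of_int (int p - int q) * \<theta>)"
      for p q
    proof -
      have "a p * b q = (of_real (z / 2) ^ p * of_real (- (z / 2)) ^ q / (fact q * fact p)) *
          (cis (real p * \<theta>) * cis (real q * - \<theta>))"
        unfolding a_def b_def power_mult_distrib Complex.DeMoivre by (simp add: mult_ac)
      also have "cis (real p * \<theta>) * cis (real q * - \<theta>) = cis (of_int (int p - int q) * \<theta>)"
        by (simp add: cis_mult algebra_simps)
      also have "of_real (z / 2) ^ p * of_real (- (z / 2)) ^ q / (fact q * fact p) =
          complex_of_real ((-1) ^ q / (fact q * fact p) * (z / 2) ^ (p + q))"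
        by (simp add: power_add power_minus[of "complex_of_real z / 2"] mult_ac)
      finally show ?thesis .
    qed
    have "(case h (n, k) of (p, q) \<Rightarrow> a p * b q) = (of_real (if n \<ge> 0 then 1 else (-1) ^ nat (- n)) *
       cis (of_int n * \<theta>)) * of_real ((-1) ^ k / (fact k * fact (k + nat \<bar>n\<bar>)) * (z / 2) ^ (2 * k + nat \<bar>n\<bar>))" for k
    proof (cases "n \<ge> 0")
      case True
      thus ?thesis
        by (simp add: h_def * mult_2 mult_2_right add_ac mult_ac)
    next
      case False
      thus ?thesis
        by (simp add: h_def * mult_2 mult_2_right add_ac mult_ac power_add)
    qed
    moreover have "((\<lambda>k. (of_real (if n \<ge> 0 then 1 else (-1) ^ nat (- n)) *
       cis (of_int n * \<theta>)) * of_real ((-1) ^ k / (fact k * fact (k + nat \<bar>n\<bar>)) * (z / 2) ^ (2 * k + nat \<bar>n\<bar>)))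
       has_sum ((of_real (if n \<ge> 0 then 1 else (-1) ^ nat (- n)) * cis (of_int n * \<theta>)) * of_real (bessel_nat (nat \<bar>n\<bar>) z))) UNIV"
      by (intro has_sum_cmult_right has_sum_of_real bessel_nat_has_sum)
    ultimately show "((\<lambda>k. case h (n, k) of (p, q) \<Rightarrow> a p * b q) has_sum
        of_real (bessel_int z n) * cis (of_int n * \<theta>)) UNIV"
      by (simp add: bessel_int_def mult_ac split: if_splits)
  qed
qed

section \<open>Fourier analysis for a uniformly distributed angle\<close>

definition circle_measure :: "real measure" where
  "circle_measure = density lborel (\<lambda>\<theta>. ennreal (indicator {-pi..pi} \<theta> / (2 * pi)))"

lemma sets_circle_measure [simp, measurable_cong]: "sets circle_measure = sets borel"
  and space_circle_measure [simp]: "space circle_measure = UNIV"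
  by (simp_all add: circle_measure_def)

lemma prob_space_circle_measure: "prob_space circle_measure"
proof
  have "emeasure circle_measure UNIV = (\<integral>\<^sup>+\<theta>. ennreal (1 / (2 * pi)) * indicator {-pi..pi} \<theta> \<partial>lborel)"
    unfolding circle_measure_def
    by (subst emeasure_density) (auto intro!: nn_integral_cong split: split_indicator)
  also have "\<dots> = ennreal (1 / (2 * pi)) * ennreal (2 * pi)"
    by (subst nn_integral_cmult_indicator) auto
  also have "\<dots> = 1"
    by (subst ennreal_mult[symmetric]) auto
  finally show "emeasure circle_measure (space circle_measure) = 1" by simp
qed

interpretation circle: prob_space circle_measure
  by (rule prob_space_circle_measure)

lemma measure_circle_UNIV [simp]: "measure circle_measure UNIV = 1"
  using circle.prob_space by simp

lemma integrable_circle_measure: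
  fixes f :: "real \<Rightarrow> 'a :: {banach, second_countable_topology}"
  assumes "f \<in> borel_measurable borel" "\<And>\<theta>. norm (f \<theta>) \<le> B"
  shows "integrable circle_measure f"
  by (rule circle.integrable_const_bound[where B = B]) (use assms in auto)

text \<open>For \<open>k \<noteq> 0\<close> the antiderivative
  \<open>cis (k \<theta>) / (\<i> k)\<close> takes the same value at both ends of the
  period.\<close>

lemma integral_circle_measure_cis:
  "(\<integral>\<theta>. cis (of_int k * \<theta>) \<partial>circle_measure) = (if k = 0 then 1 else 0)"
proof (cases "k = 0")
  case True
  thus ?thesis by simp
next
  case False
  have "(\<integral>\<theta>. cis (of_int k * \<theta>) \<partial>circle_measure) =
      (\<integral>\<theta>. (1 / (2 * pi)) *\<^sub>R (indicator {-pi..pi} \<theta> *\<^sub>R cis (of_int k * \<theta>)) \<partial>lborel)"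
    unfolding circle_measure_def
    by (subst integral_density) (auto simp: cis.code complex_eq_iff split: split_indicator
      intro!: Bochner_Integration.integral_cong borel_measurable_continuous_onI continuous_intros)
  also have "\<dots> = (1 / (2 * pi)) *\<^sub>R (\<integral>\<theta>. indicator {-pi..pi} \<theta> *\<^sub>R cis (of_int k * \<theta>) \<partial>lborel)"
    by (rule integral_scaleR_right)
  also have "(\<integral>\<theta>. indicator {-pi..pi} \<theta> *\<^sub>R cis (of_int k * \<theta>) \<partial>lborel) =
      cis (of_int k * pi) / (\<i> * of_int k) - cis (of_int k * (- pi)) / (\<i> * of_int k)"
  proof (rule integral_FTC_Icc)
    fix x :: real
    have "((\<lambda>w. exp (\<i> * of_int k * w) / (\<i> * of_int k)) has_field_derivative exp (\<i> * of_int k * of_real x))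
        (at (of_real x))"
      using False by (auto intro!: derivative_eq_intros)
    from has_vector_derivative_real_field[OF this]
    show "((\<lambda>\<theta>. cis (of_int k * \<theta>) / (\<i> * of_int k)) has_vector_derivative cis (of_int k * x))
        (at x within {-pi..pi})"
      by (simp add: cis_conv_exp mult.assoc)
  qed (auto intro!: continuous_intros)
  also have "cis (of_int k * (- pi)) = cis (of_int k * pi)"
    using sin_integer_2pi[of "of_int k"] by (simp add: complex_eq_iff sin_times_pi_eq_0)
  finally show ?thesis using False by simp
qed

text \<open>Absolutely summable coefficients and a bounded \<open>G\<close> allow the series to be
  integrated term by term. The frequencies are an arbitrary map \<open>e\<close> on the naturals,
  since both an enumeration of the integers and its negative occur.\<close>

lemma fourier_series_sums:
  assumes A: "summable (\<lambda>j. norm (A j))"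
    and F: "\<And>\<theta>. (\<lambda>j. A j * cis (of_int (e j) * \<theta>)) sums F \<theta>"
    and G [measurable]: "G \<in> borel_measurable borel" and B: "\<And>\<theta>. norm (G \<theta>) \<le> B"
  shows "(\<lambda>j. A j * (\<integral>\<theta>. cis (of_int (e j) * \<theta>) * G \<theta> \<partial>circle_measure)) sums
     (\<integral>\<theta>. F \<theta> * G \<theta> \<partial>circle_measure)"
proof -
  let ?f = "\<lambda>j \<theta>. A j * (cis (of_int (e j) * \<theta>) * G \<theta>)"
  have B0: "B \<ge> 0" using B[of 0] norm_ge_zero order_trans by blast
  have [measurable]: "(\<lambda>\<theta>. cis (of_int n * \<theta>)) \<in> borel_measurable borel" for n
    by (intro borel_measurable_continuous_onI continuous_intros)
  have bound: "norm (?f j \<theta>) \<le> norm (A j) * B" for j \<theta>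
    by (simp add: norm_mult mult_left_mono B)
  have int: "integrable circle_measure (?f j)" for j
    by (rule integrable_circle_measure[OF _ bound]) measurable
  have sumb: "summable (\<lambda>j. norm (A j) * B)"
    using A by (rule summable_mult2)
  have "(\<lambda>j. integral\<^sup>L circle_measure (?f j)) sums (\<integral>\<theta>. (\<Sum>j. ?f j \<theta>) \<partial>circle_measure)"
  proof (rule sums_integral[OF int])
    show "AE \<theta> in circle_measure. summable (\<lambda>j. norm (?f j \<theta>))"
      by (intro always_eventually allI summable_comparison_test'[OF sumb]) (use bound in simp)
    have "(\<integral>\<theta>. norm (?f j \<theta>) \<partial>circle_measure) \<le> norm (A j) * B" for j
    proof -
      have "(\<integral>\<theta>. norm (?f j \<theta>) \<partial>circle_measure) \<le> (\<integral>\<theta>. norm (A j) * B \<partial>circle_measure)"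
        by (intro integral_mono integrable_norm int bound) simp
      thus ?thesis by simp
    qed
    thus "summable (\<lambda>j. \<integral>\<theta>. norm (?f j \<theta>) \<partial>circle_measure)"
      by (intro summable_comparison_test'[OF sumb]) simp
  qed
  moreover have "(\<Sum>j. ?f j \<theta>) = F \<theta> * G \<theta>" for \<theta>
    using sums_mult2[OF F, of \<theta> "G \<theta>"] by (simp add: sums_iff mult.assoc)
  moreover have "integral\<^sup>L circle_measure (?f j) =
      A j * (\<integral>\<theta>. cis (of_int (e j) * \<theta>) * G \<theta> \<partial>circle_measure)" for j
    by simp
  ultimately show ?thesis by simp
qed

text \<open>\<open>int_decode\<close> enumerates the integers, so that results about series apply;
  the order is harmless because the expansion is an unordered sum.\<close>

lemma bessel_generating_sums:
  "(\<lambda>j. of_real (bessel_int z (int_decode j)) * cis (of_int (int_decode j) * \<theta>)) sums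
     exp (\<i> * of_real (z * sin \<theta>))"
  by (rule has_sum_imp_sums)
    (use bessel_generating_function[of z \<theta>] in \<open>simp add: has_sum_reindex_bij_betw[OF bij_int_decode,
      of "\<lambda>n. of_real (bessel_int z n) * cis (of_int n * \<theta>)"]\<close>)

lemma summable_abs_bessel_int: "summable (\<lambda>j. \<bar>bessel_int z (int_decode j)\<bar>)"
proof -
  have "(\<lambda>n. complex_of_real (bessel_int z n) * cis (of_int n * 0)) summable_on UNIV"
    using bessel_generating_function by (rule has_sum_imp_summable)
  hence "(\<lambda>n. \<bar>bessel_int z n\<bar>) summable_on UNIV"
    by (simp add: summable_on_iff_abs_summable_on_complex)
  hence "(\<lambda>j. \<bar>bessel_int z (int_decode j)\<bar>) summable_on UNIV"
    using summable_on_reindex_bij_betw[OF bij_int_decode, of "\<lambda>n. \<bar>bessel_int z n\<bar>"] by simp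
  thus ?thesis by (rule summable_on_imp_summable)
qed

text \<open>Parseval's identity for \<open>\<theta> \<mapsto> exp (\<i> z sin \<theta>)\<close> and its translate by \<open>t\<close>.\<close>

lemma bessel_int_squares_sums:
  "(\<lambda>j. of_real ((bessel_int z (int_decode j))\<^sup>2) * cis (of_int (int_decode j) * t)) sums
     (\<integral>\<theta>. exp (\<i> * of_real (z * (sin \<theta> - sin (\<theta> - t)))) \<partial>circle_measure)"
proof -
  define A where "A j = complex_of_real (bessel_int z (int_decode j))" for j
  \<comment> \<open>The conjugate of the generating function translated by \<open>t\<close>.
    Multiplied by the untranslated function it gives the phase
    \<open>z * (sin \<theta> - sin (\<theta> - t))\<close> of the claim.\<close>
  define G where "G \<theta> = exp (- \<i> * of_real (z * sin (\<theta> - t)))" for \<theta>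
  have A: "summable (\<lambda>j. norm (A j))"
    using summable_abs_bessel_int by (simp add: A_def)
  have [measurable]: "G \<in> borel_measurable borel"
    unfolding G_def by (intro borel_measurable_continuous_onI continuous_intros)
  have nG: "norm (G \<theta>) \<le> 1" for \<theta>
    by (simp add: G_def)
  have G: "(\<lambda>j. A j * cis (of_int (int_decode j) * t) * cis (of_int (- int_decode j) * \<theta>)) sums G \<theta>" for \<theta>
  proof -
    have "(\<lambda>j. cnj (A j * cis (of_int (int_decode j) * (\<theta> - t)))) sums cnj (exp (\<i> * of_real (z * sin (\<theta> - t))))"
      unfolding A_def by (subst sums_cnj) (rule bessel_generating_sums)
    moreover have "cnj (A j * cis (of_int (int_decode j) * (\<theta> - t))) =
        A j * cis (of_int (int_decode j) * t) * cis (of_int (- int_decode j) * \<theta>)" for j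
      unfolding mult.assoc cis_mult by (simp add: A_def cis_cnj algebra_simps)
    moreover have "cnj (exp (\<i> * of_real (z * sin (\<theta> - t)))) = G \<theta>"
      by (simp add: G_def exp_cnj)
    ultimately show ?thesis by simp
  qed
  \<comment> \<open>The series of \<open>G\<close> is integrated against a single exponential, and
    orthogonality leaves only the term \<open>i = j\<close>.\<close>
  have inner: "(\<integral>\<theta>. cis (of_int (int_decode j) * \<theta>) * G \<theta> \<partial>circle_measure) =
      A j * cis (of_int (int_decode j) * t)" for j
  proof (rule sums_unique2)
    have "(\<lambda>i. A i * cis (of_int (int_decode i) * t) *
        (\<integral>\<theta>. cis (of_int (- int_decode i) * \<theta>) * cis (of_int (int_decode j) * \<theta>) \<partial>circle_measure)) sums
        (\<integral>\<theta>. G \<theta> * cis (of_int (int_decode j) * \<theta>) \<partial>circle_measure)"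
    proof (rule fourier_series_sums[OF _ G])
      show "summable (\<lambda>i. norm (A i * cis (of_int (int_decode i) * t)))"
        using A by (simp add: norm_mult)
      show "norm (cis (of_int (int_decode j) * \<theta>)) \<le> 1" for \<theta> by simp
    qed (intro borel_measurable_continuous_onI continuous_intros)
    moreover have "(\<integral>\<theta>. cis (of_int (- int_decode i) * \<theta>) * cis (of_int (int_decode j) * \<theta>) \<partial>circle_measure) =
        (if i = j then 1 else 0)" for i
    proof -
      have "cis (of_int (- int_decode i) * \<theta>) * cis (of_int (int_decode j) * \<theta>) =
          cis (of_int (int_decode j - int_decode i) * \<theta>)" for \<theta>
        by (simp add: cis_mult algebra_simps)
      thus ?thesis
        by (simp only: integral_circle_measure_cis right_minus_eq int_decode_eq eq_commute[of j])
    qed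
    ultimately have "(\<lambda>i. A i * cis (of_int (int_decode i) * t) * (if i = j then 1 else 0)) sums
        (\<integral>\<theta>. G \<theta> * cis (of_int (int_decode j) * \<theta>) \<partial>circle_measure)"
      by (simp only:)
    moreover have "(\<lambda>i. A i * cis (of_int (int_decode i) * t) * (if i = j then 1 else 0)) =
        (\<lambda>i. if i = j then A i * cis (of_int (int_decode i) * t) else 0)" by auto
    ultimately show "(\<lambda>i. if i = j then A i * cis (of_int (int_decode i) * t) else 0) sums
        (\<integral>\<theta>. cis (of_int (int_decode j) * \<theta>) * G \<theta> \<partial>circle_measure)"
      by (simp only: mult.commute[of "G _"])
    show "(\<lambda>i. if i = j then A i * cis (of_int (int_decode i) * t) else 0) sums
        (A j * cis (of_int (int_decode j) * t))"
      by (rule sums_single)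
  qed
  have "(\<lambda>j. A j * (\<integral>\<theta>. cis (of_int (int_decode j) * \<theta>) * G \<theta> \<partial>circle_measure)) sums
      (\<integral>\<theta>. exp (\<i> * of_real (z * sin \<theta>)) * G \<theta> \<partial>circle_measure)"
    by (rule fourier_series_sums[OF A _ _ nG]) (unfold A_def, rule bessel_generating_sums, measurable)
  moreover have "exp (\<i> * of_real (z * sin \<theta>)) * G \<theta> = exp (\<i> * of_real (z * (sin \<theta> - sin (\<theta> - t))))" for \<theta>
    unfolding G_def exp_add[symmetric] by (simp add: algebra_simps)
  ultimately show ?thesis
    by (simp add: inner A_def power2_eq_square mult.assoc)
qed

lemma bessel_int_power2_sums: "(\<lambda>j. (bessel_int z (int_decode j))\<^sup>2) sums 1"
proof -
  have "(\<lambda>j. complex_of_real ((bessel_int z (int_decode j))\<^sup>2)) sums of_real 1"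
    using bessel_int_squares_sums[of z 0] by simp
  thus ?thesis by (simp only: sums_of_real_iff)
qed

text \<open>One term of a sum of squares with value 1. This bound makes Hankel integrals of
  integrable functions converge absolutely and supplies the majorants for dominated convergence and
  Fubini.\<close>

lemma abs_bessel_nat_le_1: "\<bar>bessel_nat n z\<bar> \<le> 1"
proof -
  have "(bessel_int z (int_decode (int_encode (int n))))\<^sup>2 \<le> (\<Sum>j. (bessel_int z (int_decode j))\<^sup>2)"
    using sum_le_suminf[OF sums_summable[OF bessel_int_power2_sums], of "{int_encode (int n)}"] by simp
  hence "(bessel_nat n z)\<^sup>2 \<le> 1"
    using sums_unique[OF bessel_int_power2_sums, of z] by (simp add: bessel_int_power2)
  thus ?thesis by (simp add: abs_square_le_1)
qed

section \<open>The arcsine law as limit of the squared Bessel functions\<close>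

lemma emeasure_circle_measure:
  assumes "S \<in> sets borel"
  shows "emeasure circle_measure S = ennreal (1 / (2 * pi)) * emeasure lborel (S \<inter> {-pi..pi})"
proof -
  have "emeasure circle_measure S = (\<integral>\<^sup>+\<theta>. ennreal (1 / (2 * pi)) * indicator (S \<inter> {-pi..pi}) \<theta> \<partial>lborel)"
    unfolding circle_measure_def using assms
    by (subst emeasure_density) (auto intro!: nn_integral_cong split: split_indicator)
  thus ?thesis
    using assms by (simp add: nn_integral_cmult_indicator)
qed

text \<open>For \<open>c < 1\<close> and \<open>a = arccos c\<close> the set consists, within one
  period, of two arcs of length \<open>\<pi> - 2 a\<close>, a fraction
  \<open>1 - 2 a / \<pi>\<close> of the circle. This is the source of the arcsecant in
  \<open>U\<close>, as \<open>arcsec (1 / c) = arccos c\<close>. For \<open>c \<ge> 1\<close> it is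
  the whole circle, and \<open>U\<close> has its constant value \<open>1/2\<close>.\<close>

lemma measure_circle_abs_cos_le:
  assumes "c > 0"
  shows "measure circle_measure {\<theta>. \<bar>cos \<theta>\<bar> \<le> c} = 2 * U (1 / c)"
proof (cases "c \<ge> 1")
  case True
  have "{\<theta>. \<bar>cos \<theta>\<bar> \<le> c} = UNIV"
    using True order_trans[OF abs_cos_le_one] by auto
  thus ?thesis
    using True by (simp add: U_def)
next
  case False
  define a where "a = arccos c"
  have a: "0 < a" "a < pi / 2" "cos a = c"
    using False assms arccos_less_arccos[of 0 c] arccos_less_arccos[of c 1] by (auto simp: a_def)
  have *: "\<bar>cos \<theta>\<bar> \<le> c \<longleftrightarrow> \<theta> \<in> {a..pi - a}" if "0 \<le> \<theta>" "\<theta> \<le> pi" for \<theta>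
  proof -
    have "cos \<theta> \<le> c \<longleftrightarrow> a \<le> \<theta>"
      using cos_mono_le_eq[of \<theta> a] a that by auto
    moreover have "- c \<le> cos \<theta> \<longleftrightarrow> \<theta> \<le> pi - a"
      using cos_mono_le_eq[of "pi - a" \<theta>] a that by auto
    ultimately show ?thesis by (auto simp: abs_le_iff)
  qed
  have "\<bar>cos \<theta>\<bar> \<le> c \<longleftrightarrow> \<theta> \<in> {a..pi - a} \<union> {- (pi - a)..- a}" if "\<theta> \<in> {-pi..pi}" for \<theta>
    using *[of \<theta>] *[of "- \<theta>"] that a by (cases "\<theta> \<ge> 0") auto
  hence "{\<theta>. \<bar>cos \<theta>\<bar> \<le> c} \<inter> {-pi..pi} = {a..pi - a} \<union> {- (pi - a)..- a}"
    using a by auto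
  moreover have "emeasure lborel ({a..pi - a} \<union> {- (pi - a)..- a}) = ennreal (2 * (pi - 2 * a))"
    using a by (subst plus_emeasure[symmetric]) (auto simp flip: ennreal_plus)
  moreover have "{\<theta>. \<bar>cos \<theta>\<bar> \<le> c} \<in> sets borel"
    by measurable
  ultimately have "emeasure circle_measure {\<theta>. \<bar>cos \<theta>\<bar> \<le> c} = ennreal (1 / (2 * pi) * (2 * (pi - 2 * a)))"
    using a by (simp add: emeasure_circle_measure ennreal_mult'[symmetric])
  hence "measure circle_measure {\<theta>. \<bar>cos \<theta>\<bar> \<le> c} = 1 / (2 * pi) * (2 * (pi - 2 * a))"
    using a by (intro measure_eq_emeasure_eq_ennreal) auto
  also have "\<dots> = 2 * U (1 / c)"
  proof -
    have "\<not> 1 / c \<le> 1" using False assms by (simp add: field_simps)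
    thus ?thesis by (simp add: U_def arcsec_def a_def field_simps)
  qed
  finally show ?thesis .
qed

text \<open>The cosine of a uniform angle has no atoms. This makes the end points of an interval
  negligible when weak convergence is turned into convergence of probabilities.\<close>

lemma AE_circle_measure_cos_neq: "AE \<theta> in circle_measure. cos \<theta> \<noteq> c"
proof -
  have "AE \<theta> in lborel. \<theta> \<notin> {arccos c, - arccos c}"
    by (rule AE_not_in) (rule finite_imp_null_set_lborel, simp)
  hence "AE \<theta> in lborel. \<theta> \<in> {-pi..pi} \<longrightarrow> cos \<theta> \<noteq> c"
  proof eventually_elim
    case (elim \<theta>)
    show ?case
      using elim arccos_cos[of \<theta>] arccos_cos2[of \<theta>] by (cases "\<theta> \<ge> 0") auto
  qed
  thus ?thesis
    unfolding circle_measure_def by (subst AE_density) (auto split: split_indicator elim!: eventually_mono)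
qed

text \<open>The law of a random integer \<open>X\<close> with \<open>P (X = n) = J\<^sub>n(z)\<^sup>2\<close>, transported to \<open>\<nat>\<close>.\<close>

definition bessel_pmf :: "real \<Rightarrow> nat pmf" where
  "bessel_pmf z = embed_pmf (\<lambda>j. (bessel_int z (int_decode j))\<^sup>2)"

lemma pmf_bessel_pmf: "pmf (bessel_pmf z) j = (bessel_int z (int_decode j))\<^sup>2"
  unfolding bessel_pmf_def
proof (rule pmf_embed_pmf)
  have "(\<integral>\<^sup>+j. ennreal ((bessel_int z (int_decode j))\<^sup>2) \<partial>count_space UNIV) =
      (\<Sum>j. ennreal ((bessel_int z (int_decode j))\<^sup>2))"
    by (rule nn_integral_count_space_nat)
  also have "\<dots> = ennreal 1"
    using bessel_int_power2_sums[of z] by (subst suminf_ennreal2) (auto simp: sums_iff)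
  finally show "(\<integral>\<^sup>+j. ennreal ((bessel_int z (int_decode j))\<^sup>2) \<partial>count_space UNIV) = 1" by simp
qed simp

text \<open>The characteristic function of the law on the integers. The Bessel functions are gone
  from the right-hand side, whose limit under scaling is elementary.\<close>

lemma bessel_pmf_cis:
  "(\<integral>j. cis (of_int (int_decode j) * t) \<partial>measure_pmf (bessel_pmf z)) =
     (\<integral>\<theta>. exp (\<i> * of_real (z * (sin \<theta> - sin (\<theta> - t)))) \<partial>circle_measure)"
proof (rule sums_unique2[OF _ bessel_int_squares_sums])
  let ?f = "\<lambda>j. cis (of_int (int_decode j) * t)"
  have "integrable (measure_pmf (bessel_pmf z)) ?f"
    by (rule measure_pmf.integrable_const_bound[where B = 1]) auto
  hence int: "integrable (count_space UNIV) (\<lambda>j. pmf (bessel_pmf z) j *\<^sub>R ?f j)"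
    unfolding measure_pmf_eq_density by (subst (asm) integrable_density) auto
  have "(\<lambda>j. pmf (bessel_pmf z) j *\<^sub>R ?f j) sums (\<integral>j. pmf (bessel_pmf z) j *\<^sub>R ?f j \<partial>count_space UNIV)"
    by (rule sums_integral_count_space_nat[OF int])
  moreover have "(\<integral>j. pmf (bessel_pmf z) j *\<^sub>R ?f j \<partial>count_space UNIV) = (\<integral>j. ?f j \<partial>measure_pmf (bessel_pmf z))"
    unfolding measure_pmf_eq_density by (subst integral_density) auto
  ultimately show "(\<lambda>j. of_real ((bessel_int z (int_decode j))\<^sup>2) * ?f j) sums (\<integral>j. ?f j \<partial>measure_pmf (bessel_pmf z))"
    by (simp add: pmf_bessel_pmf scaleR_conv_of_real)
qed

lemma measure_bessel_pmf:
  "measure (measure_pmf (bessel_pmf z)) {j. \<bar>int_decode j\<bar> \<le> int n} = (\<Sum>k=-int n..int n. (bessel_int z k)\<^sup>2)"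
proof -
  have bij: "bij_betw int_decode {j. \<bar>int_decode j\<bar> \<le> int n} {-int n..int n}"
    by (rule bij_betw_byWitness[where f' = int_encode]) auto
  have "finite {j. \<bar>int_decode j\<bar> \<le> int n}"
    using bij_betw_finite[OF bij] by simp
  thus ?thesis
    using sum.reindex_bij_betw[OF bij, of "\<lambda>k. (bessel_int z k)\<^sup>2"]
    by (simp add: measure_measure_pmf_finite pmf_bessel_pmf)
qed

text \<open>By Levy's continuity theorem the law of \<open>X / N\<close> converges to that of \<open>cos \<Theta> / c\<close>, with
  \<open>\<Theta>\<close> uniformly distributed on the circle.\<close>

lemma bessel_square_sum_tendsto:
  fixes N :: "nat \<Rightarrow> nat" and z :: "nat \<Rightarrow> real"
  assumes N: "filterlim N at_top sequentially" and c: "(\<lambda>i. real (N i) / z i) \<longlonglongrightarrow> c" "c > 0"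
  shows "(\<lambda>i. \<Sum>k=-int (N i)..int (N i). (bessel_int (z i) k)\<^sup>2) \<longlonglongrightarrow> 2 * U (1 / c)"
proof -
  \<comment> \<open>Scaling by \<open>N i\<close> instead of \<open>z i\<close> turns the event
    \<open>\<bar>X\<bar> \<le> N i\<close> into the fixed interval \<open>{-1..1}\<close>; the ratio
    of the two scales tends to \<open>c\<close>.\<close>
  define D where "D i = distr (measure_pmf (bessel_pmf (z i))) borel
    (\<lambda>j. real_of_int (int_decode j) / real (N i))" for i
  define D' where "D' = distr circle_measure borel (\<lambda>\<theta>. cos \<theta> / c)"
  have rN: "filterlim (\<lambda>i. real (N i)) at_top sequentially"
    by (rule filterlim_compose[OF filterlim_real_sequentially N])
  have D: "real_distribution (D i)" for i
    unfolding D_def by (rule prob_space.real_distribution_distr[OF prob_space_measure_pmf]) simp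
  have D': "real_distribution D'"
    unfolding D'_def by (rule circle.real_distribution_distr) measurable
  have pos: "\<forall>\<^sub>F i in sequentially. N i > 0"
    using eventually_compose_filterlim[OF eventually_gt_at_top N] .
  have zN: "(\<lambda>i. z i / real (N i)) \<longlonglongrightarrow> 1 / c"
    using tendsto_inverse[OF c(1)] c(2) by (simp add: inverse_eq_divide)
  have "(\<lambda>i. char (D i) t) \<longlonglongrightarrow> char D' t" for t
  proof -
    have "char (D i) t = (\<integral>\<theta>. exp (\<i> * of_real (z i * (sin \<theta> - sin (\<theta> - t / real (N i))))) \<partial>circle_measure)" for i
      unfolding bessel_pmf_cis[symmetric] char_def D_def
      by (subst integral_distr) (auto simp: cis_conv_exp mult_ac)
    moreover have "char D' t = (\<integral>\<theta>. exp (\<i> * of_real (t * (cos \<theta> / c))) \<partial>circle_measure)"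
      unfolding char_def D'_def by (subst integral_distr) auto
    moreover have "(\<lambda>i. \<integral>\<theta>. exp (\<i> * of_real (z i * (sin \<theta> - sin (\<theta> - t / real (N i))))) \<partial>circle_measure) \<longlonglongrightarrow>
        (\<integral>\<theta>. exp (\<i> * of_real (t * (cos \<theta> / c))) \<partial>circle_measure)"
    proof (rule integral_dominated_convergence[where w = "\<lambda>_. 1"])
      \<comment> \<open>The expression is \<open>t z i / N i\<close> times the difference quotient
        of the sine at \<open>\<theta>\<close> with increment \<open>- t / N i\<close>. The
        increment must not vanish, hence the separate case \<open>t = 0\<close>.\<close>
      have "(\<lambda>i. z i * (sin \<theta> - sin (\<theta> - t / real (N i)))) \<longlonglongrightarrow> t * (cos \<theta> / c)" for \<theta>
      proof (cases "t = 0")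
        case False
        define h where "h i = - t / real (N i)" for i
        have "h \<longlonglongrightarrow> 0"
          unfolding h_def by (rule tendsto_divide_0[OF tendsto_const filterlim_at_top_imp_at_infinity[OF rN]])
        moreover have "\<forall>\<^sub>F i in sequentially. h i \<noteq> 0"
          using pos by eventually_elim (use False in \<open>simp add: h_def\<close>)
        ultimately have "filterlim h (at 0) sequentially"
          by (simp add: filterlim_at)
        moreover have "((\<lambda>h. (sin (\<theta> + h) - sin \<theta>) / h) \<longlongrightarrow> cos \<theta>) (at 0)"
          using DERIV_sin[of \<theta>] by (simp add: DERIV_def)
        ultimately have "(\<lambda>i. (sin (\<theta> + h i) - sin \<theta>) / h i) \<longlonglongrightarrow> cos \<theta>"
          by (rule filterlim_compose[rotated])
        hence "(\<lambda>i. (z i / real (N i)) * t * ((sin (\<theta> + h i) - sin \<theta>) / h i)) \<longlonglongrightarrow> 1 / c * t * cos \<theta>"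
          by (intro tendsto_mult zN tendsto_const)
        moreover have "\<forall>\<^sub>F i in sequentially. (z i / real (N i)) * t * ((sin (\<theta> + h i) - sin \<theta>) / h i) =
            z i * (sin \<theta> - sin (\<theta> - t / real (N i)))"
          using pos by eventually_elim (use False in \<open>simp add: h_def field_simps\<close>)
        ultimately show ?thesis
          by (subst (asm) tendsto_cong) (auto simp: mult_ac)
      qed simp
      from tendsto_exp[OF tendsto_mult[OF tendsto_const tendsto_of_real[OF this]]]
      show "AE \<theta> in circle_measure. (\<lambda>i. exp (\<i> * of_real (z i * (sin \<theta> - sin (\<theta> - t / real (N i)))))) \<longlonglongrightarrow>
          exp (\<i> * of_real (t * (cos \<theta> / c)))"
        by (intro always_eventually allI)
    qed auto
    ultimately show ?thesis by simp
  qed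
  hence conv: "weak_conv_m D D'"
    by (rule levy_continuity[OF D D'])
  \<comment> \<open>Weak convergence yields convergence of the measures of a set only if its
    boundary is null for the limit law.\<close>
  have "emeasure D' (frontier {-1..1}) = 0"
  proof -
    have "frontier {-1..1::real} = {-1, 1}"
      by (auto simp: frontier_def)
    then have "emeasure D' (frontier {-1..1}) = emeasure circle_measure {\<theta>. cos \<theta> / c \<in> {-1, 1}}"
      unfolding D'_def by (subst emeasure_distr) (auto simp: vimage_def)
    also have "AE \<theta> in circle_measure. \<not> (cos \<theta> / c \<in> {-1, 1})"
      using AE_circle_measure_cos_neq[of c] AE_circle_measure_cos_neq[of "- c"]
      by eventually_elim (use c(2) in \<open>auto simp: field_simps\<close>)
    hence "emeasure circle_measure {\<theta>. cos \<theta> / c \<in> {-1, 1}} = 0"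
      by (subst (asm) AE_iff_measurable[OF _ refl]) auto
    finally show ?thesis .
  qed
  from weak_conv_imp_continuity_set_conv[OF D D' conv _ this]
  have "(\<lambda>i. measure (D i) {-1..1}) \<longlonglongrightarrow> measure D' {-1..1}" by simp
  also have "measure D' {-1..1} = measure circle_measure {\<theta>. \<bar>cos \<theta>\<bar> \<le> c}"
  proof -
    have "(\<lambda>\<theta>. cos \<theta> / c) -` {-1..1} = {\<theta>. \<bar>cos \<theta>\<bar> \<le> c}"
      using c(2) by (auto simp: field_simps abs_le_iff)
    thus ?thesis
      unfolding D'_def by (subst measure_distr) auto
  qed
  also have "\<dots> = 2 * U (1 / c)"
    by (rule measure_circle_abs_cos_le[OF c(2)])
  finally have lim: "(\<lambda>i. measure (D i) {-1..1}) \<longlonglongrightarrow> 2 * U (1 / c)" .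
  have "\<forall>\<^sub>F i in sequentially. measure (D i) {-1..1} = (\<Sum>k=-int (N i)..int (N i). (bessel_int (z i) k)\<^sup>2)"
    using pos
  proof eventually_elim
    case (elim i)
    have "(\<lambda>j. real_of_int (int_decode j) / real (N i)) -` {-1..1} = {j. \<bar>int_decode j\<bar> \<le> int (N i)}"
      using elim by (auto simp: field_simps abs_le_iff)
    thus ?case
      unfolding D_def measure_bessel_pmf[symmetric] by (subst measure_distr) auto
  qed
  thus ?thesis
    using lim by (rule Lim_transform_eventually[rotated])
qed

lemma sum_bessel_int_power2_le_1: "(\<Sum>k=-int n..int n. (bessel_int z k)\<^sup>2) \<le> 1"
  unfolding measure_bessel_pmf[symmetric] by simp

section \<open>The Hankel transform\<close>

abbreviation rad :: "real measure" where "rad \<equiv> radial_measure"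

lemma sets_radial_measure [simp, measurable_cong]: "sets rad = sets borel"
  and space_radial_measure [simp]: "space rad = UNIV"
  by (simp_all add: radial_measure_def)

lemma AE_radial_measure: "(AE r in rad. P r) \<longleftrightarrow> (AE r in lborel. r > 0 \<longrightarrow> P r)"
  unfolding radial_measure_def by (subst AE_density) (auto split: split_indicator)

lemma AE_radial_measure_pos: "AE r in rad. r > 0"
  by (simp add: AE_radial_measure)

lemma AE_radial_measureI: "(\<And>r. r > 0 \<Longrightarrow> P r) \<Longrightarrow> AE r in rad. P r"
  by (simp add: AE_radial_measure)

interpretation radial: sigma_finite_measure rad
  unfolding radial_measure_def
  by (subst sigma_finite_measure.sigma_finite_iff_density_finite[OF sigma_finite_lborel]) (auto split: split_indicator)

interpretation radial_pair: pair_sigma_finite rad rad ..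

lemma has_bochner_integral_radial_measure:
  fixes f :: "real \<Rightarrow> 'a :: {banach, second_countable_topology}"
  assumes [measurable]: "f \<in> borel_measurable borel"
  shows "has_bochner_integral rad f I \<longleftrightarrow>
    has_bochner_integral lborel (\<lambda>r. indicator {0<..} r *\<^sub>R (r *\<^sub>R f r)) I"
proof -
  have *: "(r * indicator {0<..} r) *\<^sub>R f r = indicator {0<..} r *\<^sub>R (r *\<^sub>R f r)" for r
    by (auto split: split_indicator)
  have "integrable rad f \<longleftrightarrow> integrable lborel (\<lambda>r. indicator {0<..} r *\<^sub>R (r *\<^sub>R f r))"
    unfolding radial_measure_def *[symmetric]
    by (rule integrable_density) (auto split: split_indicator)
  moreover have "integral\<^sup>L rad f = integral\<^sup>L lborel (\<lambda>r. indicator {0<..} r *\<^sub>R (r *\<^sub>R f r))"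
    unfolding radial_measure_def *[symmetric]
    by (rule integral_density) (auto split: split_indicator)
  ultimately show ?thesis by (simp add: has_bochner_integral_iff)
qed

text \<open>The weight \<open>r\<close> of the radial measure turns the even power into an odd one,
  so the substitution \<open>x = sqrt c * r\<close> reduces the claim to the odd Gaussian moments on
  the half-line. Only even exponents are covered; the other functions are compared with
  these.\<close>

lemma has_bochner_integral_gaussian_moment:
  assumes "c > 0"
  shows "has_bochner_integral rad (\<lambda>r. r ^ (2 * j) * exp (- c * r\<^sup>2)) (fact j / (2 * c ^ (j + 1)))"
proof -
  let ?s = "sqrt c"
  have s: "?s > 0" using assms by simp
  have "has_bochner_integral lborel
      (\<lambda>x. indicator {0..} (0 + ?s * x) *\<^sub>R (exp (- (0 + ?s * x)\<^sup>2) * (0 + ?s * x) ^ (2 * j + 1))) ((fact j / 2) /\<^sub>R \<bar>?s\<bar>)"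
    using gaussian_moment_odd_pos[of j] s by (subst (asm) lborel_has_bochner_integral_real_affine_iff[of ?s _ _ 0]) auto
  hence "has_bochner_integral lborel
      (\<lambda>x. (indicator {0..} (0 + ?s * x) *\<^sub>R (exp (- (0 + ?s * x)\<^sup>2) * (0 + ?s * x) ^ (2 * j + 1))) / ?s ^ (2 * j + 1))
      (((fact j / 2) /\<^sub>R \<bar>?s\<bar>) / ?s ^ (2 * j + 1))"
    by (rule has_bochner_integral_divide)
  also have "(\<lambda>x. (indicator {0..} (0 + ?s * x) *\<^sub>R (exp (- (0 + ?s * x)\<^sup>2) * (0 + ?s * x) ^ (2 * j + 1))) / ?s ^ (2 * j + 1)) =
      (\<lambda>r. indicator {0<..} r *\<^sub>R (r *\<^sub>R (r ^ (2 * j) * exp (- c * r\<^sup>2))))"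
    using assms s by (auto simp: fun_eq_iff power_mult_distrib zero_le_mult_iff split: split_indicator)
  also have "((fact j / 2) /\<^sub>R \<bar>?s\<bar>) / ?s ^ (2 * j + 1) = fact j / (2 * c ^ (j + 1))"
  proof -
    have "?s * ?s ^ (2 * j + 1) = c ^ (j + 1)"
      using assms by (simp add: power_mult flip: power_Suc) (simp add: power_mult mult.assoc[symmetric])
    thus ?thesis using s by (simp add: field_simps)
  qed
  finally show ?thesis
    by (subst has_bochner_integral_radial_measure) auto
qed

section \<open>Gaussian functions and their Hankel transforms\<close>

definition gauss_fun :: "nat \<Rightarrow> real \<Rightarrow> real \<Rightarrow> complex" where
  "gauss_fun n c r = of_real (r ^ n * exp (- c * r\<^sup>2))"

text \<open>The transform as an absolutely convergent integral, for \<open>g\<close> integrable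
  against \<open>r dr\<close>. It is built on \<open>bessel_nat\<close>, which is correct at the
  argument 0 too; general square integrable functions are reached by cutting off.\<close>

definition hankel :: "nat \<Rightarrow> (real \<Rightarrow> complex) \<Rightarrow> real \<Rightarrow> complex" where
  "hankel n g k = (\<integral>r. g r * of_real (bessel_nat n (k * r)) \<partial>rad)"

lemma measurable_gauss_fun [measurable]: "gauss_fun n c \<in> borel_measurable borel"
  unfolding gauss_fun_def by measurable

lemma gauss_fun_inner:
  assumes "c > 0" "d > 0"
  shows "integrable rad (\<lambda>r. gauss_fun n c r * cnj (gauss_fun n d r))"
    "L2_inner rad (gauss_fun n c) (gauss_fun n d) = of_real (fact n / (2 * (c + d) ^ (n + 1)))"
proof -
  have "has_bochner_integral rad (\<lambda>r. complex_of_real (r ^ (2 * n) * exp (- (c + d) * r\<^sup>2)))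
      (of_real (fact n / (2 * (c + d) ^ (n + 1))))"
    using assms by (intro has_bochner_integral_of_real has_bochner_integral_gaussian_moment) simp
  also have "(\<lambda>r. complex_of_real (r ^ (2 * n) * exp (- (c + d) * r\<^sup>2))) =
      (\<lambda>r. gauss_fun n c r * cnj (gauss_fun n d r))"
  proof
    fix r
    have "r ^ (2 * n) * exp (- (c + d) * r\<^sup>2) = (r ^ n * exp (- c * r\<^sup>2)) * (r ^ n * exp (- d * r\<^sup>2))"
      by (simp add: exp_add[symmetric] mult_2 mult_2_right power_add algebra_simps)
    thus "complex_of_real (r ^ (2 * n) * exp (- (c + d) * r\<^sup>2)) = gauss_fun n c r * cnj (gauss_fun n d r)"
      unfolding gauss_fun_def complex_cnj_complex_of_real of_real_mult[symmetric] by simp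
  qed
  finally show "integrable rad (\<lambda>r. gauss_fun n c r * cnj (gauss_fun n d r))"
    "L2_inner rad (gauss_fun n c) (gauss_fun n d) = of_real (fact n / (2 * (c + d) ^ (n + 1)))"
    by (auto simp: L2_inner_def has_bochner_integral_iff)
qed

lemma gauss_fun_L2: "c > 0 \<Longrightarrow> gauss_fun n c \<in> L2 rad"
  using integrable_norm[OF gauss_fun_inner(1)[of c c n]]
  by (auto intro!: L2I simp: norm_mult power2_eq_square)

lemma abs_integrable_times_bessel_nat:
  assumes "integrable rad g"
  shows "integrable rad (\<lambda>r. g r * of_real (bessel_nat n (k * r)) :: complex)"
proof (rule Bochner_Integration.integrable_bound[OF assms])
  show "AE r in rad. norm (g r * of_real (bessel_nat n (k * r))) \<le> norm (g r)"
    using abs_bessel_nat_le_1[of n "k * r" for r] by (auto simp: norm_mult mult_left_le)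
qed (use borel_measurable_integrable[OF assms] in measurable)

text \<open>The inequality \<open>\<bar>r ^ n\<bar> \<le> 1 + r ^ (2 * n)\<close> replaces a
  possibly odd exponent by the even moments \<open>0\<close> and \<open>2 * n\<close>.\<close>

lemma gauss_fun_integrable:
  assumes "c > 0"
  shows "integrable rad (gauss_fun n c)"
proof (rule Bochner_Integration.integrable_bound)
  let ?g = "\<lambda>j r. r ^ (2 * j) * exp (- c * r\<^sup>2)"
  have "integrable rad (?g j)" for j
    using has_bochner_integral_gaussian_moment[OF assms, of j] by (simp add: has_bochner_integral_iff)
  thus "integrable rad (\<lambda>r. ?g 0 r + ?g n r)"
    by (intro Bochner_Integration.integrable_add)
  have "\<bar>r ^ n\<bar> \<le> 1 + r ^ (2 * n)" for r :: real
  proof -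
    have "2 * \<bar>r ^ n\<bar> \<le> \<bar>r ^ n\<bar>\<^sup>2 + 1"
      using sum_squares_bound[of "\<bar>r ^ n\<bar>" 1] by simp
    hence "\<bar>r ^ n\<bar> \<le> 1 + \<bar>r ^ n\<bar>\<^sup>2" by linarith
    thus ?thesis by (simp add: power_even_eq)
  qed
  hence "norm (gauss_fun n c r) \<le> norm (?g 0 r + ?g n r)" for r
    using mult_right_mono[of "\<bar>r ^ n\<bar>" "1 + r ^ (2 * n)" "exp (- c * r\<^sup>2)"]
    by (simp add: gauss_fun_def norm_mult norm_power power_abs ring_distribs abs_mult)
  thus "AE r in rad. norm (gauss_fun n c r) \<le> norm (?g 0 r + ?g n r)" by simp
qed measurable

text \<open>Integrate the Bessel series term by term against the Gaussian. The factor
  \<open>fact (m + n)\<close> of the moment cancels the one in the Bessel coefficient, and what is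
  left is the exponential series of \<open>- k\<^sup>2 / (4 c)\<close>. The same computation with
  absolute values justifies the interchange.\<close>

lemma hankel_gauss_fun:
  assumes "c > 0"
  shows "hankel n (gauss_fun n c) k = of_real (1 / (2 * c) ^ (n + 1)) * gauss_fun n (1 / (4 * c)) k"
proof -
  let ?a = "\<lambda>m. (-1) ^ m / (fact m * fact (m + n)) * (k / 2) ^ (2 * m + n)"
  let ?f = "\<lambda>m r. ?a m * (r ^ (2 * (m + n)) * exp (- c * r\<^sup>2))"
  let ?S = "\<lambda>r. r ^ n * exp (- c * r\<^sup>2) * bessel_nat n (k * r)"
  have f_eq: "?f m r = r ^ n * exp (- c * r\<^sup>2) *
      ((-1) ^ m / (fact m * fact (m + n)) * (k * r / 2) ^ (2 * m + n))" for m r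
    by (simp add: power_mult_distrib power_divide power_add mult_2 mult_2_right mult_ac)
  have hbi: "has_bochner_integral rad (?f m) (?a m * (fact (m + n) / (2 * c ^ (m + n + 1))))" for m
    by (intro has_bochner_integral_mult_right has_bochner_integral_gaussian_moment assms)
  have hbi_abs: "has_bochner_integral rad (\<lambda>r. norm (?f m r)) (\<bar>?a m\<bar> * (fact (m + n) / (2 * c ^ (m + n + 1))))" for m
  proof -
    have "norm (?f m r) = \<bar>?a m\<bar> * (r ^ (2 * (m + n)) * exp (- c * r\<^sup>2))" for r
      unfolding real_norm_def abs_mult[of "?a m"] abs_mult[of "r ^ (2 * (m + n))"]
        abs_of_nonneg[OF zero_le_even_power'] abs_exp_cancel by (rule refl)
    thus ?thesis
      using has_bochner_integral_mult_right[OF has_bochner_integral_gaussian_moment[OF assms, of "m + n"], of "\<bar>?a m\<bar>"]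
      by simp
  qed
  \<comment> \<open>\<open>C\<close> and \<open>x\<close> are chosen so that the integrated terms
    are exactly the terms of \<open>C * exp x\<close>.\<close>
  define C where "C = (k / 2) ^ n / (2 * c ^ (n + 1))"
  define x where "x = - (k\<^sup>2 / (4 * c))"
  have int: "?a m * (fact (m + n) / (2 * c ^ (m + n + 1))) = C * (x ^ m / fact m)" for m
    using assms by (simp add: C_def x_def power_add power_minus[of "_ / _"] power_divide power_mult power_commuting[of k 2]
        power_commuting[of 2 m 2] field_simps)
  have "(\<lambda>m. integral\<^sup>L rad (?f m)) sums (\<integral>r. (\<Sum>m. ?f m r) \<partial>rad)"
  proof (rule sums_integral)
    show "integrable rad (?f m)" for m
      using hbi[of m] by (rule integrable.intros)
    show "AE r in rad. summable (\<lambda>m. norm (?f m r))"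
    proof (intro always_eventually allI)
      fix r
      show "summable (\<lambda>m. norm (?f m r))"
        unfolding f_eq norm_mult[of "r ^ n * exp (- c * r\<^sup>2)"] real_norm_def[of "(-1) ^ _ / _ * _"]
        by (intro summable_mult summable_abs_bessel_nat)
    qed
    have "summable (\<lambda>m. norm (C * (x ^ m / fact m)))"
      using summable_mult[OF summable_exp[of "\<bar>x\<bar>"], of "\<bar>C\<bar>"]
      by (simp add: abs_mult power_abs divide_inverse mult.commute)
    moreover have "(\<integral>r. norm (?f m r) \<partial>rad) = norm (C * (x ^ m / fact m))" for m
      unfolding int[symmetric] using hbi_abs[of m] assms by (simp add: has_bochner_integral_iff abs_mult)
    ultimately show "summable (\<lambda>m. \<integral>r. norm (?f m r) \<partial>rad)" by simp
  qed
  also have "(\<lambda>m. integral\<^sup>L rad (?f m)) = (\<lambda>m. C * (x ^ m / fact m))"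
    using hbi int by (simp add: has_bochner_integral_iff)
  also have "(\<lambda>r. \<Sum>m. ?f m r) = ?S"
    unfolding f_eq using sums_mult[OF bessel_nat_sums, of "r ^ n * exp (- c * r\<^sup>2)" n "k * r" for r]
    by (auto simp: sums_iff)
  finally have "(\<lambda>m. C * (x ^ m / fact m)) sums integral\<^sup>L rad ?S" .
  moreover have "(\<lambda>m. C * (x ^ m / fact m)) sums (C * exp x)"
    using exp_converges[of x] by (intro sums_mult) (simp add: divide_inverse mult.commute)
  ultimately have "integral\<^sup>L rad ?S = C * exp x"
    by (rule sums_unique2)
  moreover have "hankel n (gauss_fun n c) k = of_real (integral\<^sup>L rad ?S)"
    unfolding hankel_def gauss_fun_def by (simp flip: of_real_mult)
  moreover have "C * exp x = 1 / (2 * c) ^ (n + 1) * (k ^ n * exp (- (1 / (4 * c)) * k\<^sup>2))"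
    by (simp add: C_def x_def power_divide power_mult_distrib)
  ultimately show ?thesis
    by (simp only: gauss_fun_def of_real_mult)
qed

text \<open>Both sides are explicit, and they agree because
  \<open>2c * 2d * (1 / (4c) + 1 / (4d)) = c + d\<close>.\<close>

lemma hankel_gauss_fun_inner:
  assumes "c > 0" "d > 0"
  shows "L2_inner rad (hankel n (gauss_fun n c)) (hankel n (gauss_fun n d)) =
    L2_inner rad (gauss_fun n c) (gauss_fun n d)"
proof -
  let ?c = "1 / (4 * c)" and ?d = "1 / (4 * d)"
  have "L2_inner rad (hankel n (gauss_fun n c)) (hankel n (gauss_fun n d)) =
      (\<integral>r. of_real (1 / (2 * c) ^ (n + 1) * (1 / (2 * d) ^ (n + 1))) *
         (gauss_fun n ?c r * cnj (gauss_fun n ?d r)) \<partial>rad)"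
    unfolding L2_inner_def hankel_gauss_fun[OF assms(1), abs_def] hankel_gauss_fun[OF assms(2), abs_def]
    by (intro Bochner_Integration.integral_cong) (auto simp: mult_ac)
  also have "\<dots> = of_real (1 / (2 * c) ^ (n + 1) * (1 / (2 * d) ^ (n + 1))) *
      L2_inner rad (gauss_fun n ?c) (gauss_fun n ?d)"
    unfolding L2_inner_def by (rule integral_mult_right_zero)
  also have "\<dots> = of_real (1 / (2 * c) ^ (n + 1) * (1 / (2 * d) ^ (n + 1)) * (fact n / (2 * (?c + ?d) ^ (n + 1))))"
    using assms by (subst gauss_fun_inner(2)) auto
  also have "1 / (2 * c) ^ (n + 1) * (1 / (2 * d) ^ (n + 1)) * (fact n / (2 * (?c + ?d) ^ (n + 1))) =
      fact n / (2 * ((2 * c) * (2 * d) * (?c + ?d)) ^ (n + 1))"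
    by (simp only: power_mult_distrib) simp
  also have "(2 * c) * (2 * d) * (?c + ?d) = c + d"
    using assms by (simp add: field_simps)
  finally show ?thesis
    using assms by (simp add: gauss_fun_inner(2))
qed

text \<open>A linear combination of the Gaussian functions with \<open>c = 1, 2, 3, ...\<close>,
  written as a fixed Gaussian times a polynomial in \<open>exp (- r\<^sup>2)\<close>. In this form
  the density of their span becomes a question of polynomial approximation on the unit
  interval.\<close>

definition gauss_poly :: "nat \<Rightarrow> complex poly \<Rightarrow> real \<Rightarrow> complex" where
  "gauss_poly n p r = gauss_fun n 1 r * poly p (of_real (exp (- r\<^sup>2)))"

lemma gauss_poly_altdef: "gauss_poly n p r = (\<Sum>i\<le>degree p. coeff p i * gauss_fun n (real i + 1) r)"
proof -
  have "gauss_fun n 1 r * of_real (exp (- r\<^sup>2)) ^ i = gauss_fun n (real i + 1) r" for i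
    unfolding gauss_fun_def of_real_power[symmetric] of_real_mult[symmetric]
    by (simp add: exp_add[symmetric] algebra_simps flip: exp_of_nat_mult)
  thus ?thesis
    by (simp add: gauss_poly_def poly_altdef sum_distrib_left mult_ac)
qed

lemma gauss_poly_diff: "gauss_poly n p r - gauss_poly n q r = gauss_poly n (p - q) r"
  by (simp add: gauss_poly_def algebra_simps)

lemma gauss_poly_L2: "gauss_poly n p \<in> L2 rad"
  unfolding gauss_poly_altdef[abs_def] by (intro L2_sum L2_cmult gauss_fun_L2) simp

lemma gauss_poly_integrable: "integrable rad (gauss_poly n p)"
  unfolding gauss_poly_altdef[abs_def]
  by (intro Bochner_Integration.integrable_sum integrable_mult_right gauss_fun_integrable) simp

lemma hankel_gauss_poly: "hankel n (gauss_poly n p) k = (\<Sum>i\<le>degree p. coeff p i * hankel n (gauss_fun n (real i + 1)) k)"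
proof -
  have "hankel n (gauss_poly n p) k =
      (\<integral>r. (\<Sum>i\<le>degree p. coeff p i * (gauss_fun n (real i + 1) r * of_real (bessel_nat n (k * r)))) \<partial>rad)"
    by (simp add: hankel_def gauss_poly_altdef sum_distrib_right mult.assoc)
  also have "\<dots> = (\<Sum>i\<le>degree p. coeff p i * hankel n (gauss_fun n (real i + 1)) k)"
    unfolding hankel_def by (subst Bochner_Integration.integral_sum)
      (auto intro!: integrable_mult_right abs_integrable_times_bessel_nat gauss_fun_integrable)
  finally show ?thesis .
qed

lemma hankel_gauss_fun_L2:
  assumes "c > 0"
  shows "hankel n (gauss_fun n c) \<in> L2 rad"
  unfolding hankel_gauss_fun[OF assms, abs_def] using assms by (intro L2_cmult gauss_fun_L2) simp

lemma hankel_gauss_poly_L2: "hankel n (gauss_poly n p) \<in> L2 rad"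
  unfolding hankel_gauss_poly[abs_def] by (intro L2_sum L2_cmult hankel_gauss_fun_L2) simp

lemma L2_inner_cmult: "L2_inner M (\<lambda>x. a * f x) (\<lambda>x. b * g x) = a * cnj b * L2_inner M f g"
  unfolding L2_inner_def by (subst integral_mult_right_zero[symmetric]) (simp add: mult_ac)

text \<open>Both squared norms expand into the same double sum of coefficients times inner products
  of Gaussian functions, and these inner products are preserved one by one.\<close>

lemma hankel_gauss_poly_norm: "L2_norm rad (hankel n (gauss_poly n p)) = L2_norm rad (gauss_poly n p)"
proof -
  have *: "L2_inner rad (\<lambda>x. \<Sum>i\<le>d. a i * f i x) (\<lambda>x. \<Sum>i\<le>d. a i * f i x) =
      (\<Sum>i\<le>d. \<Sum>j\<le>d. a i * cnj (a j) * L2_inner rad (f i) (f j))"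
    if "\<And>i. f i \<in> L2 rad" for f :: "nat \<Rightarrow> real \<Rightarrow> complex" and a and d :: nat
    using that by (simp add: L2_inner_sum_left L2_inner_sum_right L2_sum L2_cmult L2_inner_cmult)
  have "L2_inner rad (hankel n (gauss_poly n p)) (hankel n (gauss_poly n p)) =
      L2_inner rad (gauss_poly n p) (gauss_poly n p)"
    unfolding hankel_gauss_poly[abs_def] unfolding gauss_poly_altdef[abs_def]
    by (subst (1 2) *) (auto simp: hankel_gauss_fun_L2 gauss_fun_L2 hankel_gauss_fun_inner)
  hence "(L2_norm rad (hankel n (gauss_poly n p)))\<^sup>2 = (L2_norm rad (gauss_poly n p))\<^sup>2"
    unfolding L2_inner_self by (simp only: of_real_eq_iff)
  thus ?thesis by simp
qed

section \<open>Density of the Gaussian functions and the isometry property\<close>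

lemma L2_dominated_convergence:
  assumes f: "\<And>i. f i \<in> borel_measurable M" "g \<in> borel_measurable M"
    and w: "integrable M (\<lambda>x. (w x :: real)\<^sup>2)"
    and bound: "\<And>i. AE x in M. cmod (f i x) \<le> w x"
    and lim: "AE x in M. (\<lambda>i. f i x) \<longlonglongrightarrow> g x"
  shows "f i \<in> L2 M" "g \<in> L2 M" "(\<lambda>i. L2_norm M (\<lambda>x. f i x - g x)) \<longlonglongrightarrow> 0"
proof -
  have bd: "AE x in M. \<forall>i. cmod (f i x) \<le> w x"
    using bound by (simp add: AE_all_countable)
  have bd': "AE x in M. cmod (g x) \<le> w x"
    using bd lim
  proof eventually_elim
    case (elim x)
    show ?case
      by (rule Lim_bounded[OF tendsto_norm[OF elim(2)]]) (use elim(1) in auto)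
  qed
  show "f i \<in> L2 M" for i
    by (rule L2_bound[OF f(1) w], use bound[of i] in eventually_elim) (auto intro: power_mono)
  show "g \<in> L2 M"
    by (rule L2_bound[OF f(2) w], use bd' in eventually_elim) (auto intro: power_mono)
  have "(\<lambda>i. \<integral>x. (cmod (f i x - g x))\<^sup>2 \<partial>M) \<longlonglongrightarrow> (\<integral>x. 0 \<partial>M)"
  proof (rule integral_dominated_convergence[where w = "\<lambda>x. 4 * (w x)\<^sup>2"])
    show "integrable M (\<lambda>x. 4 * (w x)\<^sup>2)"
      using w by (rule integrable_mult_right)
    show "AE x in M. (\<lambda>i. (cmod (f i x - g x))\<^sup>2) \<longlonglongrightarrow> 0"
      using lim
    proof eventually_elim
      case (elim x)
      have "(\<lambda>i. (cmod (f i x - g x))\<^sup>2) \<longlonglongrightarrow> (cmod (g x - g x))\<^sup>2"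
        using elim by (intro tendsto_intros)
      thus ?case by simp
    qed
    show "AE x in M. norm ((cmod (f i x - g x))\<^sup>2) \<le> 4 * (w x)\<^sup>2" for i
      using bd bd'
    proof eventually_elim
      case (elim x)
      have "cmod (f i x - g x) \<le> cmod (f i x) + cmod (g x)"
        by (rule norm_triangle_ineq4)
      also have "\<dots> \<le> 2 * w x"
        using spec[OF elim(1), of i] elim(2) by linarith
      finally have "(cmod (f i x - g x))\<^sup>2 \<le> (2 * w x)\<^sup>2"
        by (rule power_mono) simp
      thus ?case by (simp add: power_mult_distrib)
    qed
  qed (use f in measurable)
  from tendsto_real_sqrt[OF this]
  show "(\<lambda>i. L2_norm M (\<lambda>x. f i x - g x)) \<longlonglongrightarrow> 0"
    by (simp add: L2_norm_def)
qed

lemma complex_polynomial_function_poly: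
  fixes q :: "real \<Rightarrow> complex"
  assumes "polynomial_function q"
  shows "\<exists>p. \<forall>x. q x = poly p (of_real x)"
proof -
  have poly: "\<exists>p. \<forall>x. of_real (f x) = poly p (of_real x :: complex)" if f: "real_polynomial_function f" for f
  proof -
    obtain a n where "f = (\<lambda>x. \<Sum>i\<le>n. a i * x ^ i)"
      using f by (auto simp: real_polynomial_function_iff_sum)
    hence "\<forall>x. of_real (f x) = poly (\<Sum>i\<le>n. monom (of_real (a i)) i) (of_real x :: complex)"
      by (simp add: poly_sum poly_monom)
    thus ?thesis by blast
  qed
  have "real_polynomial_function (\<lambda>x. Re (q x))" "real_polynomial_function (\<lambda>x. Im (q x))"
    using assms bounded_linear_Re bounded_linear_Im by (auto simp: polynomial_function_def o_def)
  from poly[OF this(1)] poly[OF this(2)] obtain p p' :: "complex poly"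
    where 1: "\<And>x. of_real (Re (q x)) = poly p (of_real x)"
      and 2: "\<And>x. of_real (Im (q x)) = poly p' (of_real x)"
    by blast
  have "\<forall>x. q x = poly (p + smult \<i> p') (of_real x)"
    unfolding poly_add poly_smult 1[symmetric] 2[symmetric] by (intro allI complex_eq)
  thus ?thesis by blast
qed

text \<open>Weierstrass approximation in the variable \<open>u = exp (- r\<^sup>2) \<in> (0, 1)\<close>.\<close>

lemma gauss_poly_approximation:
  assumes g [measurable]: "g \<in> borel_measurable borel"
    and B: "B \<ge> 0" "\<And>r. r > 0 \<Longrightarrow> cmod (g r) \<le> B * cmod (gauss_fun n 1 r)"
  shows "\<exists>p. (AE r in rad. (\<lambda>j. gauss_poly n (p j) r) \<longlonglongrightarrow> g r) \<and>
     (\<forall>j r. r > 0 \<longrightarrow> cmod (gauss_poly n (p j) r) \<le> (B + 1) * cmod (gauss_fun n 1 r))"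
proof -
  \<comment> \<open>The inverse of \<open>r \<mapsto> exp (- r\<^sup>2)\<close> from the positive
    half-line onto the open unit interval. \<open>G\<close> is \<open>g\<close> divided by the
    Gaussian, read in the new variable; the hypothesis makes it bounded by \<open>B\<close>.\<close>
  define \<rho> :: "real \<Rightarrow> real" where "\<rho> u = sqrt (- ln u)" for u
  define G where "G u = (if u \<in> {0<..<1} then g (\<rho> u) / gauss_fun n 1 (\<rho> u) else 0)" for u
  have [measurable]: "G \<in> borel_measurable borel"
    unfolding G_def \<rho>_def by measurable
  have gauss_pos: "gauss_fun n 1 r \<noteq> 0" if "r > 0" for r
    using that by (simp add: gauss_fun_def)
  have G_bound: "cmod (G u) \<le> B" for u
  proof (cases "u \<in> {0<..<1}")
    case True
    hence "\<rho> u > 0" by (simp add: \<rho>_def)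
    thus ?thesis
      using B(2)[of "\<rho> u"] gauss_pos[of "\<rho> u"] True by (simp add: G_def norm_divide divide_le_eq)
  next
    case False
    thus ?thesis
      using B(1) unfolding G_def by (subst if_not_P) auto
  qed
  have "G measurable_on UNIV"
    by (subst measurable_on_iff_borel_measurable)
      (auto intro!: measurable_completion simp: lebesgue_on_UNIV_eq)
  then obtain N H where N: "negligible N" and H: "\<And>j. continuous_on UNIV (H j)"
    and lim: "\<And>u. u \<notin> N \<Longrightarrow> (\<lambda>j. H j u) \<longlonglongrightarrow> G u"
    unfolding measurable_on_def by auto
  \<comment> \<open>The continuous functions \<open>H j\<close> tend to \<open>G\<close> off a null
    set, but may be unbounded. Composing with the nearest point map of the ball keeps them
    continuous, bounds them by \<open>B\<close>, and preserves the limit, since \<open>G\<close>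
    takes values in the ball.\<close>
  let ?cp = "closest_point (cball 0 B :: complex set)"
  have cp: "?cp z \<in> cball 0 B" for z
    using B(1) by (intro closest_point_in_set) auto
  have cont_cp: "continuous_on UNIV ?cp"
    using B(1) by (intro continuous_on_closest_point) auto
  have "\<exists>q. polynomial_function q \<and> (\<forall>u\<in>{0..1}. norm (?cp (H j u) - q u) < 1 / (real j + 1))" for j
    by (intro Stone_Weierstrass_polynomial_function)
      (auto intro!: continuous_on_compose2[OF cont_cp continuous_on_subset[OF H]])
  then obtain q where q: "\<And>j. polynomial_function (q j)"
    and q_approx: "\<And>j u. u \<in> {0..1} \<Longrightarrow> norm (?cp (H j u) - q j u) < 1 / (real j + 1)"
    by metis
  have "\<exists>p. \<forall>x. q j x = poly p (of_real x)" for j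
    by (rule complex_polynomial_function_poly[OF q])
  then obtain p where p: "\<And>j x. q j x = poly (p j) (of_real x)"
    by metis
  have q_lim: "(\<lambda>j. q j u) \<longlonglongrightarrow> G u" if "u \<in> {0..1}" "u \<notin> N" for u
  proof -
    have "(\<lambda>j. ?cp (H j u)) \<longlonglongrightarrow> ?cp (G u)"
      using cont_cp lim[OF that(2)] by (intro isCont_tendsto_compose[of _ ?cp]) (auto simp: continuous_on_eq_continuous_at)
    also have "?cp (G u) = G u"
      using G_bound by (intro closest_point_self) simp
    finally have 1: "(\<lambda>j. ?cp (H j u)) \<longlonglongrightarrow> G u" .
    have "(\<lambda>j. q j u - ?cp (H j u)) \<longlonglongrightarrow> 0"
    proof (rule Lim_null_comparison)
      show "\<forall>\<^sub>F j in sequentially. norm (q j u - ?cp (H j u)) \<le> 1 / (real j + 1)"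
        using q_approx[OF that(1)] by (intro always_eventually allI less_imp_le) (simp add: norm_minus_commute)
      show "(\<lambda>j. 1 / (real j + 1)) \<longlonglongrightarrow> 0"
        using LIMSEQ_inverse_real_of_nat by (simp add: inverse_eq_divide add.commute)
    qed
    from tendsto_add[OF this 1] show ?thesis by simp
  qed
  have q_bound: "cmod (q j u) \<le> B + 1" if "u \<in> {0..1}" for j u
  proof -
    have "cmod (q j u) \<le> cmod (?cp (H j u)) + cmod (?cp (H j u) - q j u)"
      using norm_triangle_sub[of "q j u" "?cp (H j u)"] by (simp add: norm_minus_commute)
    also have "\<dots> \<le> B + 1 / (real j + 1)"
      using cp[of "H j u"] less_imp_le[OF q_approx[OF that, of j]] by (intro add_mono) auto
    also have "1 / (real j + 1) \<le> 1" by simp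
    finally show ?thesis by simp
  qed
  \<comment> \<open>The exceptional set lives in the variable \<open>u\<close>. As a differentiable
    map, \<open>\<rho>\<close> carries it to a null set in \<open>r\<close>.\<close>
  have "negligible (\<rho> ` (N \<inter> {0<..<1}))"
  proof (rule negligible_differentiable_image_negligible)
    show "\<rho> differentiable_on N \<inter> {0<..<1}"
      unfolding differentiable_on_def
    proof
      fix u assume "u \<in> N \<inter> {0<..<1}"
      hence "(\<rho> has_real_derivative (inverse (sqrt (- ln u)) / 2 * - (1 / u))) (at u within N \<inter> {0<..<1})"
        unfolding \<rho>_def by (auto intro!: derivative_eq_intros)
      thus "\<rho> differentiable (at u within N \<inter> {0<..<1})"
        by (auto simp: real_differentiable_def)
    qed
  qed (use N in \<open>auto intro: negligible_subset\<close>)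
  hence "\<rho> ` (N \<inter> {0<..<1}) \<in> null_sets lebesgue"
    by (simp add: negligible_iff_null_sets)
  hence "AE r in lborel. r \<notin> \<rho> ` (N \<inter> {0<..<1})"
    using AE_not_in AE_completion_iff by blast
  hence "AE r in rad. (\<lambda>j. gauss_poly n (p j) r) \<longlonglongrightarrow> g r"
    unfolding AE_radial_measure
  proof (eventually_elim, intro impI)
    fix r :: real assume r: "r \<notin> \<rho> ` (N \<inter> {0<..<1})" "r > 0"
    define u where "u = exp (- r\<^sup>2)"
    have u: "u \<in> {0<..<1}" "\<rho> u = r"
      using r by (auto simp: u_def \<rho>_def)
    hence "u \<notin> N" using r by blast
    hence "(\<lambda>j. gauss_fun n 1 r * q j u) \<longlonglongrightarrow> gauss_fun n 1 r * G u"
      using u by (intro tendsto_intros q_lim) auto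
    moreover have "gauss_fun n 1 r * G u = g r"
      using u gauss_pos[OF r(2)] by (simp add: G_def)
    ultimately show "(\<lambda>j. gauss_poly n (p j) r) \<longlonglongrightarrow> g r"
      by (simp add: gauss_poly_def p u_def)
  qed
  moreover have "cmod (gauss_poly n (p j) r) \<le> (B + 1) * cmod (gauss_fun n 1 r)" for j r
    using mult_right_mono[OF q_bound[of "exp (- r\<^sup>2)" j], of "cmod (gauss_fun n 1 r)"]
    by (simp add: gauss_poly_def p[symmetric] norm_mult mult.commute)
  ultimately show ?thesis by blast
qed

lemma measurable_hankel [measurable]:
  assumes [measurable]: "g \<in> borel_measurable borel"
  shows "hankel n g \<in> borel_measurable borel"
  unfolding hankel_def[abs_def] by measurable

lemma hankel_tendsto:
  assumes w: "integrable rad w" "\<And>i. AE r in rad. cmod (f i r) \<le> w r"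
    and lim: "AE r in rad. (\<lambda>i. f i r) \<longlonglongrightarrow> g r"
    and [measurable]: "\<And>i. f i \<in> borel_measurable borel" "g \<in> borel_measurable borel"
  shows "(\<lambda>i. hankel n (f i) k) \<longlonglongrightarrow> hankel n g k"
  unfolding hankel_def
proof (rule integral_dominated_convergence[where w = w])
  show "AE r in rad. (\<lambda>i. f i r * of_real (bessel_nat n (k * r))) \<longlonglongrightarrow> g r * of_real (bessel_nat n (k * r))"
    using lim by eventually_elim (intro tendsto_intros)
  show "AE r in rad. norm (f i r * of_real (bessel_nat n (k * r))) \<le> w r" for i
    using w(2)[of i]
  proof eventually_elim
    case (elim r)
    have "norm (f i r * of_real (bessel_nat n (k * r))) \<le> norm (f i r)"
      using abs_bessel_nat_le_1[of n "k * r"] by (auto simp: norm_mult mult_left_le)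
    thus ?case using elim by simp
  qed
qed (use w(1) in measurable)

lemma hankel_diff:
  assumes "integrable rad f" "integrable rad g"
  shows "hankel n (\<lambda>r. f r - g r) k = hankel n f k - hankel n g k"
  unfolding hankel_def using assms
  by (simp add: left_diff_distrib abs_integrable_times_bessel_nat)

text \<open>Domination by a Gaussian serves twice. It is integrable, so the transforms of the
  approximating functions converge pointwise; it is square integrable, so the functions themselves
  converge in mean. The limit principle for norm-preserving maps combines the two.\<close>

lemma gauss_bounded_isometry:
  assumes g [measurable]: "g \<in> borel_measurable borel"
    and B: "B \<ge> 0" "\<And>r. r > 0 \<Longrightarrow> cmod (g r) \<le> B * cmod (gauss_fun n 1 r)"
  shows "g \<in> L2 rad" "integrable rad g"
    "hankel n g \<in> L2 rad" "L2_norm rad (hankel n g) = L2_norm rad g"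
proof -
  obtain p where lim: "AE r in rad. (\<lambda>j. gauss_poly n (p j) r) \<longlonglongrightarrow> g r"
    and bound: "\<And>j r. r > 0 \<Longrightarrow> cmod (gauss_poly n (p j) r) \<le> (B + 1) * cmod (gauss_fun n 1 r)"
    using gauss_poly_approximation[OF assms] by blast
  let ?w = "\<lambda>r. (B + 1) * cmod (gauss_fun n 1 r)"
  have w: "integrable rad (\<lambda>r. (?w r)\<^sup>2)" "integrable rad ?w"
    using L2_integrable[OF gauss_fun_L2[of 1 n]] integrable_norm[OF gauss_fun_integrable[of 1 n]]
    by (auto simp: power_mult_distrib intro: integrable_mult_right)
  have bd: "AE r in rad. cmod (gauss_poly n (p j) r) \<le> ?w r" for j
    by (rule AE_radial_measureI) (rule bound)
  have [measurable]: "gauss_poly n q \<in> borel_measurable borel" for q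
    using L2_measurable[OF gauss_poly_L2] by simp
  note conv = L2_dominated_convergence[OF _ _ w(1) bd lim]
  show "g \<in> L2 rad"
    by (rule conv(2)) measurable
  show int: "integrable rad g"
  proof (rule Bochner_Integration.integrable_bound[OF w(2)])
    show "AE r in rad. norm (g r) \<le> norm (?w r)"
    proof (rule AE_radial_measureI)
      fix r :: real assume "r > 0"
      have "cmod (g r) \<le> ?w r"
        using B(2)[OF \<open>r > 0\<close>] norm_ge_zero[of "gauss_fun n 1 r"] by (simp only: ring_distribs)
      thus "norm (g r) \<le> norm (?w r)" by simp
    qed
  qed measurable
  have hankel_lim: "AE k in rad. (\<lambda>j. hankel n (gauss_poly n (p j)) k) \<longlonglongrightarrow> hankel n g k"
    by (intro always_eventually allI hankel_tendsto[OF w(2) bd lim]) measurable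
  have diff: "L2_norm rad (\<lambda>x. hankel n (gauss_poly n (p i)) x - hankel n (gauss_poly n (p j)) x) =
      L2_norm rad (\<lambda>x. gauss_poly n (p i) x - gauss_poly n (p j) x)" for i j
    unfolding hankel_diff[OF gauss_poly_integrable gauss_poly_integrable, symmetric] gauss_poly_diff
    using hankel_gauss_poly_norm[of n "p i - p j"] by simp
  note * = L2_isometry_limit[OF gauss_poly_L2 _ _ hankel_gauss_poly_L2 _ hankel_lim hankel_gauss_poly_norm diff]
  show "hankel n g \<in> L2 rad" "L2_norm rad (hankel n g) = L2_norm rad g"
    by (rule *; (rule conv; measurable)?; measurable)+
qed

lemma indicator_L2_radial_measure: "(\<lambda>r. indicator {0..\<rho>} r) \<in> L2 rad"
proof (rule L2I)
  have "integrable lborel (\<lambda>r. indicator {0..\<rho>} r *\<^sub>R r)"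
    by (rule borel_integrable_compact) (auto intro!: continuous_intros)
  hence "integrable lborel (\<lambda>r. indicator {0<..} r *\<^sub>R (indicator {0..\<rho>} r *\<^sub>R r))"
    by (rule integrable_mult_indicator[rotated]) simp
  also have "(\<lambda>r. indicator {0<..} r *\<^sub>R (indicator {0..\<rho>} r *\<^sub>R r)) =
      (\<lambda>r. indicator {0<..} r *\<^sub>R (r *\<^sub>R (cmod (indicator {0..\<rho>} r))\<^sup>2))"
    by (auto split: split_indicator)
  finally show "integrable rad (\<lambda>r. (cmod (indicator {0..\<rho>} r))\<^sup>2)"
    using has_bochner_integral_radial_measure[of "\<lambda>r. (cmod (indicator {0..\<rho>} r))\<^sup>2"]
    by (auto simp: has_bochner_integral_iff)
qed measurable

text \<open>A bounded interval has finite mass, so its indicator is square integrable and can be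
  paired with \<open>g\<close>.\<close>

lemma bounded_support_integrable:
  assumes g: "g \<in> L2 rad" and supp: "\<And>r. r > \<rho> \<Longrightarrow> g r = 0"
  shows "integrable rad g"
proof -
  have "integrable rad (\<lambda>r. g r * cnj (indicator {0..\<rho>} r))"
    by (rule L2_integrable_mult[OF g indicator_L2_radial_measure])
  moreover have "AE r in rad. g r * cnj (indicator {0..\<rho>} r) = g r"
    by (rule AE_radial_measureI) (use supp in \<open>auto simp: not_le split: split_indicator\<close>)
  ultimately show ?thesis
    using L2_measurable[OF g]
    by (subst (asm) integrable_cong_AE[where g = g]) (auto intro!: borel_measurable_integrable)
qed

text \<open>\<open>g\<close> is replaced by 0 wherever it exceeds \<open>j\<close> times the
  Gaussian. Since the Gaussian is positive for \<open>r > 0\<close>, these truncations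
  \<open>G j\<close> eventually equal \<open>g\<close> at every such point. The bounded support
  makes \<open>g\<close> itself an integrable majorant, so the transforms converge
  pointwise.\<close>

lemma hankel_isometry:
  assumes g: "g \<in> L2 rad" and supp: "\<And>r. r > \<rho> \<Longrightarrow> g r = 0"
  shows "hankel n g \<in> L2 rad" "L2_norm rad (hankel n g) = L2_norm rad g"
proof -
  have [measurable]: "g \<in> borel_measurable borel"
    using L2_measurable[OF g] by simp
  define G where "G j r = (if cmod (g r) \<le> real j * cmod (gauss_fun n 1 r) then g r else 0)" for j :: nat and r
  have [measurable]: "G j \<in> borel_measurable borel" for j
    unfolding G_def by measurable
  have Gb: "cmod (G j r) \<le> real j * cmod (gauss_fun n 1 r)" for j r
    by (simp add: G_def)
  note iso = gauss_bounded_isometry[of "G j" "real j" n for j, OF _ _ Gb]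
  have G_le: "AE r in rad. cmod (G j r) \<le> cmod (g r)" for j
    by (simp add: G_def)
  have G_lim: "AE r in rad. (\<lambda>j. G j r) \<longlonglongrightarrow> g r"
  proof (rule AE_radial_measureI)
    fix r :: real assume r: "r > 0"
    hence pos: "cmod (gauss_fun n 1 r) > 0" by (simp add: gauss_fun_def)
    obtain j0 :: nat where j0: "cmod (g r) / cmod (gauss_fun n 1 r) \<le> real j0"
      using real_arch_simple by blast
    have "G j r = g r" if "j \<ge> j0" for j
    proof -
      have "cmod (g r) / cmod (gauss_fun n 1 r) \<le> real j" using j0 that by simp
      thus ?thesis using pos by (simp add: G_def divide_le_eq)
    qed
    thus "(\<lambda>j. G j r) \<longlonglongrightarrow> g r"
      by (intro tendsto_eventually eventually_sequentiallyI[of j0])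
  qed
  have w: "integrable rad (\<lambda>r. (cmod (g r))\<^sup>2)" "integrable rad (\<lambda>r. cmod (g r))"
    using L2_integrable[OF g] integrable_norm[OF bounded_support_integrable[OF assms]] by auto
  note conv = L2_dominated_convergence[OF _ _ w(1) G_le G_lim]
  have hankel_lim: "AE k in rad. (\<lambda>j. hankel n (G j) k) \<longlonglongrightarrow> hankel n g k"
    by (intro always_eventually allI hankel_tendsto[OF w(2) G_le G_lim]) measurable
  have diff: "L2_norm rad (\<lambda>k. hankel n (G i) k - hankel n (G j) k) = L2_norm rad (\<lambda>r. G i r - G j r)" for i j
  proof -
    have "cmod (G i r - G j r) \<le> real (i + j) * cmod (gauss_fun n 1 r)" for r
      using norm_triangle_ineq4[of "G i r" "G j r"] Gb[of i r] Gb[of j r] by (simp add: ring_distribs)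
    hence "L2_norm rad (hankel n (\<lambda>r. G i r - G j r)) = L2_norm rad (\<lambda>r. G i r - G j r)"
      by (intro gauss_bounded_isometry(4)[where B = "real (i + j)"]) auto
    moreover have "hankel n (\<lambda>r. G i r - G j r) = (\<lambda>k. hankel n (G i) k - hankel n (G j) k)"
      by (intro ext hankel_diff iso) measurable
    ultimately show ?thesis by simp
  qed
  show "hankel n g \<in> L2 rad"
    by (rule L2_isometry_limit(1)[OF _ g conv(3) _ _ hankel_lim _ diff])
      (auto intro!: iso)
  show "L2_norm rad (hankel n g) = L2_norm rad g"
    by (rule L2_isometry_limit(2)[OF _ g conv(3) _ _ hankel_lim _ diff])
      (auto intro!: iso)
qed

lemma L2_norm_0: "L2_norm M (\<lambda>x. 0) = 0"
  by (simp add: L2_norm_def)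

section \<open>Extension of the transform to all square integrable functions\<close>

definition cutoff :: "real \<Rightarrow> (real \<Rightarrow> complex) \<Rightarrow> real \<Rightarrow> complex" where
  "cutoff \<rho> g r = indicator {..\<rho>} r * g r"

lemma cutoff_eq_0: "r > \<rho> \<Longrightarrow> cutoff \<rho> g r = 0"
  by (simp add: cutoff_def)

lemma cutoff_L2: "g \<in> L2 rad \<Longrightarrow> cutoff \<rho> g \<in> L2 rad"
  unfolding cutoff_def[abs_def] by (intro L2_indicator) auto

lemma hankel_cutoff_L2: "g \<in> L2 rad \<Longrightarrow> hankel n (cutoff \<rho> g) \<in> L2 rad"
  by (rule hankel_isometry(1)[OF cutoff_L2 cutoff_eq_0])

lemma cutoff_integrable: "g \<in> L2 rad \<Longrightarrow> integrable rad (cutoff \<rho> g)"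
  by (rule bounded_support_integrable[OF cutoff_L2 cutoff_eq_0])

lemma cutoff_tendsto:
  assumes g: "g \<in> L2 rad"
  shows "((\<lambda>\<rho>. L2_norm rad (\<lambda>r. cutoff \<rho> g r - g r)) \<longlongrightarrow> 0) at_top"
proof (rule tendsto_at_topI_sequentially)
  fix X :: "nat \<Rightarrow> real" assume X: "filterlim X at_top sequentially"
  show "(\<lambda>i. L2_norm rad (\<lambda>r. cutoff (X i) g r - g r)) \<longlonglongrightarrow> 0"
  proof (rule L2_dominated_convergence(3)[OF _ _ L2_integrable[OF g]])
    show "AE r in rad. cmod (cutoff (X i) g r) \<le> cmod (g r)" for i
      by (auto simp: cutoff_def split: split_indicator)
    have "(\<lambda>i. cutoff (X i) g r) \<longlonglongrightarrow> g r" for r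
    proof (rule tendsto_eventually)
      show "\<forall>\<^sub>F i in sequentially. cutoff (X i) g r = g r"
        using filterlim_at_top[THEN iffD1, OF X, rule_format, of r]
        by eventually_elim (simp add: cutoff_def)
    qed
    thus "AE r in rad. (\<lambda>i. cutoff (X i) g r) \<longlonglongrightarrow> g r" by simp
  qed (use L2_measurable[OF g] L2_measurable[OF cutoff_L2[OF g]] in auto)
qed

lemma borel_measurable_bessel_J [measurable]: "bessel_J \<alpha> \<in> borel_measurable borel"
  unfolding bessel_J_def[abs_def] by measurable

text \<open>The two versions of the Bessel function are identified for positive arguments only;
  \<open>k > 0\<close> is assumed, and almost every \<open>r\<close> is positive.\<close>

lemma truncated_hankel_eq:
  assumes [measurable]: "g \<in> borel_measurable borel" and "k > 0"
  shows "truncated_hankel (real n) \<rho> g k = hankel n (cutoff \<rho> g) k"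
  unfolding truncated_hankel_def hankel_def cutoff_def
proof (rule integral_cong_AE)
  show "AE r in rad. indicator {..\<rho>} r *\<^sub>R (g r * of_real (bessel_J (real n) (k * r))) =
      indicator {..\<rho>} r * g r * of_real (bessel_nat n (k * r))"
    by (rule AE_radial_measureI) (use assms in \<open>auto simp: bessel_J_of_nat split: split_indicator\<close>)
qed measurable

text \<open>The transform of a cutoff is square integrable by the isometry, so the nonnegative
  integral in the definition is finite and equals the squared norm of the difference.\<close>

lemma has_hankel_transform_iff:
  "has_hankel_transform (real n) g h \<longleftrightarrow> g \<in> L2 rad \<and> h \<in> L2 rad \<and>
     ((\<lambda>\<rho>. L2_norm rad (\<lambda>k. hankel n (cutoff \<rho> g) k - h k)) \<longlongrightarrow> 0) at_top"
proof -
  have "((\<lambda>\<rho>. \<integral>\<^sup>+k. ennreal ((cmod (truncated_hankel (real n) \<rho> g k - h k))\<^sup>2) \<partial>rad)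
        \<longlongrightarrow> 0) at_top \<longleftrightarrow> ((\<lambda>\<rho>. L2_norm rad (\<lambda>k. hankel n (cutoff \<rho> g) k - h k)) \<longlongrightarrow> 0) at_top"
    if g: "g \<in> L2 rad" and h: "h \<in> L2 rad"
  proof -
    let ?N = "\<lambda>\<rho>. L2_norm rad (\<lambda>k. hankel n (cutoff \<rho> g) k - h k)"
    have "(\<integral>\<^sup>+k. ennreal ((cmod (truncated_hankel (real n) \<rho> g k - h k))\<^sup>2) \<partial>rad) = ennreal ((?N \<rho>)\<^sup>2)" for \<rho>
    proof -
      have "(\<integral>\<^sup>+k. ennreal ((cmod (truncated_hankel (real n) \<rho> g k - h k))\<^sup>2) \<partial>rad) =
          (\<integral>\<^sup>+k. ennreal ((cmod (hankel n (cutoff \<rho> g) k - h k))\<^sup>2) \<partial>rad)"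
        by (intro nn_integral_cong_AE AE_radial_measureI) (use L2_measurable[OF g] in \<open>simp add: truncated_hankel_eq\<close>)
      also have "\<dots> = ennreal ((?N \<rho>)\<^sup>2)"
        by (intro L2_nn_integral L2_diff hankel_cutoff_L2 g h)
      finally show ?thesis .
    qed
    moreover have "((\<lambda>\<rho>. ennreal ((?N \<rho>)\<^sup>2)) \<longlongrightarrow> 0) at_top \<longleftrightarrow> ((\<lambda>\<rho>. (?N \<rho>)\<^sup>2) \<longlongrightarrow> 0) at_top"
      using tendsto_ennreal_iff[of "\<lambda>\<rho>. (?N \<rho>)\<^sup>2" at_top 0] by simp
    moreover have "((\<lambda>\<rho>. (?N \<rho>)\<^sup>2) \<longlongrightarrow> 0) at_top \<longleftrightarrow> (?N \<longlongrightarrow> 0) at_top"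
    proof
      assume "((\<lambda>\<rho>. (?N \<rho>)\<^sup>2) \<longlongrightarrow> 0) at_top"
      from tendsto_real_sqrt[OF this] show "(?N \<longlongrightarrow> 0) at_top" by simp
    next
      assume "(?N \<longlongrightarrow> 0) at_top"
      from tendsto_power[OF this, of 2] show "((\<lambda>\<rho>. (?N \<rho>)\<^sup>2) \<longlongrightarrow> 0) at_top" by simp
    qed
    ultimately show ?thesis by simp
  qed
  thus ?thesis
    unfolding has_hankel_transform_def by blast
qed

lemma has_hankel_transform_L2:
  assumes "has_hankel_transform (real n) g h"
  shows "g \<in> L2 rad" "h \<in> L2 rad"
    "((\<lambda>\<rho>. L2_norm rad (\<lambda>k. hankel n (cutoff \<rho> g) k - h k)) \<longlongrightarrow> 0) at_top"
  using assms by (auto simp: has_hankel_transform_iff)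

lemma has_hankel_transform_bounded_support:
  assumes g: "g \<in> L2 rad" and supp: "\<And>r. r > \<rho> \<Longrightarrow> g r = 0"
  shows "has_hankel_transform (real n) g (hankel n g)"
proof -
  have "((\<lambda>\<rho>. L2_norm rad (\<lambda>k. hankel n (cutoff \<rho> g) k - hankel n g k)) \<longlongrightarrow> 0) at_top"
  proof (rule tendsto_eventually)
    show "\<forall>\<^sub>F \<sigma> in at_top. L2_norm rad (\<lambda>k. hankel n (cutoff \<sigma> g) k - hankel n g k) = 0"
      using eventually_ge_at_top[of \<rho>]
    proof eventually_elim
      case (elim \<sigma>)
      have "cutoff \<sigma> g = g"
        using elim supp by (auto simp: cutoff_def fun_eq_iff not_le split: split_indicator)
      thus ?case by (simp add: L2_norm_def)
    qed
  qed
  thus ?thesis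
    using g hankel_isometry(1)[OF assms] by (simp add: has_hankel_transform_iff)
qed

text \<open>The cutoffs of \<open>g\<close> converge to \<open>g\<close> in mean, and the isometry
  makes their transforms a Cauchy family, whose limit exists by completeness.\<close>

lemma has_hankel_transform_exists:
  assumes g: "g \<in> L2 rad"
  shows "\<exists>h. has_hankel_transform (real n) g h"
proof -
  let ?N = "\<lambda>\<rho>. L2_norm rad (\<lambda>r. cutoff \<rho> g r - g r)"
  let ?T = "\<lambda>\<rho>. hankel n (cutoff \<rho> g)"
  have dist: "L2_norm rad (\<lambda>k. ?T \<rho> k - ?T \<sigma> k) \<le> ?N \<rho> + ?N \<sigma>" for \<rho> \<sigma>
  proof -
    have "(\<lambda>k. ?T \<rho> k - ?T \<sigma> k) = hankel n (\<lambda>r. cutoff \<rho> g r - cutoff \<sigma> g r)"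
      by (intro ext hankel_diff[symmetric] cutoff_integrable g)
    hence "L2_norm rad (\<lambda>k. ?T \<rho> k - ?T \<sigma> k) =
        L2_norm rad (hankel n (\<lambda>r. cutoff \<rho> g r - cutoff \<sigma> g r))" by simp
    also have "\<dots> = L2_norm rad (\<lambda>r. cutoff \<rho> g r - cutoff \<sigma> g r)"
      by (rule hankel_isometry(2)[where \<rho> = "max \<rho> \<sigma>"]) (auto intro!: L2_diff cutoff_L2 g simp: cutoff_eq_0)
    also have "\<dots> \<le> ?N \<rho> + ?N \<sigma>"
      using L2_norm_triangle_diff[OF cutoff_L2[OF g] g cutoff_L2[OF g]]
      by (simp add: L2_norm_minus_commute[of _ g])
    finally show ?thesis .
  qed
  have small: "\<forall>\<^sub>F \<rho> in at_top. ?N \<rho> < e" if "e > 0" for e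
    by (rule order_tendstoD(2)[OF cutoff_tendsto[OF g] that])
  have "\<exists>h\<in>L2 rad. (\<lambda>i. L2_norm rad (\<lambda>k. ?T (real i) k - h k)) \<longlonglongrightarrow> 0"
  proof (rule L2_complete)
    \<comment> \<open>The nowhere vanishing weight for completeness is a Gaussian, that is,
      \<open>gauss_fun 0 1\<close>.\<close>
    show "(\<lambda>r. of_real (exp (- r\<^sup>2))) \<in> L2 rad"
      using gauss_fun_L2[of 1 0] by (simp add: gauss_fun_def[abs_def])
    show "?T (real i) \<in> L2 rad" for i :: nat
      by (rule hankel_cutoff_L2[OF g])
    fix e :: real assume "e > 0"
    have "\<forall>\<^sub>F i in sequentially. ?N (real i) < e / 2"
      by (rule eventually_compose_filterlim[OF small filterlim_real_sequentially]) (use \<open>e > 0\<close> in simp)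
    then obtain i0 where i0: "\<And>i. i \<ge> i0 \<Longrightarrow> ?N (real i) < e / 2"
      by (auto simp: eventually_sequentially)
    have "L2_norm rad (\<lambda>x. ?T (real i) x - ?T (real j) x) < e" if "i \<ge> i0" "j \<ge> i0" for i j
      using dist[of "real i" "real j"] i0[OF that(1)] i0[OF that(2)] by simp
    thus "\<exists>n0. \<forall>i\<ge>n0. \<forall>j\<ge>n0. L2_norm rad (\<lambda>x. ?T (real i) x - ?T (real j) x) < e"
      by blast
  qed auto
  then obtain h where h: "h \<in> L2 rad"
    and lim: "(\<lambda>i. L2_norm rad (\<lambda>k. ?T (real i) k - h k)) \<longlonglongrightarrow> 0" by blast
  \<comment> \<open>Completeness gave the limit along integer radii. One integer radius with a small
    error serves as a bridge to all large real radii.\<close>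
  have "((\<lambda>\<rho>. L2_norm rad (\<lambda>k. ?T \<rho> k - h k)) \<longlongrightarrow> 0) at_top"
  proof (rule tendstoI)
    fix e :: real assume e: "e > 0"
    have "\<forall>\<^sub>F i in sequentially. ?N (real i) < e / 3"
      by (rule eventually_compose_filterlim[OF small filterlim_real_sequentially]) (use e in simp)
    moreover have "\<forall>\<^sub>F i in sequentially. L2_norm rad (\<lambda>k. ?T (real i) k - h k) < e / 3"
      by (rule order_tendstoD(2)[OF lim]) (use e in simp)
    ultimately have "\<forall>\<^sub>F i in sequentially. ?N (real i) < e / 3 \<and> L2_norm rad (\<lambda>k. ?T (real i) k - h k) < e / 3"
      by (rule eventually_conj)
    then obtain i where i: "?N (real i) < e / 3" "L2_norm rad (\<lambda>k. ?T (real i) k - h k) < e / 3"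
      using eventually_happens'[OF trivial_limit_sequentially] by blast
    have "\<forall>\<^sub>F \<rho> in at_top. ?N \<rho> < e / 3"
      by (rule small) (use e in simp)
    thus "\<forall>\<^sub>F \<rho> in at_top. dist (L2_norm rad (\<lambda>k. ?T \<rho> k - h k)) 0 < e"
    proof eventually_elim
      case (elim \<rho>)
      have "L2_norm rad (\<lambda>k. ?T \<rho> k - h k) < e"
        using L2_norm_triangle_diff[OF hankel_cutoff_L2[OF g] hankel_cutoff_L2[OF g] h, of n \<rho> n "real i"]
          dist[of \<rho> "real i"] i elim by simp
      thus ?case by simp
    qed
  qed
  thus ?thesis
    using g h by (auto simp: has_hankel_transform_iff)
qed

section \<open>Parseval's identity and the inversion theorem\<close>

lemma L2_norm_add_power2:
  assumes "f \<in> L2 M" "g \<in> L2 M"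
  shows "(L2_norm M (\<lambda>x. f x + c * g x))\<^sup>2 =
    (L2_norm M f)\<^sup>2 + (cmod c)\<^sup>2 * (L2_norm M g)\<^sup>2 + 2 * Re (cnj c * L2_inner M f g)"
proof -
  have "(cmod (a + c * b))\<^sup>2 = (cmod a)\<^sup>2 + (cmod c)\<^sup>2 * (cmod b)\<^sup>2 + 2 * Re (cnj c * (a * cnj b))" for a b
    unfolding cmod_power2 by (simp add: power2_eq_square algebra_simps)
  hence "(L2_norm M (\<lambda>x. f x + c * g x))\<^sup>2 = (\<integral>x. (cmod (f x))\<^sup>2 + (cmod c)\<^sup>2 * (cmod (g x))\<^sup>2 +
      2 * Re (cnj c * (f x * cnj (g x))) \<partial>M)"
    unfolding L2_norm_power2 by (simp only:)
  also have "\<dots> = (L2_norm M f)\<^sup>2 + (cmod c)\<^sup>2 * (L2_norm M g)\<^sup>2 +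
      2 * (\<integral>x. Re (cnj c * (f x * cnj (g x))) \<partial>M)"
  proof -
    have [simp]: "integrable M (\<lambda>x. (cmod (f x))\<^sup>2)" "integrable M (\<lambda>x. (cmod (g x))\<^sup>2)"
      using assms by (auto intro: L2_integrable)
    define R where "R x = Re (cnj c * (f x * cnj (g x)))" for x
    have [simp]: "integrable M R"
      unfolding R_def by (intro integrable_Re integrable_mult_right L2_integrable_mult assms)
    show ?thesis
      unfolding R_def[symmetric] L2_norm_power2 by simp
  qed
  also have "(\<integral>x. Re (cnj c * (f x * cnj (g x))) \<partial>M) = Re (cnj c * L2_inner M f g)"
    unfolding L2_inner_def
    by (subst integral_Re) (auto intro!: integrable_mult_right L2_integrable_mult assms)
  finally show ?thesis .
qed

text \<open>Expanding the norms of \<open>F + c * G\<close> and \<open>f + c * g\<close> isolates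
  \<open>Re (cnj c * _)\<close> of the inner products; \<open>c = 1\<close> and
  \<open>c = \<i>\<close> recover the real and the imaginary part.\<close>

lemma L2_polarization:
  assumes "f \<in> L2 M" "g \<in> L2 M" "F \<in> L2 M'" "G \<in> L2 M'"
    and "\<And>c. L2_norm M' (\<lambda>x. F x + c * G x) = L2_norm M (\<lambda>x. f x + c * g x)"
    and "L2_norm M' F = L2_norm M f" "L2_norm M' G = L2_norm M g"
  shows "L2_inner M' F G = L2_inner M f g"
proof -
  have "Re (cnj c * L2_inner M' F G) = Re (cnj c * L2_inner M f g)" for c
    using L2_norm_add_power2[OF assms(1,2), of c] L2_norm_add_power2[OF assms(3,4), of c] assms(5-7)
    by simp
  from this[of 1] this[of \<i>] show ?thesis
    by (simp add: complex_eq_iff)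
qed

lemma hankel_inner:
  assumes f: "f \<in> L2 rad" "\<And>r. r > \<rho> \<Longrightarrow> f r = 0"
    and g: "g \<in> L2 rad" "\<And>r. r > \<rho> \<Longrightarrow> g r = 0"
  shows "L2_inner rad (hankel n f) (hankel n g) = L2_inner rad f g"
proof (rule L2_polarization)
  fix c
  have "(\<lambda>k. hankel n f k + c * hankel n g k) = hankel n (\<lambda>r. f r + c * g r)"
    unfolding hankel_def using bounded_support_integrable[OF f] bounded_support_integrable[OF g]
    by (simp add: distrib_right mult.assoc abs_integrable_times_bessel_nat)
  hence "L2_norm rad (\<lambda>k. hankel n f k + c * hankel n g k) =
      L2_norm rad (hankel n (\<lambda>r. f r + c * g r))" by simp
  also have "\<dots> = L2_norm rad (\<lambda>r. f r + c * g r)"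
    by (rule hankel_isometry(2)[where \<rho> = \<rho>]) (auto intro!: L2_add L2_cmult simp: f g)
  finally show "L2_norm rad (\<lambda>k. hankel n f k + c * hankel n g k) = L2_norm rad (\<lambda>r. f r + c * g r)" .
qed (use hankel_isometry[OF f] hankel_isometry[OF g] f g in auto)

text \<open>For cutoffs at a common radius this is polarization of the isometry; the inner product
  is continuous as the radius grows.\<close>

lemma hankel_Parseval:
  assumes "has_hankel_transform (real n) g h" "has_hankel_transform (real n) g' h'"
  shows "L2_inner rad h h' = L2_inner rad g g'"
proof -
  note gh = has_hankel_transform_L2[OF assms(1)] and gh' = has_hankel_transform_L2[OF assms(2)]
  have "((\<lambda>\<rho>. L2_inner rad (hankel n (cutoff \<rho> g)) (hankel n (cutoff \<rho> g'))) \<longlongrightarrow> L2_inner rad h h') at_top"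
    by (rule L2_inner_tendsto) (auto intro: hankel_cutoff_L2 gh gh')
  moreover have "((\<lambda>\<rho>. L2_inner rad (cutoff \<rho> g) (cutoff \<rho> g')) \<longlongrightarrow> L2_inner rad g g') at_top"
    by (rule L2_inner_tendsto) (auto intro: cutoff_L2 cutoff_tendsto gh gh')
  moreover have "L2_inner rad (hankel n (cutoff \<rho> g)) (hankel n (cutoff \<rho> g')) =
      L2_inner rad (cutoff \<rho> g) (cutoff \<rho> g')" for \<rho>
    by (rule hankel_inner[where \<rho> = \<rho>]) (auto intro: cutoff_L2 gh gh' simp: cutoff_eq_0)
  ultimately show ?thesis
    by (simp add: tendsto_unique[OF trivial_limit_at_top_linorder])
qed

text \<open>The kernel \<open>bessel_nat n (k * r)\<close> is real and symmetric in \<open>k\<close>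
  and \<open>r\<close>. Being bounded by 1, it leaves the product of two integrable functions as a
  majorant for Fubini.\<close>

lemma hankel_self_adjoint:
  assumes f: "integrable rad f" and g: "integrable rad g"
  shows "L2_inner rad (hankel n f) g = L2_inner rad f (hankel n g)"
proof -
  have [measurable]: "f \<in> borel_measurable borel" "g \<in> borel_measurable borel"
    using f g by (auto dest: borel_measurable_integrable)
  let ?F = "\<lambda>(k, r). f r * of_real (bessel_nat n (k * r)) * cnj (g k)"
  have int: "integrable (rad \<Otimes>\<^sub>M rad) ?F"
  proof (rule Bochner_Integration.integrable_bound)
    show "integrable (rad \<Otimes>\<^sub>M rad) (\<lambda>(k, r). cmod (f r) * cmod (g k))"
    proof (rule radial_pair.Fubini_integrable)
      show "integrable rad (\<lambda>k. \<integral>r. norm (case (k, r) of (k, r) \<Rightarrow> cmod (f r) * cmod (g k)) \<partial>rad)"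
        using f g by (simp add: norm_mult)
      show "AE k in rad. integrable rad (\<lambda>r. case (k, r) of (k, r) \<Rightarrow> cmod (f r) * cmod (g k))"
        using f by simp
    qed measurable
    have "norm (f r * of_real (bessel_nat n (k * r)) * cnj (g k)) \<le> cmod (f r) * cmod (g k)" for r k
      using abs_bessel_nat_le_1[of n "k * r"] by (auto simp: norm_mult mult_left_le intro!: mult_right_mono)
    thus "AE x in rad \<Otimes>\<^sub>M rad. norm (?F x) \<le> norm (case x of (k, r) \<Rightarrow> cmod (f r) * cmod (g k))"
      by (auto simp: norm_mult)
  qed measurable
  have "L2_inner rad (hankel n f) g = (\<integral>k. (\<integral>r. f r * of_real (bessel_nat n (k * r)) * cnj (g k) \<partial>rad) \<partial>rad)"
    by (simp add: L2_inner_def hankel_def)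
  also have "\<dots> = (\<integral>r. (\<integral>k. f r * of_real (bessel_nat n (k * r)) * cnj (g k) \<partial>rad) \<partial>rad)"
    using radial_pair.Fubini_integral[OF int] by simp
  also have "\<dots> = (\<integral>r. f r * cnj (hankel n g r) \<partial>rad)"
  proof (intro Bochner_Integration.integral_cong refl)
    fix r
    have "cnj (hankel n g r) = (\<integral>k. of_real (bessel_nat n (k * r)) * cnj (g k) \<partial>rad)"
      unfolding hankel_def by (subst Bochner_Integration.integral_cnj[symmetric]) (simp add: mult_ac)
    thus "(\<integral>k. f r * of_real (bessel_nat n (k * r)) * cnj (g k) \<partial>rad) = f r * cnj (hankel n g r)"
      by (simp add: mult.assoc)
  qed
  finally show ?thesis by (simp add: L2_inner_def)
qed

lemma has_hankel_transform_cong_AE: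
  assumes gh: "has_hankel_transform (real n) g h" and h': "h' \<in> L2 rad" "AE k in rad. h k = h' k"
  shows "has_hankel_transform (real n) g h'"
proof -
  note L = has_hankel_transform_L2[OF gh]
  have "L2_norm rad (\<lambda>k. hankel n (cutoff \<rho> g) k - h k) = L2_norm rad (\<lambda>k. hankel n (cutoff \<rho> g) k - h' k)" for \<rho>
    by (rule L2_norm_cong_AE) (use h' L in \<open>auto intro!: L2_measurable L2_diff hankel_cutoff_L2\<close>)
  thus ?thesis
    using L h' by (simp add: has_hankel_transform_iff)
qed

text \<open>Let \<open>g'\<close> be the transform of \<open>h\<close>. For a test function
  \<open>\<psi>\<close> of bounded support, self-adjointness moves the transform onto
  \<open>\<psi>\<close>, and Parseval moves it off both factors again, so \<open>g'\<close> and
  \<open>g\<close> have equal pairings with \<open>\<psi>\<close>. Taking for \<open>\<psi>\<close>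
  the cutoffs of \<open>g' - g\<close> forces this difference to vanish almost everywhere.\<close>

lemma hankel_inversion:
  assumes gh: "has_hankel_transform (real n) g h"
  shows "has_hankel_transform (real n) h g"
proof -
  note L = has_hankel_transform_L2[OF gh]
  obtain g' where hg': "has_hankel_transform (real n) h g'"
    using has_hankel_transform_exists[OF L(2)] by blast
  note L' = has_hankel_transform_L2[OF hg']
  define d where "d r = g' r - g r" for r
  have d: "d \<in> L2 rad"
    unfolding d_def[abs_def] by (intro L2_diff L L')
  have "L2_inner rad g' \<psi> = L2_inner rad g \<psi>"
    if \<psi>: "\<psi> \<in> L2 rad" "\<And>r. r > \<rho> \<Longrightarrow> \<psi> r = 0" for \<psi> \<rho>
  proof -
    have H\<psi>: "has_hankel_transform (real n) \<psi> (hankel n \<psi>)"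
      by (rule has_hankel_transform_bounded_support[OF \<psi>])
    have "((\<lambda>\<rho>. L2_inner rad (hankel n (cutoff \<rho> h)) \<psi>) \<longlongrightarrow> L2_inner rad g' \<psi>) at_top"
      by (rule L2_inner_tendsto) (use L L' \<psi> in \<open>auto intro: hankel_cutoff_L2 simp: L2_norm_0\<close>)
    moreover have "((\<lambda>\<rho>. L2_inner rad (cutoff \<rho> h) (hankel n \<psi>)) \<longlongrightarrow> L2_inner rad h (hankel n \<psi>)) at_top"
      by (rule L2_inner_tendsto)
        (use L hankel_isometry(1)[OF \<psi>] in \<open>auto intro: cutoff_L2 cutoff_tendsto simp: L2_norm_0\<close>)
    moreover have "L2_inner rad (hankel n (cutoff \<rho> h)) \<psi> = L2_inner rad (cutoff \<rho> h) (hankel n \<psi>)" for \<rho>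
      by (intro hankel_self_adjoint cutoff_integrable L bounded_support_integrable[OF \<psi>])
    ultimately have "L2_inner rad g' \<psi> = L2_inner rad h (hankel n \<psi>)"
      by (simp add: tendsto_unique[OF trivial_limit_at_top_linorder])
    also have "\<dots> = L2_inner rad g \<psi>"
      by (rule hankel_Parseval[OF gh H\<psi>])
    finally show ?thesis .
  qed
  from this[OF cutoff_L2[OF d] cutoff_eq_0]
  have "L2_inner rad (\<lambda>r. g' r - g r) (cutoff \<rho> d) = 0" for \<rho>
    by (subst L2_inner_diff_left) (auto intro: L L' cutoff_L2[OF d])
  hence "L2_inner rad d (cutoff \<rho> d) = 0" for \<rho>
    by (simp add: d_def[abs_def, symmetric])
  moreover have "((\<lambda>\<rho>. L2_inner rad d (cutoff \<rho> d)) \<longlongrightarrow> L2_inner rad d d) at_top"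
    by (rule L2_inner_tendsto) (use d in \<open>auto intro: cutoff_L2 cutoff_tendsto simp: L2_norm_0\<close>)
  ultimately have "L2_inner rad d d = 0"
    by (simp add: tendsto_const_iff)
  hence "L2_norm rad d = 0"
    by (simp add: L2_inner_self)
  from L2_norm_eq_0[OF d this] have "AE r in rad. g' r = g r"
    by eventually_elim (simp add: d_def)
  thus ?thesis
    by (rule has_hankel_transform_cong_AE[OF hg' L(1)])
qed

section \<open>Polar coordinates in the plane\<close>

abbreviation circ :: "(real ^ 2) measure" where "circ \<equiv> surface_measure"

lemma space_surface_measure [simp]: "space surface_measure = sphere 0 1"
  by (simp add: surface_measure_def space_restrict_space)

lemma sets_surface_measure [measurable_cong]:
  "sets surface_measure = sets (restrict_space borel (sphere 0 1))"
  by (simp add: surface_measure_def)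

lemma measurable_sgn_sphere:
  "sgn \<in> density (restrict_space lborel (ball 0 1 - {0 :: 'a :: euclidean_space})) c
     \<rightarrow>\<^sub>M restrict_space borel (sphere 0 (1::real))"
  by (intro measurable_restrict_space2)
     (auto simp: space_restrict_space norm_sgn intro!: measurable_restrict_space1)

lemma emeasure_surface_measure:
  fixes B :: "'a :: euclidean_space set"
  assumes "B \<in> sets borel" "B \<subseteq> sphere 0 1"
  shows "emeasure surface_measure B = of_nat DIM('a) * emeasure lborel {x. x \<noteq> 0 \<and> norm x < 1 \<and> sgn x \<in> B}"
proof -
  let ?A = "ball 0 1 - {0} :: 'a set"
  let ?C = "{x. x \<noteq> 0 \<and> norm x < 1 \<and> sgn x \<in> B}"
  have [measurable]: "B \<in> sets borel" by fact
  have C: "?C \<in> sets borel" by measurable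
  have "emeasure surface_measure B =
      emeasure (density (restrict_space lborel ?A) (\<lambda>_. of_nat DIM('a))) ?C"
    unfolding surface_measure_def using assms
    by (subst emeasure_distr[OF measurable_sgn_sphere])
      (auto simp: sets_restrict_space space_restrict_space intro!: arg_cong2[where f = emeasure])
  also have "\<dots> = of_nat DIM('a) * emeasure (restrict_space lborel ?A) ?C"
    using C by (subst emeasure_density_const) (auto simp: sets_restrict_space intro!: image_eqI[of _ _ ?C])
  also have "\<dots> = of_nat DIM('a) * emeasure lborel ?C"
    by (subst emeasure_restrict_space) auto
  finally show ?thesis .
qed

lemma finite_measure_circ: "finite_measure circ"
  by standard (simp add: emeasure_surface_measure_sphere)

interpretation circ: finite_measure circ
  by (rule finite_measure_circ)

lemma measure_circ: "measure circ (sphere 0 1) = 2 * pi"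
  using emeasure_surface_measure_sphere[where ?'a = "real ^ 2"]
  by (simp add: measure_def unit_ball_vol_2)

lemma emeasure_radial_measure_lessThan:
  assumes "a > 0"
  shows "emeasure rad {..<a} = ennreal (a\<^sup>2 / 2)"
proof -
  have "emeasure rad {..<a} = (\<integral>\<^sup>+r. ennreal r * indicator {0..a} r \<partial>lborel)"
  proof -
    have "emeasure rad {..<a} =
        (\<integral>\<^sup>+r. ennreal (r * indicator {0<..} r) * indicator {..<a} r \<partial>lborel)"
      unfolding radial_measure_def by (rule emeasure_density) auto
    also have "\<dots> = (\<integral>\<^sup>+r. ennreal r * indicator {0..a} r \<partial>lborel)"
    proof (rule nn_integral_cong_AE)
      show "AE r in lborel. ennreal (r * indicator {0<..} r) * indicator {..<a} r = ennreal r * indicator {0..a} r"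
        using AE_lborel_singleton[of a] by eventually_elim (auto split: split_indicator)
    qed
    finally show ?thesis .
  qed
  also have "\<dots> = ennreal (a\<^sup>2 / 2 - 0\<^sup>2 / 2)"
    by (rule nn_integral_FTC_Icc[where F = "\<lambda>r. r\<^sup>2 / 2"])
      (use assms in \<open>auto intro!: derivative_eq_intros\<close>)
  finally show ?thesis by simp
qed

lemma emeasure_radial_measure_lessThan_nonpos:
  "a \<le> 0 \<Longrightarrow> emeasure rad {..<a} = 0"
  by (subst AE_iff_measurable[symmetric, of _ _ "\<lambda>x. \<not> x < a"]) (auto simp: AE_radial_measure)

text \<open>The larger cone is the image of the unit one under scaling by \<open>a\<close>, which
  multiplies areas in the plane by \<open>a\<^sup>2\<close>.\<close>

lemma emeasure_cone:
  fixes B :: "(real ^ 2) set"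
  assumes [measurable]: "B \<in> sets borel" and a: "a > 0"
  shows "emeasure lborel {x. x \<noteq> 0 \<and> norm x < a \<and> sgn x \<in> B} =
    ennreal (a\<^sup>2) * emeasure lborel {x. x \<noteq> 0 \<and> norm x < 1 \<and> sgn x \<in> B}"
proof -
  let ?C = "\<lambda>a. {x. x \<noteq> 0 \<and> norm x < a \<and> sgn x \<in> B}"
  have C: "?C b \<in> sets borel" for b by measurable
  have "?C a = (\<lambda>x. a *\<^sub>R x + 0) ` ?C 1"
  proof (intro equalityI subsetI)
    fix x assume x: "x \<in> ?C a"
    show "x \<in> (\<lambda>x. a *\<^sub>R x + 0) ` ?C 1"
      by (rule image_eqI[of _ _ "x /\<^sub>R a"]) (use x a in \<open>auto simp: sgn_scaleR divide_simps\<close>)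
  qed (use a in \<open>auto simp: sgn_scaleR\<close>)
  hence "emeasure lebesgue (?C a) = ennreal (a\<^sup>2) * emeasure lebesgue (?C 1)"
    using emeasure_lebesgue_affine[of a 0 "?C 1"] by simp
  thus ?thesis
    using C by simp
qed

text \<open>A product of sigma-finite measures is determined by its values on rectangles. For a
  fixed set \<open>B\<close> of directions both sides are measures of the set of radii, and these
  are compared on the half-lines \<open>{..<a}\<close>. The origin is removed because
  \<open>sgn 0 = 0\<close> does not lie on the circle.\<close>

lemma polar_pair:
  "rad \<Otimes>\<^sub>M circ =
     distr (restrict_space lborel (- {0})) (borel \<Otimes>\<^sub>M restrict_space borel (sphere 0 1)) (\<lambda>x. (norm x, sgn x))"
  (is "_ = ?D")
proof (rule pair_measure_eqI)
  have meas: "(\<lambda>x. (norm x, sgn x)) \<in> restrict_space lborel (- {0 :: real ^ 2}) \<rightarrow>\<^sub>M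
      borel \<Otimes>\<^sub>M restrict_space borel (sphere 0 1)"
    by (intro measurable_Pair measurable_restrict_space2)
      (auto simp: space_restrict_space norm_sgn intro!: measurable_restrict_space1)
  fix A B assume A: "A \<in> sets rad" and B: "B \<in> sets circ"
  from B have B': "B \<in> sets borel" "B \<subseteq> sphere 0 1"
    by (auto simp: sets_surface_measure sets_restrict_space)
  note [measurable] = B'(1)
  define X where "X = {x :: real ^ 2. x \<noteq> 0 \<and> sgn x \<in> B}"
  have X [measurable]: "X \<in> sets borel" unfolding X_def by measurable
  \<comment> \<open>The distribution of the radius under Lebesgue measure restricted to the cone
    with directions in \<open>B\<close>.\<close>
  define \<nu> where "\<nu> = distr (restrict_space lborel X) borel norm"
  have meas_norm: "norm \<in> restrict_space lborel X \<rightarrow>\<^sub>M borel"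
    by (intro measurable_restrict_space1) auto
  have \<nu>: "emeasure \<nu> E = emeasure lborel {x \<in> X. norm x \<in> E}" if [measurable]: "E \<in> sets borel" for E
    unfolding \<nu>_def using X
    by (subst emeasure_distr[OF meas_norm that], subst emeasure_restrict_space)
      (auto simp: space_restrict_space intro!: arg_cong2[where f = emeasure])
  have "density rad (\<lambda>_. emeasure circ B) = \<nu>"
  proof (rule measure_eqI_generator_eq)
    let ?E = "range lessThan :: real set set"
    show "Int_stable ?E"
      unfolding Int_stable_def
    proof safe
      fix a b :: real
      show "{..<a} \<inter> {..<b} \<in> ?E" by (rule image_eqI[of _ _ "min a b"]) auto
    qed
    show "sets (density rad (\<lambda>_. emeasure circ B)) = sigma_sets UNIV ?E"
      by (simp add: borel_Iio)
    show "sets \<nu> = sigma_sets UNIV ?E"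
      by (simp add: \<nu>_def borel_Iio)
    show eq: "emeasure (density rad (\<lambda>_. emeasure circ B)) E = emeasure \<nu> E" if "E \<in> ?E" for E
    proof -
      from that obtain a where E: "E = {..<a}" by auto
      show ?thesis
      proof (cases "a > 0")
        case True
        have "emeasure (density rad (\<lambda>_. emeasure circ B)) E = emeasure circ B * ennreal (a\<^sup>2 / 2)"
          using True by (simp add: emeasure_density_const E emeasure_radial_measure_lessThan)
        also have "\<dots> = ennreal (a\<^sup>2) * emeasure lborel {x. x \<noteq> 0 \<and> norm x < 1 \<and> sgn x \<in> B}"
        proof -
          \<comment> \<open>The dimension 2 in the normalisation of the surface measure cancels the
            \<open>1 / 2\<close> from integrating \<open>r\<close>.\<close>
          have "ennreal 2 * ennreal (a\<^sup>2 / 2) = ennreal (a\<^sup>2)"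
            by (subst ennreal_mult[symmetric]) auto
          thus ?thesis
            by (simp add: emeasure_surface_measure[OF B'] mult_ac) (simp add: mult.assoc[symmetric] mult.commute)
        qed
        also have "\<dots> = emeasure lborel {x. x \<noteq> 0 \<and> norm x < a \<and> sgn x \<in> B}"
          by (rule emeasure_cone[symmetric]) (use B' True in auto)
        also have "\<dots> = emeasure \<nu> E"
          by (subst \<nu>) (auto simp: E X_def intro!: arg_cong2[where f = emeasure])
        finally show ?thesis .
      next
        case False
        have "emeasure rad {..<a} = 0"
          using False by (simp add: emeasure_radial_measure_lessThan_nonpos)
        moreover have "emeasure \<nu> E = 0"
        proof -
          have empty: "{x \<in> X. norm x \<in> E} = {}"
            using False by (auto simp: E dest: le_less_trans[OF norm_ge_zero])
          have "E \<in> sets borel" by (simp add: E)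
          from \<nu>[OF this] show ?thesis by (simp only: empty emeasure_empty)
        qed
        ultimately show ?thesis
          by (simp add: emeasure_density_const E)
      qed
    qed
    show "range (\<lambda>i::nat. {..<real i}) \<subseteq> ?E" by auto
    show "(\<Union>i::nat. {..<real i}) = UNIV"
      using reals_Archimedean2 by auto
    show "emeasure (density rad (\<lambda>_. emeasure circ B)) {..<real i} \<noteq> \<infinity>" for i :: nat
    proof -
      have "emeasure rad {..<real i} \<noteq> \<infinity>"
        by (cases "i > 0") (auto simp: emeasure_radial_measure_lessThan emeasure_radial_measure_lessThan_nonpos)
      thus ?thesis
        using circ.emeasure_finite[of B] by (auto simp: emeasure_density_const ennreal_mult_eq_top_iff)
    qed
  qed auto
  hence "emeasure \<nu> A = emeasure rad A * emeasure circ B"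
    using A by (simp add: emeasure_density_const mult.commute flip: \<open>density _ _ = _\<close>)
  moreover have "emeasure ?D (A \<times> B) = emeasure \<nu> A"
  proof -
    have "A \<times> B \<in> sets (borel \<Otimes>\<^sub>M restrict_space borel (sphere 0 1))"
      using A B by (intro pair_measureI) (auto simp: sets_surface_measure)
    hence "emeasure ?D (A \<times> B) = emeasure (restrict_space lborel (- {0})) {x \<in> X. norm x \<in> A}"
      by (subst emeasure_distr[OF meas]) (auto simp: space_restrict_space X_def intro!: arg_cong2[where f = emeasure])
    also have "\<dots> = emeasure lborel {x \<in> X. norm x \<in> A}"
      by (rule emeasure_restrict_space) (auto simp: X_def)
    also have "\<dots> = emeasure \<nu> A"
      by (rule \<nu>[symmetric]) (use A in simp)
    finally show ?thesis .
  qed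
  ultimately show "emeasure rad A * emeasure circ B = emeasure ?D (A \<times> B)" by simp
next
  show "sets (rad \<Otimes>\<^sub>M circ) = sets ?D"
    by (simp, intro sets_pair_measure_cong sets_surface_measure) simp
qed unfold_locales

lemma measurable_sphere_borel: "f \<in> borel_measurable borel \<Longrightarrow> f \<in> borel_measurable circ"
  by (subst measurable_cong_sets[OF sets_surface_measure refl]) (rule measurable_restrict_space1)

lemma measurable_polar [measurable]: "(\<lambda>(r, \<xi>). r *\<^sub>R \<xi>) \<in> borel_measurable (rad \<Otimes>\<^sub>M circ)"
proof -
  have [measurable]: "(\<lambda>\<xi>. \<xi>) \<in> borel_measurable circ"
    by (rule measurable_sphere_borel) simp
  show ?thesis by measurable
qed

lemma distr_polar: "distr (rad \<Otimes>\<^sub>M circ) borel (\<lambda>(r, \<xi>). r *\<^sub>R \<xi>) = lborel"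
proof -
  let ?L = "restrict_space lborel (- {0 :: real ^ 2})"
  have meas: "(\<lambda>x. (norm x, sgn x)) \<in> ?L \<rightarrow>\<^sub>M borel \<Otimes>\<^sub>M restrict_space borel (sphere 0 1)"
    by (intro measurable_Pair measurable_restrict_space2)
      (auto simp: space_restrict_space norm_sgn intro!: measurable_restrict_space1)
  have sets: "sets (borel \<Otimes>\<^sub>M restrict_space borel (sphere 0 1)) = sets (rad \<Otimes>\<^sub>M circ)"
    by (intro sets_pair_measure_cong sets_surface_measure[symmetric]) simp
  have "(\<lambda>(r, \<xi>). r *\<^sub>R \<xi>) \<in> borel_measurable (borel \<Otimes>\<^sub>M restrict_space borel (sphere 0 (1::real) :: (real ^ 2) set))"
    using measurable_polar by (subst measurable_cong_sets[OF sets refl])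
  hence "distr (rad \<Otimes>\<^sub>M circ) borel (\<lambda>(r, \<xi>). r *\<^sub>R \<xi>) =
      distr ?L borel ((\<lambda>(r, \<xi>). r *\<^sub>R \<xi>) \<circ> (\<lambda>x. (norm x, sgn x)))"
    unfolding polar_pair by (rule distr_distr[OF _ meas])
  also have "(\<lambda>(r, \<xi>). r *\<^sub>R \<xi>) \<circ> (\<lambda>x. (norm x, sgn x)) = (\<lambda>x :: real ^ 2. x)"
  proof
    fix x :: "real ^ 2"
    show "((\<lambda>(r, \<xi>). r *\<^sub>R \<xi>) \<circ> (\<lambda>x. (norm x, sgn x))) x = x"
      by (cases "x = 0") (auto simp: sgn_div_norm)
  qed
  also have "distr ?L borel (\<lambda>x. x) = lborel"
  proof (rule measure_eqI)
    fix A assume "A \<in> sets (distr ?L borel (\<lambda>x. x))"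
    hence A: "A \<in> sets borel" by simp
    have "emeasure (distr ?L borel (\<lambda>x. x)) A = emeasure lborel (A - {0})"
      using A by (subst emeasure_distr, simp add: measurable_restrict_space1, simp, subst emeasure_restrict_space)
        (auto simp: space_restrict_space intro!: arg_cong2[where f = emeasure])
    also have "\<dots> = emeasure lborel A"
      using A by (intro emeasure_Diff_null_set) auto
    finally show "emeasure (distr ?L borel (\<lambda>x. x)) A = emeasure lborel A" .
  qed simp
  finally show ?thesis .
qed

interpretation polar: pair_sigma_finite rad circ ..

lemma integrable_polar:
  fixes f :: "real ^ 2 \<Rightarrow> 'b :: {banach, second_countable_topology}"
  assumes "integrable lborel f"
  shows "integrable (rad \<Otimes>\<^sub>M circ) (\<lambda>(r, \<xi>). f (r *\<^sub>R \<xi>))"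
proof -
  have f: "f \<in> borel_measurable borel"
    using borel_measurable_integrable[OF assms] by simp
  show ?thesis
    using assms integrable_distr_eq[OF measurable_polar f] unfolding distr_polar
    by (simp add: case_prod_unfold)
qed

lemma integral_polar:
  fixes f :: "real ^ 2 \<Rightarrow> 'b :: {banach, second_countable_topology}"
  assumes "integrable lborel f"
  shows "integral\<^sup>L lborel f = (\<integral>r. (\<integral>\<xi>. f (r *\<^sub>R \<xi>) \<partial>circ) \<partial>rad)"
proof -
  have f: "f \<in> borel_measurable borel"
    using borel_measurable_integrable[OF assms] by simp
  have "integral\<^sup>L lborel f = (\<integral>p. f (case p of (r, \<xi>) \<Rightarrow> r *\<^sub>R \<xi>) \<partial>(rad \<Otimes>\<^sub>M circ))"
    unfolding distr_polar[symmetric]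
    by (rule integral_distr[OF measurable_polar f])
  also have "\<dots> = (\<integral>r. (\<integral>\<xi>. f (r *\<^sub>R \<xi>) \<partial>circ) \<partial>rad)"
    using polar.integral_fst'[OF integrable_polar[OF assms]] by (simp add: case_prod_unfold)
  finally show ?thesis .
qed

lemma nn_integral_polar:
  fixes f :: "real ^ 2 \<Rightarrow> ennreal"
  assumes [measurable]: "f \<in> borel_measurable borel"
  shows "integral\<^sup>N lborel f = (\<integral>\<^sup>+r. (\<integral>\<^sup>+\<xi>. f (r *\<^sub>R \<xi>) \<partial>circ) \<partial>rad)"
proof -
  have "integral\<^sup>N lborel f = (\<integral>\<^sup>+p. f (case p of (r, \<xi>) \<Rightarrow> r *\<^sub>R \<xi>) \<partial>(rad \<Otimes>\<^sub>M circ))"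
    unfolding distr_polar[symmetric] by (rule nn_integral_distr) auto
  also have "\<dots> = (\<integral>\<^sup>+r. (\<integral>\<^sup>+\<xi>. f (r *\<^sub>R \<xi>) \<partial>circ) \<partial>rad)"
  proof -
    have "(\<lambda>p. f (case p of (r, \<xi>) \<Rightarrow> r *\<^sub>R \<xi>)) \<in> borel_measurable (rad \<Otimes>\<^sub>M circ)"
      by measurable
    from circ.nn_integral_fst[OF this] show ?thesis by simp
  qed
  finally show ?thesis .
qed

subsection \<open>Rotations\<close>

definition cpx :: "real ^ 2 \<Rightarrow> complex" where
  "cpx x = Complex (x $ 1) (x $ 2)"

lemma norm_cpx: "cmod (cpx x) = norm x"
  by (simp add: cpx_def cmod_def norm_vec_def L2_set_def sum_2)

lemma cpx_scaleR: "cpx (r *\<^sub>R x) = of_real r * cpx x"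
  by (simp add: cpx_def complex_eq_iff)

lemma cpx_inject: "cpx x = cpx y \<longleftrightarrow> x = y"
  by (auto simp: cpx_def complex_eq_iff vec_eq_iff forall_2)

lemma bounded_linear_cpx: "bounded_linear cpx"
proof (rule bounded_linear_intro[where K = 1])
  show "cpx (x + y) = cpx x + cpx y" for x y
    by (simp add: cpx_def complex_eq_iff)
  show "cpx (r *\<^sub>R x) = r *\<^sub>R cpx x" for r x
    by (simp add: cpx_def complex_eq_iff)
qed (simp add: norm_cpx)

lemma continuous_on_cpx [continuous_intros]: "continuous_on S f \<Longrightarrow> continuous_on S (\<lambda>x. cpx (f x))"
  by (rule bounded_linear.continuous_on[OF bounded_linear_cpx])

lemma measurable_cpx [measurable]: "cpx \<in> borel_measurable borel"
  by (intro borel_measurable_continuous_onI continuous_intros)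

definition rot :: "real \<Rightarrow> real ^ 2 \<Rightarrow> real ^ 2" where
  "rot a x = vector [cos a * x $ 1 - sin a * x $ 2, sin a * x $ 1 + cos a * x $ 2]"

lemma cpx_rot: "cpx (rot a x) = cis a * cpx x"
  by (simp add: cpx_def rot_def complex_eq_iff)

lemma norm_rot [simp]: "norm (rot a x) = norm x"
  by (simp add: norm_cpx[symmetric] cpx_rot norm_mult)

lemma rot_rot: "rot a (rot b x) = rot (a + b) x"
  by (simp add: cpx_inject[symmetric] cpx_rot mult.assoc[symmetric] cis_mult)

lemma rot_0 [simp]: "rot 0 x = x"
  by (simp add: cpx_inject[symmetric] cpx_rot)

lemma linear_rot: "linear (rot a)"
  by (rule linearI) (auto simp: rot_def vec_eq_iff forall_2 algebra_simps)

lemma measurable_rot [measurable]: "rot a \<in> borel_measurable borel"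
  by (intro borel_measurable_continuous_onI linear_continuous_on linear_conv_bounded_linear[THEN iffD1] linear_rot)

lemma det_matrix_rot: "det (matrix (rot a)) = 1"
  by (simp add: det_2 matrix_def rot_def axis_def)

lemma vimage_rot: "rot a -` A = rot (- a) ` A"
proof (intro equalityI subsetI)
  fix x assume "x \<in> rot a -` A"
  thus "x \<in> rot (- a) ` A"
    by (intro image_eqI[of _ _ "rot a x"]) (auto simp: rot_rot)
qed (auto simp: rot_rot)

text \<open>Lebesgue measure is recognised on boxes, whose rotated images keep their measure because
  the matrix has determinant 1.\<close>

lemma distr_rot: "distr lborel borel (rot a) = lborel"
proof (rule lborel_eqI[symmetric])
  fix l u :: "real ^ 2"
  assume lu: "\<And>b. b \<in> Basis \<Longrightarrow> l \<bullet> b \<le> u \<bullet> b"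
  have lm: "rot (- a) ` box l u \<in> lmeasurable"
    by (rule measurable_linear_image[OF linear_rot lmeasurable_box])
  have borel: "rot (- a) ` box l u \<in> sets borel"
    unfolding vimage_rot[symmetric] using measurable_sets[OF measurable_rot, of "box l u" a] by simp
  have "emeasure (distr lborel borel (rot a)) (box l u) = emeasure lborel (rot (- a) ` box l u)"
    by (subst emeasure_distr) (auto simp: vimage_rot)
  also have "\<dots> = emeasure lebesgue (rot (- a) ` box l u)"
    using borel by simp
  also have "\<dots> = ennreal (measure lebesgue (rot (- a) ` box l u))"
    using lm by (rule emeasure_eq_measure2)
  also have "measure lebesgue (rot (- a) ` box l u) = measure lebesgue (box l u)"
    using measure_linear_image[OF linear_rot lmeasurable_box, of "- a" l u] by (simp add: det_matrix_rot)
  also have "\<dots> = (\<Prod>b\<in>Basis. (u - l) \<bullet> b)"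
    using lu by (simp add: measure_lborel_box_eq)
  finally show "emeasure (distr lborel borel (rot a)) (box l u) = (\<Prod>b\<in>Basis. (u - l) \<bullet> b)" .
qed simp

lemma integral_circ:
  fixes f :: "real ^ 2 \<Rightarrow> complex"
  assumes [measurable]: "f \<in> borel_measurable borel"
  shows "integral\<^sup>L circ f = (\<integral>x. indicator (ball 0 1 - {0}) x *\<^sub>R (2 *\<^sub>R f (sgn x)) \<partial>lborel)"
proof -
  let ?A = "ball 0 1 - {0} :: (real ^ 2) set"
  have "integral\<^sup>L circ f = (\<integral>x. f (sgn x) \<partial>density (restrict_space lborel ?A) (\<lambda>_. ennreal 2))"
    unfolding surface_measure_def
    by (subst integral_distr[OF measurable_sgn_sphere]) (auto intro!: measurable_restrict_space1)
  also have "\<dots> = (\<integral>x. 2 *\<^sub>R f (sgn x) \<partial>restrict_space lborel ?A)"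
    by (rule integral_density) (auto intro!: measurable_restrict_space1)
  also have "\<dots> = (\<integral>x. indicator ?A x *\<^sub>R (2 *\<^sub>R f (sgn x)) \<partial>lborel)"
    by (subst integral_restrict_space) auto
  finally show ?thesis .
qed

text \<open>The surface measure is the image of Lebesgue measure on the punctured disc under
  \<open>sgn\<close>, and \<open>sgn\<close> commutes with rotations; so it inherits the invariance
  of Lebesgue measure.\<close>

lemma integral_circ_rot:
  fixes f :: "real ^ 2 \<Rightarrow> complex"
  assumes [measurable]: "f \<in> borel_measurable borel"
  shows "(\<integral>\<xi>. f (rot a \<xi>) \<partial>circ) = integral\<^sup>L circ f"
proof -
  have sgn: "sgn (rot a x) = rot a (sgn x)" for x
    using linear_rot by (simp add: sgn_div_norm linear_scale)
  have ind: "indicator (ball 0 1 - {0}) (rot a x) = (indicator (ball 0 1 - {0}) x :: real)" for x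
    using norm_rot[of a x] norm_eq_zero[of "rot a x"] by (simp add: indicator_def)
  have "integral\<^sup>L circ f = (\<integral>x. indicator (ball 0 1 - {0}) x *\<^sub>R (2 *\<^sub>R f (sgn x)) \<partial>distr lborel borel (rot a))"
    unfolding distr_rot by (rule integral_circ) fact
  also have "\<dots> = (\<integral>x. indicator (ball 0 1 - {0}) x *\<^sub>R (2 *\<^sub>R f (rot a (sgn x))) \<partial>lborel)"
  proof -
    have [measurable]: "ball 0 1 - {0} \<in> sets (borel :: (real ^ 2) measure)" by simp
    have "(\<lambda>x. indicator (ball 0 1 - {0}) x *\<^sub>R (2 *\<^sub>R f (sgn x))) \<in> borel_measurable borel"
      by (intro borel_measurable_scaleR borel_measurable_indicator borel_measurable_const) measurable
    from integral_distr[OF _ this, of "rot a" lborel] show ?thesis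
      by (simp only: ind sgn) simp
  qed
  also have "\<dots> = (\<integral>\<xi>. f (rot a \<xi>) \<partial>circ)"
    by (rule integral_circ[symmetric]) measurable
  finally show ?thesis ..
qed

text \<open>With the plane identified with the complex numbers this is \<open>z ^ k\<close> or a
  power of the conjugate of \<open>z\<close>: a harmonic homogeneous polynomial of degree
  \<open>\<bar>k\<bar>\<close> that equals \<open>exp (\<i> k \<theta>)\<close> on the unit
  circle.\<close>

definition sph :: "int \<Rightarrow> real ^ 2 \<Rightarrow> complex" where
  "sph k x = (if k \<ge> 0 then cpx x ^ nat k else cnj (cpx x) ^ nat (- k))"

lemma continuous_on_sph [continuous_intros]: "continuous_on S f \<Longrightarrow> continuous_on S (\<lambda>x. sph k (f x))"
  unfolding sph_def by (cases "k \<ge> 0") (auto intro!: continuous_intros)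

lemma measurable_sph [measurable]: "sph k \<in> borel_measurable borel"
  by (intro borel_measurable_continuous_onI continuous_intros)

lemma norm_sph: "cmod (sph k x) = norm x ^ nat \<bar>k\<bar>"
  by (simp add: sph_def norm_power norm_cpx)

lemma cnj_sph: "cnj (sph k x) = sph (- k) x"
  by (auto simp: sph_def)

lemma sph_scaleR: "sph k (r *\<^sub>R x) = of_real (r ^ nat \<bar>k\<bar>) * sph k x"
  by (simp add: sph_def cpx_scaleR power_mult_distrib)

lemma sph_rot: "sph k (rot a x) = cis (of_int k * a) * sph k x"
  by (auto simp: sph_def cpx_rot power_mult_distrib Complex.DeMoivre cis_cnj)

lemma sph_powi: "norm x = 1 \<Longrightarrow> sph k x = cpx x powi k"
proof -
  assume "norm x = 1"
  hence "cpx x * cnj (cpx x) = 1"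
    by (simp add: complex_norm_square[symmetric] norm_cpx)
  hence "cnj (cpx x) = inverse (cpx x)"
    by (metis inverse_unique)
  thus ?thesis
    by (simp add: sph_def power_int_def)
qed

lemma sph_mult_cnj:
  assumes "norm x = 1"
  shows "sph j x * cnj (sph k x) = sph (j - k) x"
proof -
  have "cpx x \<noteq> 0" using assms norm_cpx[of x] by auto
  thus ?thesis
    unfolding cnj_sph using assms by (simp add: sph_powi power_int_add[symmetric])
qed

text \<open>For \<open>k \<noteq> 0\<close> the rotation by \<open>\<pi> / k\<close> multiplies the
  integrand by -1 and preserves the measure, so the integral is its own negative.\<close>

lemma integral_sph: "(\<integral>\<xi>. sph k \<xi> \<partial>circ) = (if k = 0 then 2 * pi else 0)"
proof (cases "k = 0")
  case True
  thus ?thesis by (simp add: sph_def measure_circ scaleR_conv_of_real)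
next
  case False
  have "(\<integral>\<xi>. sph k \<xi> \<partial>circ) = (\<integral>\<xi>. sph k (rot (pi / of_int k) \<xi>) \<partial>circ)"
    by (rule integral_circ_rot[symmetric]) measurable
  also have "\<dots> = - (\<integral>\<xi>. sph k \<xi> \<partial>circ)"
    using False by (simp add: sph_rot)
  finally have neg: "(\<integral>\<xi>. sph k \<xi> \<partial>circ) = - (\<integral>\<xi>. sph k \<xi> \<partial>circ)" .
  have "(\<integral>\<xi>. sph k \<xi> \<partial>circ) = 0"
    using arg_cong[OF neg, of Re] arg_cong[OF neg, of Im] by (intro complex_eqI) simp_all
  thus ?thesis using False by simp
qed

lemma sph_inner: "L2_inner circ (sph j) (sph k) = (if j = k then 2 * pi else 0)"
proof -
  have "L2_inner circ (sph j) (sph k) = (\<integral>\<xi>. sph (j - k) \<xi> \<partial>circ)"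
    unfolding L2_inner_def
    by (intro Bochner_Integration.integral_cong) (auto simp: sph_mult_cnj)
  thus ?thesis by (simp add: integral_sph)
qed

subsection \<open>Circular harmonics\<close>

lemma vec2_eq: "x = x $ 1 *\<^sub>R axis 1 1 + x $ 2 *\<^sub>R axis 2 (1::real)" for x :: "real ^ 2"
  by (simp add: vec_eq_iff forall_2 axis_def)

lemma Basis_vec2: "Basis = {axis 1 1, axis 2 (1::real) :: real ^ 2}"
  by (auto simp: Basis_vec_def UNIV_2)

lemma axis_neq: "axis 1 1 \<noteq> (axis 2 1 :: real ^ 2)"
  by (simp add: axis_eq_axis)

text \<open>The partial derivatives are delivered as polynomials, so that they can be differentiated
  once more for the Laplacian.\<close>

lemma real_polynomial_partials:
  fixes p :: "real ^ 2 \<Rightarrow> real"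
  assumes "real_polynomial_function p"
  shows "\<exists>p1 p2. real_polynomial_function p1 \<and> real_polynomial_function p2 \<and>
    (\<forall>x. (p has_derivative (\<lambda>h. h $ 1 * p1 x + h $ 2 * p2 x)) (at x))"
  using assms
proof induction
  case (linear f)
  have lin: "linear f" by (rule bounded_linear.linear[OF linear])
  have "f h = h $ 1 * f (axis 1 1) + h $ 2 * f (axis 2 1)" for h
    by (rule trans[OF arg_cong[OF vec2_eq[of h], of f]]) (simp add: linear_add[OF lin] linear_scale[OF lin])
  hence f: "f = (\<lambda>h. h $ 1 * f (axis 1 1) + h $ 2 * f (axis 2 1))" ..
  have "\<forall>x. (f has_derivative (\<lambda>h. h $ 1 * f (axis 1 1) + h $ 2 * f (axis 2 1))) (at x)"
    by (intro allI has_derivative_eq_rhs[OF bounded_linear_imp_has_derivative[OF linear] f])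
  thus ?case
    by (intro exI[of _ "\<lambda>_. f (axis 1 1)"] exI[of _ "\<lambda>_. f (axis 2 1)"] conjI
      real_polynomial_function.intros(2))
next
  case (const c)
  show ?case
    using real_polynomial_function.intros(2)[of 0]
    by (intro exI[of _ "\<lambda>_. 0"]) (auto intro!: derivative_eq_intros)
next
  case (add f g)
  then obtain f1 f2 g1 g2 where *: "real_polynomial_function f1" "real_polynomial_function f2"
    "real_polynomial_function g1" "real_polynomial_function g2"
    "\<And>x. (f has_derivative (\<lambda>h. h $ 1 * f1 x + h $ 2 * f2 x)) (at x)"
    "\<And>x. (g has_derivative (\<lambda>h. h $ 1 * g1 x + h $ 2 * g2 x)) (at x)" by blast
  show ?case
  proof (intro exI conjI allI)
    show "((\<lambda>x. f x + g x) has_derivative (\<lambda>h. h $ 1 * (f1 x + g1 x) + h $ 2 * (f2 x + g2 x))) (at x)" for x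
      by (rule has_derivative_eq_rhs[OF has_derivative_add[OF *(5,6)]]) (simp add: fun_eq_iff algebra_simps)
  qed (use * in \<open>auto intro: real_polynomial_function.intros(3)\<close>)
next
  case (mult f g)
  then obtain f1 f2 g1 g2 where *: "real_polynomial_function f1" "real_polynomial_function f2"
    "real_polynomial_function g1" "real_polynomial_function g2"
    "\<And>x. (f has_derivative (\<lambda>h. h $ 1 * f1 x + h $ 2 * f2 x)) (at x)"
    "\<And>x. (g has_derivative (\<lambda>h. h $ 1 * g1 x + h $ 2 * g2 x)) (at x)" by blast
  show ?case
  proof (intro exI conjI allI)
    show "((\<lambda>x. f x * g x) has_derivative
        (\<lambda>h. h $ 1 * (f x * g1 x + f1 x * g x) + h $ 2 * (f x * g2 x + f2 x * g x))) (at x)" for x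
      by (rule has_derivative_eq_rhs[OF has_derivative_mult[OF *(5,6)]]) (simp add: fun_eq_iff algebra_simps)
  qed (use * mult in \<open>auto intro!: real_polynomial_function.intros(3) real_polynomial_function.intros(4)\<close>)
qed

lemma complex_polynomial_function_iff:
  fixes p :: "'a :: real_normed_vector \<Rightarrow> complex"
  shows "polynomial_function p \<longleftrightarrow>
    real_polynomial_function (\<lambda>x. Re (p x)) \<and> real_polynomial_function (\<lambda>x. Im (p x))"
  by (simp add: polynomial_function_iff_Basis_inner Basis_complex_def inner_complex_def)

lemma polynomial_function_times:
  fixes p q :: "'a :: real_normed_vector \<Rightarrow> complex"
  assumes "polynomial_function p" "polynomial_function q"
  shows "polynomial_function (\<lambda>x. p x * q x)"
  using assms unfolding complex_polynomial_function_iff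
  by (auto intro!: real_polynomial_function_diff real_polynomial_function.intros(3) real_polynomial_function.intros(4))

definition has_partials :: "(real ^ 2 \<Rightarrow> complex) \<Rightarrow> (real ^ 2 \<Rightarrow> complex) \<Rightarrow> (real ^ 2 \<Rightarrow> complex) \<Rightarrow> bool" where
  "has_partials p p1 p2 \<longleftrightarrow> (\<forall>x. (p has_derivative (\<lambda>h. h $ 1 *\<^sub>R p1 x + h $ 2 *\<^sub>R p2 x)) (at x))"

lemma polynomial_partials:
  assumes "polynomial_function p"
  shows "\<exists>p1 p2. polynomial_function p1 \<and> polynomial_function p2 \<and> has_partials p p1 p2"
proof -
  obtain a1 a2 where a: "real_polynomial_function a1" "real_polynomial_function a2"
    "\<And>x. ((\<lambda>x. Re (p x)) has_derivative (\<lambda>h. h $ 1 * a1 x + h $ 2 * a2 x)) (at x)"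
    using assms real_polynomial_partials unfolding complex_polynomial_function_iff by blast
  obtain b1 b2 where b: "real_polynomial_function b1" "real_polynomial_function b2"
    "\<And>x. ((\<lambda>x. Im (p x)) has_derivative (\<lambda>h. h $ 1 * b1 x + h $ 2 * b2 x)) (at x)"
    using assms real_polynomial_partials unfolding complex_polynomial_function_iff by blast
  have "((\<lambda>x. Re (p x) *\<^sub>R 1 + Im (p x) *\<^sub>R \<i>) has_derivative
      (\<lambda>h. (h $ 1 * a1 x + h $ 2 * a2 x) *\<^sub>R 1 + (h $ 1 * b1 x + h $ 2 * b2 x) *\<^sub>R \<i>)) (at x)" for x
    by (intro has_derivative_add has_derivative_scaleR_left a b)
  moreover have "(\<lambda>x. Re (p x) *\<^sub>R 1 + Im (p x) *\<^sub>R \<i>) = p"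
    by (simp add: fun_eq_iff complex_eq_iff)
  moreover have "(\<lambda>h. (h $ 1 * a1 x + h $ 2 * a2 x) *\<^sub>R 1 + (h $ 1 * b1 x + h $ 2 * b2 x) *\<^sub>R \<i>) =
      (\<lambda>h :: real ^ 2. h $ 1 *\<^sub>R Complex (a1 x) (b1 x) + h $ 2 *\<^sub>R Complex (a2 x) (b2 x))" for x
    by (simp add: fun_eq_iff complex_eq_iff algebra_simps)
  ultimately have "has_partials p (\<lambda>x. Complex (a1 x) (b1 x)) (\<lambda>x. Complex (a2 x) (b2 x))"
    by (simp add: has_partials_def)
  moreover have "polynomial_function (\<lambda>x. Complex (a1 x) (b1 x))" "polynomial_function (\<lambda>x. Complex (a2 x) (b2 x))"
    using a b by (auto simp: complex_polynomial_function_iff)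
  ultimately show ?thesis by blast
qed

definition vec2 :: "real \<Rightarrow> real \<Rightarrow> real ^ 2" where
  "vec2 a b = a *\<^sub>R axis 1 1 + b *\<^sub>R axis 2 1"

lemma vec2_nth [simp]: "vec2 a b $ 1 = a" "vec2 a b $ 2 = b"
  by (simp_all add: vec2_def axis_def)

lemma vec2_components: "vec2 (x $ 1) (x $ 2) = x"
  unfolding vec2_def by (rule vec2_eq[symmetric])

lemma scaleR_vec2: "t *\<^sub>R vec2 a b = vec2 (t * a) (t * b)"
  by (simp add: vec2_def scaleR_add_right)

lemma has_partials_curve:
  assumes "has_partials p p1 p2" "(c has_real_derivative c') (at t)" "(s has_real_derivative s') (at t)"
  shows "((\<lambda>t. p (vec2 (c t) (s t))) has_vector_derivative
    c' *\<^sub>R p1 (vec2 (c t) (s t)) + s' *\<^sub>R p2 (vec2 (c t) (s t))) (at t)"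
proof -
  have "((\<lambda>t. vec2 (c t) (s t)) has_vector_derivative vec2 c' s') (at t)"
    unfolding vec2_def
    using assms(2,3) unfolding has_real_derivative_iff_has_vector_derivative
    by (intro has_vector_derivative_add bounded_linear.has_vector_derivative[OF bounded_linear_scaleR_left])
  hence "((\<lambda>t. vec2 (c t) (s t)) has_derivative (\<lambda>h. h *\<^sub>R vec2 c' s')) (at t)"
    by (simp add: has_vector_derivative_def)
  moreover have "(p has_derivative (\<lambda>h. h $ 1 *\<^sub>R p1 (vec2 (c t) (s t)) + h $ 2 *\<^sub>R p2 (vec2 (c t) (s t))))
      (at (vec2 (c t) (s t)))"
    using assms(1) by (simp add: has_partials_def)
  ultimately have "((\<lambda>t. p (vec2 (c t) (s t))) has_derivative
      (\<lambda>h. (h *\<^sub>R vec2 c' s') $ 1 *\<^sub>R p1 (vec2 (c t) (s t)) + (h *\<^sub>R vec2 c' s') $ 2 *\<^sub>R p2 (vec2 (c t) (s t)))) (at t)"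
    by (rule has_derivative_compose)
  thus ?thesis
    by (simp add: has_vector_derivative_def scaleR_add_right)
qed

lemma vector_derivative_axis:
  assumes "has_partials p p1 p2"
  shows "vector_derivative (\<lambda>s. p (x + s *\<^sub>R axis 1 1)) (at t) = p1 (x + t *\<^sub>R axis 1 1)"
    "vector_derivative (\<lambda>s. p (x + s *\<^sub>R axis 2 1)) (at t) = p2 (x + t *\<^sub>R axis 2 1)"
proof -
  have 1: "x + s *\<^sub>R axis 1 1 = vec2 (x $ 1 + s) (x $ 2)" and 2: "x + s *\<^sub>R axis 2 1 = vec2 (x $ 1) (x $ 2 + s)" for s
    by (simp_all add: vec_eq_iff forall_2 axis_def)
  have d: "((\<lambda>s. a + s) has_real_derivative 1) (at t)" for a
    by (auto intro!: derivative_eq_intros)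
  show "vector_derivative (\<lambda>s. p (x + s *\<^sub>R axis 1 1)) (at t) = p1 (x + t *\<^sub>R axis 1 1)"
    unfolding 1 using has_partials_curve[OF assms, of "\<lambda>s. x $ 1 + s" 1 t "\<lambda>s. x $ 2" 0]
    by (intro vector_derivative_at) (simp add: d)
  show "vector_derivative (\<lambda>s. p (x + s *\<^sub>R axis 2 1)) (at t) = p2 (x + t *\<^sub>R axis 2 1)"
    unfolding 2 using has_partials_curve[OF assms, of "\<lambda>s. x $ 1" 0 t "\<lambda>s. x $ 2 + s" 1]
    by (intro vector_derivative_at) (simp add: d)
qed

lemma laplacian_partials:
  assumes "has_partials p p1 p2" "has_partials p1 p11 p12" "has_partials p2 p21 p22"
  shows "laplacian p x = p11 x + p22 x"
  unfolding laplacian_def Basis_vec2 using axis_neq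
  by (simp add: vector_derivative_axis[OF assms(1)] vector_derivative_axis[OF assms(2)]
      vector_derivative_axis[OF assms(3)])

text \<open>Euler's identity, applied twice, turns the vanishing Laplacian into an equation along the circle.\<close>

lemma harmonic_ode:
  assumes p: "polynomial_function p" and hom: "\<And>t x. p (t *\<^sub>R x) = of_real (t ^ n) * p x"
    and lap: "\<And>x. laplacian p x = 0"
  defines "q \<equiv> \<lambda>\<theta>. p (vec2 (cos \<theta>) (sin \<theta>))"
  shows "\<exists>q'. (\<forall>\<theta>. (q has_vector_derivative q' \<theta>) (at \<theta>)) \<and>
    (\<forall>\<theta>. (q' has_vector_derivative - (of_nat n)\<^sup>2 * q \<theta>) (at \<theta>))"
proof -
  obtain p1 p2 where p1: "polynomial_function p1" and p2: "polynomial_function p2" and D: "has_partials p p1 p2"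
    using polynomial_partials[OF p] by blast
  obtain p11 p12 where D1: "has_partials p1 p11 p12" using polynomial_partials[OF p1] by blast
  obtain p21 p22 where D2: "has_partials p2 p21 p22" using polynomial_partials[OF p2] by blast
  have lap': "p11 x + p22 x = 0" for x
    using laplacian_partials[OF D D1 D2] lap by simp
  \<comment> \<open>The derivative of \<open>p\<close> along a ray is computed in two ways, by the
    chain rule and by homogeneity.\<close>
  have euler_t: "of_real t * (a *\<^sub>R p1 (vec2 (t * a) (t * b)) + b *\<^sub>R p2 (vec2 (t * a) (t * b))) =
      of_nat n * p (vec2 (t * a) (t * b))" if "t \<noteq> 0" for t a b
  proof -
    have "((\<lambda>t. p (vec2 (t * a) (t * b))) has_vector_derivative
        a *\<^sub>R p1 (vec2 (t * a) (t * b)) + b *\<^sub>R p2 (vec2 (t * a) (t * b))) (at t)"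
      by (rule has_partials_curve[OF D]) (auto intro!: derivative_eq_intros)
    moreover have "((\<lambda>t. p (vec2 (t * a) (t * b))) has_vector_derivative
        of_real (real n * t ^ (n - 1)) * p (vec2 a b)) (at t)"
      unfolding scaleR_vec2[symmetric] hom
      by (intro has_vector_derivative_mult_left has_vector_derivative_of_real)
        (auto intro!: derivative_eq_intros)
    ultimately have "a *\<^sub>R p1 (vec2 (t * a) (t * b)) + b *\<^sub>R p2 (vec2 (t * a) (t * b)) =
        of_real (real n * t ^ (n - 1)) * p (vec2 a b)"
      by (rule vector_derivative_unique_at)
    hence "of_real t * (a *\<^sub>R p1 (vec2 (t * a) (t * b)) + b *\<^sub>R p2 (vec2 (t * a) (t * b))) =
        of_nat n * (of_real (t * t ^ (n - 1)) * p (vec2 a b))"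
      by (simp add: mult_ac)
    also have "of_nat n * (of_real (t * t ^ (n - 1)) * p (vec2 a b)) = of_nat n * p (vec2 (t * a) (t * b))"
      unfolding scaleR_vec2[symmetric] hom by (cases n) auto
    finally show ?thesis .
  qed
  have euler1: "a *\<^sub>R p1 (vec2 a b) + b *\<^sub>R p2 (vec2 a b) = of_nat n * p (vec2 a b)" for a b
    using euler_t[of 1 a b] by simp
  \<comment> \<open>Euler's identity is differentiated along the ray at \<open>t = 1\<close>, which
    gives the second radial derivative.\<close>
  have euler2: "a *\<^sub>R (a *\<^sub>R p11 (vec2 a b) + b *\<^sub>R p12 (vec2 a b)) +
      b *\<^sub>R (a *\<^sub>R p21 (vec2 a b) + b *\<^sub>R p22 (vec2 a b)) = of_nat n * (of_nat n - 1) * p (vec2 a b)" for a b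
  proof -
    have "((\<lambda>t. (t * a) *\<^sub>R p1 (vec2 (t * a) (t * b)) + (t * b) *\<^sub>R p2 (vec2 (t * a) (t * b))) has_vector_derivative
        (1 * a) *\<^sub>R (a *\<^sub>R p11 (vec2 (1 * a) (1 * b)) + b *\<^sub>R p12 (vec2 (1 * a) (1 * b))) + a *\<^sub>R p1 (vec2 (1 * a) (1 * b)) +
        ((1 * b) *\<^sub>R (a *\<^sub>R p21 (vec2 (1 * a) (1 * b)) + b *\<^sub>R p22 (vec2 (1 * a) (1 * b))) + b *\<^sub>R p2 (vec2 (1 * a) (1 * b)))) (at 1)"
      by (intro has_vector_derivative_add has_vector_derivative_scaleR has_partials_curve[OF D1] has_partials_curve[OF D2])
        (auto intro!: derivative_eq_intros)
    moreover have "((\<lambda>t. of_nat n * p (vec2 (t * a) (t * b))) has_vector_derivative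
        of_nat n * (a *\<^sub>R p1 (vec2 (1 * a) (1 * b)) + b *\<^sub>R p2 (vec2 (1 * a) (1 * b)))) (at 1)"
      by (intro has_vector_derivative_mult_right has_partials_curve[OF D]) (auto intro!: derivative_eq_intros)
    ultimately have unique: "a *\<^sub>R (a *\<^sub>R p11 (vec2 a b) + b *\<^sub>R p12 (vec2 a b)) + a *\<^sub>R p1 (vec2 a b) +
        (b *\<^sub>R (a *\<^sub>R p21 (vec2 a b) + b *\<^sub>R p22 (vec2 a b)) + b *\<^sub>R p2 (vec2 a b)) =
        of_nat n * (a *\<^sub>R p1 (vec2 a b) + b *\<^sub>R p2 (vec2 a b))"
      unfolding euler1 mult_1_left by (rule vector_derivative_unique_at)
    have "a *\<^sub>R (a *\<^sub>R p11 (vec2 a b) + b *\<^sub>R p12 (vec2 a b)) +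
        b *\<^sub>R (a *\<^sub>R p21 (vec2 a b) + b *\<^sub>R p22 (vec2 a b)) =
        of_nat n * (a *\<^sub>R p1 (vec2 a b) + b *\<^sub>R p2 (vec2 a b)) -
        (a *\<^sub>R p1 (vec2 a b) + b *\<^sub>R p2 (vec2 a b))"
      unfolding unique[symmetric] by (simp add: algebra_simps)
    thus ?thesis
      unfolding euler1 by (simp add: algebra_simps)
  qed
  \<comment> \<open>The second angular derivative is the Laplacian minus the first and minus the
    second radial derivative on the unit circle. \<open>B\<close> and \<open>C\<close> stand for the
    two mixed derivatives, each kept as a separate term. With the Euler identities the result is
    \<open>- n - n (n - 1) = - n\<^sup>2\<close> times \<open>p\<close>.\<close>
  have regroup: "(- s) *\<^sub>R ((- s) *\<^sub>R A + c *\<^sub>R B) + (- c) *\<^sub>R P1 + (c *\<^sub>R ((- s) *\<^sub>R C + c *\<^sub>R D) + (- s) *\<^sub>R P2) =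
      (c * c + s * s) *\<^sub>R (A + D) - (c *\<^sub>R P1 + s *\<^sub>R P2) -
      (c *\<^sub>R (c *\<^sub>R A + s *\<^sub>R B) + s *\<^sub>R (c *\<^sub>R C + s *\<^sub>R D))"
    for c s :: real and A B C D P1 P2 :: complex
    by (simp add: algebra_simps)
  define q' where "q' \<theta> = (- sin \<theta>) *\<^sub>R p1 (vec2 (cos \<theta>) (sin \<theta>)) + cos \<theta> *\<^sub>R p2 (vec2 (cos \<theta>) (sin \<theta>))" for \<theta>
  have "(q has_vector_derivative q' \<theta>) (at \<theta>)" for \<theta>
    unfolding q_def q'_def by (rule has_partials_curve[OF D]) (auto intro!: derivative_eq_intros)
  moreover have "(q' has_vector_derivative - (of_nat n)\<^sup>2 * q \<theta>) (at \<theta>)" for \<theta>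
  proof -
    let ?c = "cos \<theta>" and ?s = "sin \<theta>"
    let ?x = "vec2 ?c ?s"
    have "(q' has_vector_derivative
        (- ?s) *\<^sub>R ((- ?s) *\<^sub>R p11 ?x + ?c *\<^sub>R p12 ?x) + (- ?c) *\<^sub>R p1 ?x +
        (?c *\<^sub>R ((- ?s) *\<^sub>R p21 ?x + ?c *\<^sub>R p22 ?x) + (- ?s) *\<^sub>R p2 ?x)) (at \<theta>)"
      unfolding q'_def[abs_def]
      by (intro has_vector_derivative_add has_vector_derivative_scaleR has_partials_curve[OF D1] has_partials_curve[OF D2])
        (auto intro!: derivative_eq_intros)
    also have "(- ?s) *\<^sub>R ((- ?s) *\<^sub>R p11 ?x + ?c *\<^sub>R p12 ?x) + (- ?c) *\<^sub>R p1 ?x +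
        (?c *\<^sub>R ((- ?s) *\<^sub>R p21 ?x + ?c *\<^sub>R p22 ?x) + (- ?s) *\<^sub>R p2 ?x) =
        (?c * ?c + ?s * ?s) *\<^sub>R (p11 ?x + p22 ?x) - (?c *\<^sub>R p1 ?x + ?s *\<^sub>R p2 ?x) -
        (?c *\<^sub>R (?c *\<^sub>R p11 ?x + ?s *\<^sub>R p12 ?x) + ?s *\<^sub>R (?c *\<^sub>R p21 ?x + ?s *\<^sub>R p22 ?x))"
      by (rule regroup)
    also have "\<dots> = - (of_nat n)\<^sup>2 * q \<theta>"
      unfolding lap' euler1 euler2 q_def by (simp add: algebra_simps power2_eq_square)
    finally show ?thesis .
  qed
  ultimately show ?thesis by blast
qed

text \<open>For \<open>a = n\<close> and \<open>a = - n\<close> the function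
  \<open>(q' - \<i> a q) * cis (a \<theta>)\<close> has derivative 0. The two constants give a
  linear system for \<open>q\<close> and \<open>q'\<close>; solving it for \<open>q\<close> divides
  by \<open>2 \<i> n\<close>, hence \<open>n > 0\<close>.\<close>

lemma ode_solution:
  fixes q :: "real \<Rightarrow> complex"
  assumes n: "n > 0" and q: "\<And>\<theta>. (q has_vector_derivative q' \<theta>) (at \<theta>)"
    and q': "\<And>\<theta>. (q' has_vector_derivative - (of_nat n)\<^sup>2 * q \<theta>) (at \<theta>)"
  shows "\<exists>a b. \<forall>\<theta>. q \<theta> = a * cis (real n * \<theta>) + b * cis (- real n * \<theta>)"
proof -
  have cis: "((\<lambda>\<theta>. cis (a * \<theta>)) has_vector_derivative \<i> * of_real a * cis (a * \<theta>)) (at \<theta>)" for a \<theta>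
  proof -
    have "((\<lambda>w. exp (\<i> * of_real a * w)) has_field_derivative exp (\<i> * of_real a * of_real \<theta>) * (\<i> * of_real a)) (at (of_real \<theta>))"
      by (auto intro!: derivative_eq_intros)
    from has_vector_derivative_real_field[OF this] show ?thesis
      by (simp add: cis_conv_exp mult_ac)
  qed
  have const: "\<exists>C. \<forall>\<theta>. (q' \<theta> - \<i> * of_real a * q \<theta>) * cis (a * \<theta>) = C" if a: "a\<^sup>2 = (real n)\<^sup>2" for a
  proof -
    have "((\<lambda>\<theta>. (q' \<theta> - \<i> * of_real a * q \<theta>) * cis (a * \<theta>)) has_vector_derivative 0) (at \<theta>)" for \<theta>
    proof -
      have "((\<lambda>\<theta>. (q' \<theta> - \<i> * of_real a * q \<theta>) * cis (a * \<theta>)) has_vector_derivative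
          (q' \<theta> - \<i> * of_real a * q \<theta>) * (\<i> * of_real a * cis (a * \<theta>)) +
          (- (of_nat n)\<^sup>2 * q \<theta> - \<i> * of_real a * q' \<theta>) * cis (a * \<theta>)) (at \<theta>)"
        by (intro has_vector_derivative_mult has_vector_derivative_diff has_vector_derivative_mult_right q q' cis)
      also have "(q' \<theta> - \<i> * of_real a * q \<theta>) * (\<i> * of_real a * cis (a * \<theta>)) +
          (- (of_nat n)\<^sup>2 * q \<theta> - \<i> * of_real a * q' \<theta>) * cis (a * \<theta>) =
          (of_real (a\<^sup>2) - (of_nat n)\<^sup>2) * (q \<theta> * cis (a * \<theta>))"
        by (simp add: algebra_simps power2_eq_square)
      also have "\<dots> = 0" unfolding a by simp
      finally show ?thesis .
    qed
    hence "((\<lambda>\<theta>. (q' \<theta> - \<i> * of_real a * q \<theta>) * cis (a * \<theta>)) has_vector_derivative 0) (at \<theta> within UNIV)" for \<theta>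
      by simp
    from has_vector_derivative_zero_constant[OF convex_UNIV this] show ?thesis by (metis UNIV_I)
  qed
  obtain C1 where C1: "\<And>\<theta>. (q' \<theta> - \<i> * of_real (real n) * q \<theta>) * cis (real n * \<theta>) = C1"
    using const[of "real n"] by blast
  obtain C2 where C2: "\<And>\<theta>. (q' \<theta> - \<i> * of_real (- real n) * q \<theta>) * cis (- real n * \<theta>) = C2"
    using const[of "- real n"] by (auto simp del: of_real_minus)
  have "q \<theta> = (C2 / (2 * \<i> * of_nat n)) * cis (real n * \<theta>) + (- C1 / (2 * \<i> * of_nat n)) * cis (- real n * \<theta>)" for \<theta>
  proof -
    have 1: "C2 * cis (real n * \<theta>) = q' \<theta> + \<i> * of_nat n * q \<theta>"
      unfolding C2[of \<theta>, symmetric] mult.assoc cis_mult by simp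
    have 2: "C1 * cis (- real n * \<theta>) = q' \<theta> - \<i> * of_nat n * q \<theta>"
      unfolding C1[of \<theta>, symmetric] mult.assoc cis_mult by simp
    have "(C2 / (2 * \<i> * of_nat n)) * cis (real n * \<theta>) + (- C1 / (2 * \<i> * of_nat n)) * cis (- real n * \<theta>) =
        (C2 * cis (real n * \<theta>) - C1 * cis (- real n * \<theta>)) / (2 * \<i> * of_nat n)"
      by (simp add: diff_divide_distrib)
    also have "\<dots> = q \<theta>"
      unfolding 1 2 using n by (simp add: field_simps)
    finally show ?thesis ..
  qed
  thus ?thesis by blast
qed

lemma cpx_vec2: "cpx (vec2 (cos \<theta>) (sin \<theta>)) = cis \<theta>"
  by (simp add: cpx_def complex_eq_iff)

lemma sphere_vec2:
  assumes "norm \<xi> = 1"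
  obtains \<theta> where "\<xi> = vec2 (cos \<theta>) (sin \<theta>)"
proof -
  have "(\<xi> $ 1)\<^sup>2 + (\<xi> $ 2)\<^sup>2 = 1"
    using assms norm_cpx[of \<xi>] by (simp add: cpx_def cmod_def)
  then obtain \<theta> where "\<xi> $ 1 = cos \<theta>" "\<xi> $ 2 = sin \<theta>"
    using sincos_total_2pi by blast
  thus thesis
    using vec2_components[of \<xi>] that by metis
qed

text \<open>On the circle a harmonic homogeneous polynomial satisfies
  \<open>q'' = - n\<^sup>2 q\<close>, so it is a combination of
  \<open>exp (\<plusminus> \<i> n \<theta>)\<close>. Degree 0 is treated apart: there the two
  exponentials coincide.\<close>

lemma spherical_harmonics_repr:
  assumes "Y \<in> spherical_harmonics n"
  shows "\<exists>a. \<forall>\<xi>\<in>sphere 0 1. Y \<xi> = (\<Sum>k\<in>{int n, - int n}. a k * sph k \<xi>)"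
proof -
  obtain p where p: "polynomial_function p" "\<And>t x. p (t *\<^sub>R x) = of_real (t ^ n) * p x"
    "\<And>x. laplacian p x = 0" and Y: "\<And>\<xi>. \<xi> \<in> sphere 0 1 \<Longrightarrow> Y \<xi> = p \<xi>"
    using assms by (auto simp: spherical_harmonics_def)
  show ?thesis
  proof (cases "n = 0")
    case True
    \<comment> \<open>Homogeneity of degree 0 is used at \<open>t = 0\<close>, where
      \<open>0 ^ 0 = 1\<close>.\<close>
    hence "p x = p 0" for x
      using p(2)[of 0 x] by simp
    thus ?thesis
      using True Y by (intro exI[of _ "\<lambda>_. p 0"]) (auto simp: sph_def)
  next
    case False
    obtain q' where q': "\<And>\<theta>. ((\<lambda>\<theta>. p (vec2 (cos \<theta>) (sin \<theta>))) has_vector_derivative q' \<theta>) (at \<theta>)"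
      "\<And>\<theta>. (q' has_vector_derivative - (of_nat n)\<^sup>2 * p (vec2 (cos \<theta>) (sin \<theta>))) (at \<theta>)"
      using harmonic_ode[OF p] by blast
    obtain a b where ab: "\<And>\<theta>. p (vec2 (cos \<theta>) (sin \<theta>)) = a * cis (real n * \<theta>) + b * cis (- real n * \<theta>)"
      using ode_solution[OF _ q'] False by blast
    have "Y \<xi> = a * sph (int n) \<xi> + b * sph (- int n) \<xi>" if \<xi>: "\<xi> \<in> sphere 0 1" for \<xi>
    proof -
      obtain \<theta> where \<theta>: "\<xi> = vec2 (cos \<theta>) (sin \<theta>)"
        using sphere_vec2[of \<xi>] \<xi> by auto
      thus ?thesis
        using Y[OF \<xi>] False by (simp add: ab sph_def cpx_vec2 Complex.DeMoivre cis_cnj)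
    qed
    thus ?thesis
      using False by (intro exI[of _ "\<lambda>k. if k = int n then a else b"]) auto
  qed
qed

text \<open>\<open>sph k\<close> is a power of the linear form \<open>L x = x_1 + c x_2\<close> with
  \<open>c = \<plusminus> \<i>\<close>. Its Laplacian contains the factor
  \<open>L(e_1)^2 + L(e_2)^2 = 1 + c\<^sup>2 = 0\<close>.\<close>

lemma sph_spherical_harmonic: "sph k \<in> spherical_harmonics (nat \<bar>k\<bar>)"
proof -
  define c where "c = (if k \<ge> 0 then \<i> else - \<i>)"
  define n where "n = nat \<bar>k\<bar>"
  define L where "L x = of_real (x $ 1) + c * of_real (x $ 2)" for x :: "real ^ 2"
  have c2: "c * c = -1" by (simp add: c_def)
  have "L x = (if k \<ge> 0 then cpx x else cnj (cpx x))" for x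
    by (simp add: L_def c_def cpx_def complex_eq_iff)
  hence sph: "sph k = (\<lambda>x. L x ^ n)"
    by (simp add: fun_eq_iff sph_def n_def)
  have "polynomial_function L"
    unfolding complex_polynomial_function_iff L_def c_def
    by (auto intro!: real_polynomial_function.intros(1) bounded_linear_minus bounded_linear_vec_nth)
  hence "polynomial_function (\<lambda>x. L x ^ n)"
    by (induction n) (auto intro: polynomial_function_times)
  moreover have "L (t *\<^sub>R x) ^ n = of_real (t ^ n) * L x ^ n" for t x
  proof -
    have "L (t *\<^sub>R x) = of_real t * L x" by (simp add: L_def algebra_simps)
    thus ?thesis by (simp add: power_mult_distrib)
  qed
  moreover have "laplacian (\<lambda>x. L x ^ n) x = 0" for x
  proof -
    have der: "((\<lambda>s. C * (A + of_real s * B) ^ m) has_vector_derivative C * (of_nat m * B * (A + of_real t * B) ^ (m - 1))) (at t)"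
      for A B C :: complex and m t
    proof -
      have "((\<lambda>s. C * (A + s * B) ^ m) has_field_derivative C * (of_nat m * B * (A + of_real t * B) ^ (m - 1))) (at (of_real t))"
        by (auto intro!: derivative_eq_intros)
      from has_vector_derivative_real_field[OF this] show ?thesis .
    qed
    have second: "vector_derivative (\<lambda>t. vector_derivative (\<lambda>s. L (x + s *\<^sub>R b) ^ n) (at t)) (at (0::real)) =
        of_nat n * (of_nat (n - 1) * L x ^ (n - 1 - 1)) * (L b * L b)" for b
    proof -
      have Lxb: "L (x + s *\<^sub>R b) = L x + of_real s * L b" for s
        by (simp add: L_def algebra_simps)
      have "vector_derivative (\<lambda>s. L (x + s *\<^sub>R b) ^ n) (at t) = of_nat n * L b * (L x + of_real t * L b) ^ (n - 1)" for t
        unfolding Lxb using der[of 1 "L x" "L b" n t] by (intro vector_derivative_at) simp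
      moreover have "vector_derivative (\<lambda>t. of_nat n * L b * (L x + of_real t * L b) ^ (n - 1)) (at 0) =
          of_nat n * L b * (of_nat (n - 1) * L b * (L x + of_real 0 * L b) ^ (n - 1 - 1))"
        by (rule vector_derivative_at) (rule der)
      ultimately show ?thesis by (simp add: mult_ac)
    qed
    have "L (axis 1 1) = 1" "L (axis 2 1) = c"
      by (simp_all add: L_def axis_def)
    thus ?thesis
      unfolding laplacian_def Basis_vec2 using axis_neq by (simp add: second c2)
  qed
  ultimately show ?thesis
    unfolding spherical_harmonics_def n_def[symmetric] sph by blast
qed

subsection \<open>Expansion in circular harmonics\<close>

lemma circ_bounded_L2:
  assumes "f \<in> borel_measurable circ" "\<And>\<xi>. \<xi> \<in> sphere 0 1 \<Longrightarrow> cmod (f \<xi>) \<le> B"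
  shows "f \<in> L2 circ"
proof (rule L2_bound[OF assms(1)])
  show "integrable circ (\<lambda>_. B\<^sup>2)" by simp
  show "AE \<xi> in circ. (cmod (f \<xi>))\<^sup>2 \<le> B\<^sup>2"
    by (rule AE_I2) (auto intro!: power_mono assms(2))
qed

lemma harmonic_coeff_cong:
  "(\<And>\<xi>. \<xi> \<in> sphere 0 1 \<Longrightarrow> Y \<xi> = P \<xi>) \<Longrightarrow> harmonic_coeff Y f r = harmonic_coeff P f r"
  unfolding harmonic_coeff_def by (intro Bochner_Integration.integral_cong) auto

lemma measurable_slice:
  assumes [measurable]: "f \<in> borel_measurable borel"
  shows "(\<lambda>\<xi>. f (r *\<^sub>R \<xi>)) \<in> borel_measurable circ"
  by (rule measurable_sphere_borel) measurable

lemma measurable_polar_compose: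
  assumes "g \<in> borel \<rightarrow>\<^sub>M N"
  shows "(\<lambda>(r, \<xi>). g (r *\<^sub>R \<xi>)) \<in> rad \<Otimes>\<^sub>M circ \<rightarrow>\<^sub>M N"
  using measurable_compose[OF measurable_polar assms] by (simp only: case_prod_unfold)

lemma measurable_slice_mult:
  fixes f P :: "real ^ 2 \<Rightarrow> complex"
  assumes [measurable]: "f \<in> borel_measurable borel" and P [measurable]: "P \<in> borel_measurable borel"
  shows "(\<lambda>(r, \<xi>). f (r *\<^sub>R \<xi>) * cnj (P \<xi>)) \<in> borel_measurable (rad \<Otimes>\<^sub>M circ)"
proof -
  have [measurable]: "(\<lambda>(r, \<xi>). f (r *\<^sub>R \<xi>)) \<in> borel_measurable (rad \<Otimes>\<^sub>M circ)"
    by (rule measurable_polar_compose[OF assms(1)])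
  have [measurable]: "P \<in> borel_measurable circ"
    by (rule measurable_sphere_borel[OF P])
  show ?thesis
    using \<open>(\<lambda>(r, \<xi>). f (r *\<^sub>R \<xi>)) \<in> _\<close> unfolding case_prod_unfold by measurable
qed

lemma measurable_harmonic_coeff:
  fixes f P :: "real ^ 2 \<Rightarrow> complex"
  assumes "f \<in> borel_measurable borel" "P \<in> borel_measurable borel"
  shows "harmonic_coeff P f \<in> borel_measurable borel"
  unfolding harmonic_coeff_def[abs_def]
  using circ.borel_measurable_lebesgue_integral[OF measurable_slice_mult[OF assms]]
  by (simp add: measurable_cong_sets[OF sets_radial_measure refl])

lemma nn_integral_slices:
  assumes f: "f \<in> L2 lborel"
  shows "(\<integral>\<^sup>+r. (\<integral>\<^sup>+\<xi>. ennreal ((cmod (f (r *\<^sub>R \<xi>)))\<^sup>2) \<partial>circ) \<partial>rad) = ennreal ((L2_norm lborel f)\<^sup>2)"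
  using L2_measurable[OF f] by (subst nn_integral_polar[symmetric]) (auto simp: L2_nn_integral[OF f])

lemma AE_slice_L2:
  assumes f: "f \<in> L2 lborel"
  shows "AE r in rad. (\<lambda>\<xi>. f (r *\<^sub>R \<xi>)) \<in> L2 circ"
proof -
  have [measurable]: "f \<in> borel_measurable borel" using L2_measurable[OF f] by simp
  have "(\<lambda>(r, \<xi>). f (r *\<^sub>R \<xi>)) \<in> borel_measurable (rad \<Otimes>\<^sub>M circ)"
    by (rule measurable_polar_compose) measurable
  hence "(\<lambda>r. \<integral>\<^sup>+\<xi>. ennreal ((cmod (f (r *\<^sub>R \<xi>)))\<^sup>2) \<partial>circ) \<in> borel_measurable rad"
    by (intro circ.borel_measurable_nn_integral) (unfold case_prod_unfold, measurable)
  moreover have "(\<integral>\<^sup>+r. (\<integral>\<^sup>+\<xi>. ennreal ((cmod (f (r *\<^sub>R \<xi>)))\<^sup>2) \<partial>circ) \<partial>rad) \<noteq> \<infinity>"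
    unfolding nn_integral_slices[OF f] by simp
  ultimately have "AE r in rad. (\<integral>\<^sup>+\<xi>. ennreal ((cmod (f (r *\<^sub>R \<xi>)))\<^sup>2) \<partial>circ) \<noteq> \<infinity>"
    by (rule nn_integral_PInf_AE)
  thus ?thesis
    by eventually_elim (subst L2_iff_nn_integral, auto intro: measurable_slice simp: top.not_eq_extremum)
qed

text \<open>Cauchy-Schwarz on each circle bounds the coefficient by the norm of the slice, and in
  polar coordinates the squared norms of the slices integrate to that of \<open>f\<close>.\<close>

lemma harmonic_coeff_L2:
  fixes f P :: "real ^ 2 \<Rightarrow> complex"
  assumes f: "f \<in> L2 lborel" and P [measurable]: "P \<in> borel_measurable borel"
    and B: "\<And>\<xi>. \<xi> \<in> sphere 0 1 \<Longrightarrow> cmod (P \<xi>) \<le> B"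
  shows "harmonic_coeff P f \<in> L2 rad"
proof -
  have fm [measurable]: "f \<in> borel_measurable borel" using L2_measurable[OF f] by simp
  have PL2: "P \<in> L2 circ"
    by (rule circ_bounded_L2[OF measurable_sphere_borel[OF P] B])
  let ?C = "ennreal ((L2_norm circ P)\<^sup>2)"
  have "(\<integral>\<^sup>+r. ennreal ((cmod (harmonic_coeff P f r))\<^sup>2) \<partial>rad) \<le>
      (\<integral>\<^sup>+r. ?C * (\<integral>\<^sup>+\<xi>. ennreal ((cmod (f (r *\<^sub>R \<xi>)))\<^sup>2) \<partial>circ) \<partial>rad)"
  proof (rule nn_integral_mono_AE, use AE_slice_L2[OF f] in eventually_elim)
    case (elim r)
    have "cmod (harmonic_coeff P f r) = cmod (L2_inner circ (\<lambda>\<xi>. f (r *\<^sub>R \<xi>)) P)"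
      by (simp add: harmonic_coeff_def L2_inner_def)
    also have "\<dots> \<le> L2_norm circ (\<lambda>\<xi>. f (r *\<^sub>R \<xi>)) * L2_norm circ P"
      by (rule L2_inner_bound[OF elim PL2])
    finally have "(cmod (harmonic_coeff P f r))\<^sup>2 \<le> (L2_norm circ (\<lambda>\<xi>. f (r *\<^sub>R \<xi>)) * L2_norm circ P)\<^sup>2"
      by (rule power_mono) simp
    also have "\<dots> = (L2_norm circ P)\<^sup>2 * (L2_norm circ (\<lambda>\<xi>. f (r *\<^sub>R \<xi>)))\<^sup>2"
      by (simp add: power_mult_distrib)
    finally have "(cmod (harmonic_coeff P f r))\<^sup>2 \<le> (L2_norm circ P)\<^sup>2 * (L2_norm circ (\<lambda>\<xi>. f (r *\<^sub>R \<xi>)))\<^sup>2" .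
    thus ?case
      by (simp add: L2_nn_integral[OF elim] ennreal_leI flip: ennreal_mult)
  qed
  also have "\<dots> = ?C * ennreal ((L2_norm lborel f)\<^sup>2)"
  proof (subst nn_integral_cmult)
    have "(\<lambda>(r, \<xi>). f (r *\<^sub>R \<xi>)) \<in> borel_measurable (rad \<Otimes>\<^sub>M circ)"
      by (rule measurable_polar_compose[OF fm])
    thus "(\<lambda>r. \<integral>\<^sup>+\<xi>. ennreal ((cmod (f (r *\<^sub>R \<xi>)))\<^sup>2) \<partial>circ) \<in> borel_measurable rad"
      by (intro circ.borel_measurable_nn_integral) (unfold case_prod_unfold, measurable)
  qed (simp add: nn_integral_slices[OF f])
  also have "\<dots> < \<infinity>"
    by (simp flip: ennreal_mult)
  finally show ?thesis
    using measurable_harmonic_coeff[OF fm P] by (subst L2_iff_nn_integral) auto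
qed

definition tensor :: "(real \<Rightarrow> complex) \<Rightarrow> (real ^ 2 \<Rightarrow> complex) \<Rightarrow> real ^ 2 \<Rightarrow> complex" where
  "tensor b P x = b (norm x) * P (sgn x)"

lemma measurable_tensor [measurable]:
  assumes [measurable]: "b \<in> borel_measurable borel" "P \<in> borel_measurable borel"
  shows "tensor b P \<in> borel_measurable borel"
  unfolding tensor_def[abs_def] by measurable

lemma tensor_polar: "r > 0 \<Longrightarrow> \<xi> \<in> sphere 0 1 \<Longrightarrow> tensor b P (r *\<^sub>R \<xi>) = b r * P \<xi>"
  by (simp add: tensor_def sgn_scaleR) (simp add: sgn_div_norm)

lemma tensor_L2:
  assumes b: "b \<in> L2 rad" and P [measurable]: "P \<in> borel_measurable borel"
    and B: "\<And>\<xi>. \<xi> \<in> sphere 0 1 \<Longrightarrow> cmod (P \<xi>) \<le> B"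
  shows "tensor b P \<in> L2 lborel"
proof -
  have [measurable]: "b \<in> borel_measurable borel" using L2_measurable[OF b] by simp
  have "(\<integral>\<^sup>+x. ennreal ((cmod (tensor b P x))\<^sup>2) \<partial>lborel) =
      (\<integral>\<^sup>+r. (\<integral>\<^sup>+\<xi>. ennreal ((cmod (tensor b P (r *\<^sub>R \<xi>)))\<^sup>2) \<partial>circ) \<partial>rad)"
    by (rule nn_integral_polar) measurable
  also have "\<dots> \<le> (\<integral>\<^sup>+r. ennreal ((cmod (b r))\<^sup>2) * ennreal (B\<^sup>2 * (2 * pi)) \<partial>rad)"
  proof (rule nn_integral_mono_AE, rule AE_radial_measureI)
    fix r :: real assume r: "r > 0"
    have "(\<integral>\<^sup>+\<xi>. ennreal ((cmod (tensor b P (r *\<^sub>R \<xi>)))\<^sup>2) \<partial>circ) \<le>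
        (\<integral>\<^sup>+\<xi>. ennreal ((cmod (b r))\<^sup>2 * B\<^sup>2) \<partial>circ)"
      by (rule nn_integral_mono)
        (auto simp: tensor_polar[OF r] norm_mult power_mult_distrib intro!: ennreal_leI mult_left_mono power_mono B)
    also have "\<dots> = ennreal ((cmod (b r))\<^sup>2) * ennreal (B\<^sup>2 * (2 * pi))"
      using measure_circ circ.emeasure_eq_measure[of "sphere 0 1"]
      by (simp add: ennreal_mult[symmetric] mult.assoc)
    finally show "(\<integral>\<^sup>+\<xi>. ennreal ((cmod (tensor b P (r *\<^sub>R \<xi>)))\<^sup>2) \<partial>circ) \<le>
        ennreal ((cmod (b r))\<^sup>2) * ennreal (B\<^sup>2 * (2 * pi))" .
  qed
  also have "\<dots> = ennreal ((L2_norm rad b)\<^sup>2) * ennreal (B\<^sup>2 * (2 * pi))"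
    by (subst nn_integral_multc) (auto simp: L2_nn_integral[OF b])
  also have "\<dots> < \<infinity>"
    by (simp flip: ennreal_mult)
  finally show ?thesis
    by (subst L2_iff_nn_integral) auto
qed

text \<open>Taking the coefficient along \<open>P\<close> is adjoint to multiplying a radial
  function by \<open>P\<close>. Inner products in the plane thereby reduce to radial ones, where the
  Hankel transform acts.\<close>

lemma tensor_inner:
  assumes f: "f \<in> L2 lborel" and b: "b \<in> L2 rad" and P [measurable]: "P \<in> borel_measurable borel"
    and B: "\<And>\<xi>. \<xi> \<in> sphere 0 1 \<Longrightarrow> cmod (P \<xi>) \<le> B"
  shows "L2_inner lborel f (tensor b P) = L2_inner rad (harmonic_coeff P f) b"
proof -
  have [measurable]: "b \<in> borel_measurable borel" "f \<in> borel_measurable borel"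
    using L2_measurable[OF b] L2_measurable[OF f] by auto
  let ?g = "\<lambda>x. f x * cnj (tensor b P x)"
  have "(\<lambda>(r, \<xi>). ?g (r *\<^sub>R \<xi>)) \<in> borel_measurable (rad \<Otimes>\<^sub>M circ)"
    by (rule measurable_polar_compose) measurable
  hence m: "(\<lambda>r. \<integral>\<xi>. ?g (r *\<^sub>R \<xi>) \<partial>circ) \<in> borel_measurable rad"
    by (rule circ.borel_measurable_lebesgue_integral)
  have "L2_inner lborel f (tensor b P) = (\<integral>r. (\<integral>\<xi>. ?g (r *\<^sub>R \<xi>) \<partial>circ) \<partial>rad)"
    unfolding L2_inner_def by (rule integral_polar[OF L2_integrable_mult[OF f tensor_L2[OF b P B]]])
  also have "\<dots> = (\<integral>r. harmonic_coeff P f r * cnj (b r) \<partial>rad)"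
  proof (rule integral_cong_AE[OF m])
    show "(\<lambda>r. harmonic_coeff P f r * cnj (b r)) \<in> borel_measurable rad"
      using measurable_harmonic_coeff[of f P] by measurable
    show "AE r in rad. (\<integral>\<xi>. ?g (r *\<^sub>R \<xi>) \<partial>circ) = harmonic_coeff P f r * cnj (b r)"
    proof (rule AE_radial_measureI)
      fix r :: real assume r: "r > 0"
      have "(\<integral>\<xi>. ?g (r *\<^sub>R \<xi>) \<partial>circ) = (\<integral>\<xi>. f (r *\<^sub>R \<xi>) * cnj (P \<xi>) * cnj (b r) \<partial>circ)"
        by (intro Bochner_Integration.integral_cong) (auto simp: tensor_polar[OF r])
      thus "(\<integral>\<xi>. ?g (r *\<^sub>R \<xi>) \<partial>circ) = harmonic_coeff P f r * cnj (b r)"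
        by (simp add: harmonic_coeff_def)
    qed
  qed
  finally show ?thesis by (simp add: L2_inner_def)
qed

subsection \<open>Completeness of the circular harmonics\<close>

text \<open>Polynomials in \<open>z\<close> and its conjugate. The choice of monomials matters: on
  the circle of radius \<open>r\<close> the monomial with exponents \<open>p\<close> and
  \<open>q\<close> is \<open>r ^ (p + q)\<close> times a single harmonic, that of order
  \<open>p - q\<close>.\<close>

inductive bihom :: "(real ^ 2 \<Rightarrow> complex) \<Rightarrow> bool" where
  monomial: "bihom (\<lambda>x. a * (cpx x ^ p * cnj (cpx x) ^ q))"
| plus: "bihom f \<Longrightarrow> bihom g \<Longrightarrow> bihom (\<lambda>x. f x + g x)"

lemma bihom_times: "bihom f \<Longrightarrow> bihom g \<Longrightarrow> bihom (\<lambda>x. f x * g x)"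
proof (induction rule: bihom.induct)
  case (monomial a p q)
  from monomial show ?case
  proof (induction rule: bihom.induct)
    case (monomial a' p' q')
    have "(\<lambda>x. a * (cpx x ^ p * cnj (cpx x) ^ q) * (a' * (cpx x ^ p' * cnj (cpx x) ^ q'))) =
        (\<lambda>x. (a * a') * (cpx x ^ (p + p') * cnj (cpx x) ^ (q + q')))"
      by (simp add: fun_eq_iff power_add)
    thus ?case by (metis bihom.monomial)
  qed (simp add: distrib_left bihom.plus)
qed (simp add: distrib_right bihom.plus)

lemma bihom_const: "bihom (\<lambda>x. c)"
  using bihom.monomial[of c 0 0] by simp

lemma bihom_polynomial:
  assumes "polynomial_function f"
  shows "bihom f"
proof -
  have real: "bihom (\<lambda>x. of_real (g x))" if "real_polynomial_function g" for g
    using that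
  proof induction
    case (linear g)
    have lin: "linear g" by (rule bounded_linear.linear[OF linear])
    define A B where "A = g (axis 1 1)" and "B = g (axis 2 1)"
    have g: "g x = x $ 1 * A + x $ 2 * B" for x
      unfolding A_def B_def
      by (rule trans[OF arg_cong[OF vec2_eq[of x], of g]]) (simp add: linear_add[OF lin] linear_scale[OF lin])
    have eq: "(\<lambda>x. of_real (g x)) = (\<lambda>x. (of_real A / 2 - \<i> * of_real B / 2) * (cpx x ^ 1 * cnj (cpx x) ^ 0) +
        (of_real A / 2 + \<i> * of_real B / 2) * (cpx x ^ 0 * cnj (cpx x) ^ 1))"
      unfolding g by (simp add: fun_eq_iff cpx_def complex_eq_iff field_simps)
    show ?case
      unfolding eq by (intro bihom.intros)
  qed (simp_all add: bihom_const bihom.plus bihom_times)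
  have "bihom (\<lambda>x. of_real (Re (f x)) + \<i> * of_real (Im (f x)))"
    using assms unfolding complex_polynomial_function_iff
    by (intro bihom.plus bihom_times[OF bihom_const] real) auto
  thus ?thesis
    by (simp add: complex_eq[symmetric])
qed

lemma continuous_on_bihom: "bihom f \<Longrightarrow> continuous_on S f"
  by (induction rule: bihom.induct) (auto intro!: continuous_intros)

lemma indicator_cball_L2: "(\<lambda>x. indicator (cball 0 \<rho>) x :: complex) \<in> L2 (lborel :: (real ^ 2) measure)"
proof (rule L2I)
  have "integrable lborel (indicator (cball 0 \<rho> :: (real ^ 2) set) :: _ \<Rightarrow> real)"
    using emeasure_lborel_cball_finite[of 0 \<rho>] by (intro integrable_real_indicator) auto
  thus "integrable lborel (\<lambda>x :: real ^ 2. (cmod (indicator (cball 0 \<rho>) x))\<^sup>2)"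
    by (rule Bochner_Integration.integrable_cong[THEN iffD1, rotated 2]) (auto split: split_indicator)
qed (rule borel_measurable_indicator, simp)

text \<open>On every ball \<open>w\<close> is orthogonal to ever larger classes of functions:
  monomials, continuous functions, and bounded measurable ones, among them a truncation of
  \<open>w\<close> itself. The ball makes polynomials square integrable and uniform approximation
  available.\<close>

lemma AE_eq_0_if_coeffs_0:
  assumes w: "w \<in> L2 lborel" and coeff: "\<And>k. AE r in rad. harmonic_coeff (sph k) w r = 0"
  shows "AE x in lborel. w x = 0"
proof -
  have [measurable]: "w \<in> borel_measurable borel" using L2_measurable[OF w] by simp
  define W where "W \<rho> x = indicator (cball 0 \<rho>) x * w x" for \<rho> :: real and x
  have WL2: "W \<rho> \<in> L2 lborel" for \<rho>
    unfolding W_def[abs_def] by (intro L2_indicator w) simp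
  have Wint: "integrable lborel (W \<rho>)" for \<rho>
  proof -
    have "integrable lborel (\<lambda>x. w x * cnj (indicator (cball 0 \<rho>) x))"
      by (rule L2_integrable_mult[OF w indicator_cball_L2])
    also have "(\<lambda>x. w x * cnj (indicator (cball 0 \<rho>) x)) = W \<rho>"
      by (auto simp: W_def fun_eq_iff split: split_indicator)
    finally show ?thesis .
  qed
  have W_times: "integrable lborel (\<lambda>x. W \<rho> x * cnj (F x))" if "continuous_on UNIV F" for \<rho> and F :: "real ^ 2 \<Rightarrow> complex"
  proof -
    have [measurable]: "F \<in> borel_measurable borel"
      by (rule borel_measurable_continuous_onI[OF that])
    have "compact (F ` cball 0 \<rho>)"
      using that by (intro compact_continuous_image continuous_on_subset[OF that]) auto
    then obtain B where B: "\<And>x. x \<in> cball 0 \<rho> \<Longrightarrow> cmod (F x) \<le> B"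
      by (metis compact_imp_bounded bounded_iff imageI)
    show ?thesis
    proof (rule Bochner_Integration.integrable_bound)
      show "integrable lborel (\<lambda>x. of_real B * W \<rho> x)"
        by (intro integrable_mult_right Wint)
      have "norm (W \<rho> x * cnj (F x)) \<le> norm (of_real B * W \<rho> x)" for x
      proof (cases "x \<in> cball 0 \<rho>")
        case True
        thus ?thesis
          using mult_right_mono[OF order_trans[OF B[OF True] abs_ge_self], of "cmod (W \<rho> x)"]
          by (simp add: norm_mult mult.commute)
      qed (simp add: W_def)
      thus "AE x in lborel. norm (W \<rho> x * cnj (F x)) \<le> norm (of_real B * W \<rho> x)" by simp
    qed (use L2_measurable[OF WL2] in measurable)
  qed
  \<comment> \<open>In polar coordinates the inner integral for a monomial is a multiple of the
    coefficient of \<open>w\<close> of order \<open>p - q\<close>, which vanishes for almost every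
    radius.\<close>
  have bihom0: "(\<integral>x. W \<rho> x * cnj (F x) \<partial>lborel) = 0" if "bihom F" for \<rho> F
    using that
  proof (induction rule: bihom.induct)
    case (monomial a p q)
    let ?F = "\<lambda>x. a * (cpx x ^ p * cnj (cpx x) ^ q)"
    have cont: "continuous_on UNIV ?F"
      by (rule continuous_on_bihom[OF bihom.monomial])
    have "(\<integral>x. W \<rho> x * cnj (?F x) \<partial>lborel) = (\<integral>r. (\<integral>\<xi>. W \<rho> (r *\<^sub>R \<xi>) * cnj (?F (r *\<^sub>R \<xi>)) \<partial>circ) \<partial>rad)"
      by (rule integral_polar[OF W_times[OF cont]])
    also have "\<dots> = (\<integral>r. 0 \<partial>rad)"
    proof (rule integral_cong_AE)
      let ?g = "\<lambda>x. W \<rho> x * cnj (?F x)"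
      have [measurable]: "?g \<in> borel_measurable borel"
        using borel_measurable_integrable[OF W_times[OF cont, of \<rho>]] by simp
      have "(\<lambda>(r, \<xi>). ?g (r *\<^sub>R \<xi>)) \<in> borel_measurable (rad \<Otimes>\<^sub>M circ)"
        by (rule measurable_polar_compose) measurable
      thus "(\<lambda>r. \<integral>\<xi>. ?g (r *\<^sub>R \<xi>) \<partial>circ) \<in> borel_measurable rad"
        by (rule circ.borel_measurable_lebesgue_integral)
      show "AE r in rad. (\<integral>\<xi>. ?g (r *\<^sub>R \<xi>) \<partial>circ) = 0"
        using coeff[of "int p - int q"] AE_radial_measure_pos
      proof eventually_elim
        case (elim r)
        have "?g (r *\<^sub>R \<xi>) = cnj a * of_real (r ^ (p + q)) * indicator {..\<rho>} r * (w (r *\<^sub>R \<xi>) * cnj (sph (int p - int q) \<xi>))"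
          if \<xi>: "\<xi> \<in> sphere 0 1" for \<xi>
        proof -
          have "cpx \<xi> ^ p * cnj (cpx \<xi>) ^ q = sph (int p) \<xi> * cnj (sph (int q) \<xi>)"
            by (simp add: sph_def)
          also have "\<dots> = sph (int p - int q) \<xi>"
            by (rule sph_mult_cnj) (use \<xi> in simp)
          finally have F_eq: "?F (r *\<^sub>R \<xi>) = a * of_real (r ^ (p + q)) * sph (int p - int q) \<xi>"
            by (simp add: cpx_scaleR power_mult_distrib power_add mult_ac)
          have ind_eq: "(indicator (cball 0 \<rho>) (r *\<^sub>R \<xi>) :: complex) = indicator {..\<rho>} r"
            using \<xi> elim(2) by (simp add: indicator_def)
          show ?thesis
            unfolding W_def ind_eq F_eq by (simp add: mult_ac)
        qed
        hence "(\<integral>\<xi>. ?g (r *\<^sub>R \<xi>) \<partial>circ) = (\<integral>\<xi>. cnj a * of_real (r ^ (p + q)) * indicator {..\<rho>} r *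
            (w (r *\<^sub>R \<xi>) * cnj (sph (int p - int q) \<xi>)) \<partial>circ)"
          by (intro Bochner_Integration.integral_cong refl) auto
        also have "\<dots> = cnj a * of_real (r ^ (p + q)) * indicator {..\<rho>} r * harmonic_coeff (sph (int p - int q)) w r"
          unfolding harmonic_coeff_def by (rule integral_mult_right_zero)
        also have "\<dots> = 0" using elim(1) by simp
        finally show ?case .
      qed
    qed simp
    finally show ?case by simp
  next
    case (plus f g)
    thus ?case
      by (simp add: distrib_left W_times continuous_on_bihom)
  qed
  \<comment> \<open>Stone-Weierstrass on the ball: replacing \<open>F\<close> by a polynomial
    changes the integral by at most \<open>e\<close> times the integral of
    \<open>cmod (W \<rho> x)\<close>.\<close>
  have cont0: "(\<integral>x. W \<rho> x * cnj (F x) \<partial>lborel) = 0" if F: "continuous_on UNIV F" for \<rho> F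
  proof -
    let ?C = "\<integral>x. cmod (W \<rho> x) \<partial>lborel"
    have bd: "cmod (\<integral>x. W \<rho> x * cnj (F x) \<partial>lborel) \<le> e * ?C" if e: "e > 0" for e
    proof -
      obtain G where G: "polynomial_function G" "\<And>x. x \<in> cball 0 \<rho> \<Longrightarrow> norm (F x - G x) < e"
        using Stone_Weierstrass_polynomial_function[OF compact_cball continuous_on_subset[OF F subset_UNIV] e,
          of 0 \<rho>] by auto
      have bG: "bihom G" by (rule bihom_polynomial[OF G(1)])
      have cG: "continuous_on UNIV G" by (rule continuous_on_bihom[OF bG])
      have int: "integrable lborel (\<lambda>x. W \<rho> x * cnj (F x - G x))"
        by (rule W_times) (intro continuous_intros F cG)
      have "(\<integral>x. W \<rho> x * cnj (F x) \<partial>lborel) = (\<integral>x. W \<rho> x * cnj (F x - G x) \<partial>lborel)"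
        using bihom0[OF bG, of \<rho>] by (simp add: right_diff_distrib W_times F cG)
      also have "cmod \<dots> \<le> (\<integral>x. cmod (W \<rho> x * cnj (F x - G x)) \<partial>lborel)"
        by (rule integral_norm_bound)
      also have "\<dots> \<le> (\<integral>x. e * cmod (W \<rho> x) \<partial>lborel)"
      proof (rule integral_mono)
        show "cmod (W \<rho> x * cnj (F x - G x)) \<le> e * cmod (W \<rho> x)" for x
        proof (cases "x \<in> cball 0 \<rho>")
          case True
          thus ?thesis
            using mult_right_mono[OF less_imp_le[OF G(2)[OF True]], of "cmod (W \<rho> x)"]
            by (simp add: norm_mult mult.commute flip: complex_cnj_diff)
        qed (simp add: W_def)
      qed (intro integrable_norm int integrable_mult_right Wint)+
      finally show ?thesis by simp
    qed
    have "cmod (\<integral>x. W \<rho> x * cnj (F x) \<partial>lborel) \<le> 0 + e" if "e > 0" for e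
    proof -
      have C: "?C \<ge> 0" by (rule Bochner_Integration.integral_nonneg) simp
      have "cmod (\<integral>x. W \<rho> x * cnj (F x) \<partial>lborel) \<le> e / (?C + 1) * ?C"
        by (rule bd) (use C that in \<open>simp add: add_nonneg_pos\<close>)
      also have "\<dots> \<le> e / (?C + 1) * (?C + 1)"
        using C that by (intro mult_left_mono) auto
      also have "\<dots> = e"
        by (rule nonzero_eq_divide_eq[THEN iffD1]) (use C in linarith, rule refl)
      finally show ?thesis by simp
    qed
    hence "cmod (\<integral>x. W \<rho> x * cnj (F x) \<partial>lborel) \<le> 0"
      by (rule field_le_epsilon)
    thus ?thesis by simp
  qed
  \<comment> \<open>One number \<open>B\<close> serves as radius of the ball and as bound on the
    values. As \<open>v\<close> is either \<open>W B\<close> or 0, its pairing with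
    \<open>W B\<close> is its own squared norm.\<close>
  have zero: "AE x in lborel. x \<in> cball 0 B \<longrightarrow> cmod (w x) \<le> B \<longrightarrow> w x = 0" if B: "B \<ge> 0" for B
  proof -
    define v where "v x = (if cmod (W B x) \<le> B then W B x else 0)" for x
    have [measurable]: "W B \<in> borel_measurable borel" "v \<in> borel_measurable borel"
      using L2_measurable[OF WL2] unfolding v_def by auto
    have "v measurable_on UNIV"
      by (subst measurable_on_iff_borel_measurable)
        (auto intro!: measurable_completion simp: lebesgue_on_UNIV_eq)
    then obtain N H where N: "negligible N" and H: "\<And>j. continuous_on UNIV (H j)"
      and lim: "\<And>x. x \<notin> N \<Longrightarrow> (\<lambda>j. H j x) \<longlonglongrightarrow> v x"
      unfolding measurable_on_def by auto
    \<comment> \<open>Projecting the approximating continuous functions onto the ball of radius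
      \<open>B\<close> bounds them uniformly, so that \<open>B * cmod (W B x)\<close> is a
      majorant.\<close>
    let ?cp = "closest_point (cball 0 B :: complex set)"
    have cp: "?cp z \<in> cball 0 B" for z
      using B by (intro closest_point_in_set) auto
    have cont_cp: "continuous_on UNIV ?cp"
      using B by (intro continuous_on_closest_point) auto
    have cont: "continuous_on UNIV (\<lambda>x. ?cp (H j x))" for j
      by (rule continuous_on_compose2[OF cont_cp H]) simp
    have "N \<in> null_sets lebesgue" using N by (simp add: negligible_iff_null_sets)
    hence AE_N: "AE x in lborel. x \<notin> N"
      using AE_not_in AE_completion_iff by blast
    have "(\<lambda>j. \<integral>x. W B x * cnj (?cp (H j x)) \<partial>lborel) \<longlonglongrightarrow> (\<integral>x. W B x * cnj (v x) \<partial>lborel)"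
    proof (rule integral_dominated_convergence[where w = "\<lambda>x. B * cmod (W B x)"])
      show "integrable lborel (\<lambda>x. B * cmod (W B x))"
        by (intro integrable_mult_right integrable_norm Wint)
      show "AE x in lborel. (\<lambda>j. W B x * cnj (?cp (H j x))) \<longlonglongrightarrow> W B x * cnj (v x)"
        using AE_N
      proof eventually_elim
        case (elim x)
        have "(\<lambda>j. ?cp (H j x)) \<longlonglongrightarrow> ?cp (v x)"
          using cont_cp lim[OF elim] by (intro isCont_tendsto_compose[of _ ?cp]) (auto simp: continuous_on_eq_continuous_at)
        also have "?cp (v x) = v x"
          using B by (intro closest_point_self) (simp add: v_def)
        finally show ?case by (intro tendsto_intros)
      qed
      show "AE x in lborel. norm (W B x * cnj (?cp (H j x))) \<le> B * cmod (W B x)" for j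
        using mult_left_mono[of "cmod (?cp (H j x))" B "cmod (W B x)" for x] cp
        by (simp add: norm_mult mult.commute)
      show "(\<lambda>x. W B x * cnj (?cp (H j x))) \<in> borel_measurable lborel" for j
        using borel_measurable_integrable[OF W_times[OF cont]] by simp
    qed measurable
    hence "(\<integral>x. W B x * cnj (v x) \<partial>lborel) = 0"
      using cont0[OF cont] by (simp add: LIMSEQ_const_iff)
    moreover have "W B x * cnj (v x) = of_real ((cmod (v x))\<^sup>2)" for x
      by (simp add: v_def complex_norm_square[symmetric] del: of_real_power)
    ultimately have "of_real (\<integral>x. (cmod (v x))\<^sup>2 \<partial>lborel) = (0 :: complex)"
      by (simp only: integral_complex_of_real)
    hence v0: "(\<integral>x. (cmod (v x))\<^sup>2 \<partial>lborel) = 0" by simp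
    have "integrable lborel (\<lambda>x. (cmod (v x))\<^sup>2)"
    proof (rule Bochner_Integration.integrable_bound[OF L2_integrable[OF WL2[of B]]])
      show "AE x in lborel. norm ((cmod (v x))\<^sup>2) \<le> norm ((cmod (W B x))\<^sup>2)"
        by (auto simp: v_def)
    qed measurable
    hence "AE x in lborel. v x = 0"
      using integral_nonneg_eq_0_iff_AE[of lborel "\<lambda>x. (cmod (v x))\<^sup>2"] v0 by simp
    thus ?thesis
      by eventually_elim (auto simp: v_def W_def)
  qed
  hence "AE x in lborel. \<forall>j::nat. x \<in> cball 0 (real j) \<longrightarrow> cmod (w x) \<le> real j \<longrightarrow> w x = 0"
    by (subst AE_all_countable) simp
  thus ?thesis
  proof eventually_elim
    case (elim x)
    obtain j :: nat where "max (norm x) (cmod (w x)) \<le> real j"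
      using real_arch_simple by blast
    thus ?case using elim by auto
  qed
qed

section \<open>The reproducing kernel\<close>

text \<open>The complement of the essential support is a union of possibly uncountably many open
  sets on each of which \<open>h\<close> vanishes almost everywhere; by Lindelof countably many of
  them suffice, so the union has the same property.\<close>

lemma ess_supp_subset_iff:
  fixes h :: "'a :: second_countable_topology \<Rightarrow> complex"
  assumes "closed S"
  shows "ess_supp M h \<subseteq> S \<longleftrightarrow> (AE x in M. x \<notin> S \<longrightarrow> h x = 0)"
proof
  assume *: "ess_supp M h \<subseteq> S"
  let ?F = "{V. open V \<and> (AE x in M. x \<in> V \<longrightarrow> h x = 0)}"
  obtain F' where F': "F' \<subseteq> ?F" "countable F'" "\<Union>F' = \<Union>?F"
    using Lindelof[of ?F] by auto
  have "AE x in M. \<forall>V\<in>F'. x \<in> V \<longrightarrow> h x = 0"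
    using F' by (subst AE_ball_countable) auto
  thus "AE x in M. x \<notin> S \<longrightarrow> h x = 0"
  proof eventually_elim
    case (elim x)
    thus ?case using * F'(3) unfolding ess_supp_def by blast
  qed
next
  assume "AE x in M. x \<notin> S \<longrightarrow> h x = 0"
  hence "- S \<in> {V. open V \<and> (AE x in M. x \<in> V \<longrightarrow> h x = 0)}"
    using assms by (simp add: open_Compl)
  thus "ess_supp M h \<subseteq> S"
    unfolding ess_supp_def by blast
qed

lemma ess_supp_radial_measure:
  "ess_supp rad h \<subseteq> {0..K} \<longleftrightarrow> (AE k in rad. k > K \<longrightarrow> h k = 0)"
proof -
  have "(AE k in rad. k \<notin> {0..K} \<longrightarrow> h k = 0) \<longleftrightarrow> (AE k in rad. k > K \<longrightarrow> h k = 0)"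
    unfolding AE_radial_measure by (intro AE_cong) auto
  thus ?thesis by (simp add: ess_supp_subset_iff)
qed

lemma has_hankel_transform_cong_left:
  assumes g: "AE r in rad. g r = g' r" "g \<in> borel_measurable borel" "g' \<in> borel_measurable borel"
  shows "has_hankel_transform (real n) g h \<longleftrightarrow> has_hankel_transform (real n) g' h"
proof -
  have "hankel n (cutoff \<rho> g) k = hankel n (cutoff \<rho> g') k" for \<rho> k
    unfolding hankel_def
  proof (rule integral_cong_AE)
    show "AE r in rad. cutoff \<rho> g r * of_real (bessel_nat n (k * r)) = cutoff \<rho> g' r * of_real (bessel_nat n (k * r))"
      using g(1) by eventually_elim (simp add: cutoff_def)
  qed (use g(2,3) in \<open>simp_all add: cutoff_def[abs_def], measurable\<close>)
  moreover have "g \<in> L2 rad \<longleftrightarrow> g' \<in> L2 rad"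
    using L2_cong_AE[of g rad g'] L2_cong_AE[of g' rad g] g
    by (auto simp: eq_commute)
  ultimately show ?thesis
    by (simp add: has_hankel_transform_iff)
qed

text \<open>At the origin an arbitrary unit vector is chosen, so that every point has a direction on
  the circle and harmonics of \<open>dir x\<close> always have modulus 1.\<close>

definition dir :: "real ^ 2 \<Rightarrow> real ^ 2" where
  "dir x = (if x = 0 then axis 1 1 else sgn x)"

lemma norm_dir [simp]: "norm (dir x) = 1"
  by (simp add: dir_def norm_sgn)

lemma norm_scaleR_dir: "norm x *\<^sub>R dir x = x"
  by (simp add: dir_def sgn_div_norm)

lemma measurable_dir [measurable]: "dir \<in> borel_measurable borel"
  unfolding dir_def[abs_def] by measurable

lemma dir_polar: "r > 0 \<Longrightarrow> \<xi> \<in> sphere 0 1 \<Longrightarrow> dir (r *\<^sub>R \<xi>) = \<xi>"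
  by (auto simp: dir_def sgn_scaleR) (auto simp: sgn_div_norm)

text \<open>The inner sum runs over a set, so for \<open>n = 0\<close> the two signs coincide and
  order 0 is counted once.\<close>

lemma sum_symmetric_range:
  fixes f :: "int \<Rightarrow> 'a :: comm_monoid_add"
  shows "(\<Sum>n\<le>N. \<Sum>k\<in>{int n, - int n}. f k) = (\<Sum>k=-int N..int N. f k)"
proof (induction N)
  case (Suc N)
  have "{- int (Suc N)..int (Suc N)} = {- int N..int N} \<union> {int (Suc N), - int (Suc N)}"
    by auto
  hence "(\<Sum>k=-int (Suc N)..int (Suc N). f k) =
      (\<Sum>k=-int N..int N. f k) + (\<Sum>k\<in>{int (Suc N), - int (Suc N)}. f k)"
    by (simp only:) (rule sum.union_disjoint, auto)
  thus ?case
    by (simp only: sum.atMost_Suc Suc.IH)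
qed simp

section \<open>Radial kernels and the candidate for the reproducing kernel\<close>

definition radial_part :: "nat \<Rightarrow> real \<Rightarrow> real \<Rightarrow> real \<Rightarrow> complex" where
  "radial_part n K r = cutoff K (\<lambda>k. of_real (bessel_nat n (k * r)))"

text \<open>The function that represents, on the radial functions with transform supported in
  \<open>[0, K]\<close>, evaluation at the radius \<open>r\<close>; its transform is the Bessel
  kernel restricted to that band.\<close>

definition radial_kernel :: "nat \<Rightarrow> real \<Rightarrow> real \<Rightarrow> real \<Rightarrow> complex" where
  "radial_kernel n K r = hankel n (radial_part n K r)"

lemma radial_part_eq_0: "k > K \<Longrightarrow> radial_part n K r k = 0"
  by (simp add: radial_part_def cutoff_eq_0)

lemma radial_part_L2: "radial_part n K r \<in> L2 rad"
proof (rule L2_bound)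
  show "radial_part n K r \<in> borel_measurable rad"
    unfolding radial_part_def cutoff_def[abs_def] by measurable
  show "integrable rad (\<lambda>k. (cmod (indicator {0..K} k))\<^sup>2)"
    by (rule L2_integrable[OF indicator_L2_radial_measure])
  show "AE k in rad. (cmod (radial_part n K r k))\<^sup>2 \<le> (cmod (indicator {0..K} k))\<^sup>2"
    by (rule AE_radial_measureI) (use abs_bessel_nat_le_1[of n] in
      \<open>auto simp: radial_part_def cutoff_def abs_square_le_1 norm_mult split: split_indicator\<close>)
qed

lemma radial_kernel_L2: "radial_kernel n K r \<in> L2 rad"
  unfolding radial_kernel_def by (rule hankel_isometry(1)[OF radial_part_L2 radial_part_eq_0])

lemma radial_kernel_eq:
  "radial_kernel n K r s = (\<integral>k. of_real (indicator {..K} k * (bessel_nat n (k * r) * bessel_nat n (k * s))) \<partial>rad)"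
  unfolding radial_kernel_def hankel_def radial_part_def cutoff_def
  by (intro Bochner_Integration.integral_cong) (auto simp: mult.commute split: split_indicator)

lemma radial_kernel_real:
  "radial_kernel n K r s = of_real (\<integral>k. indicator {..K} k * (bessel_nat n (k * r) * bessel_nat n (k * s)) \<partial>rad)"
  unfolding radial_kernel_eq by (rule integral_complex_of_real)

lemma hankel_radial_kernel: "has_hankel_transform (real n) (radial_kernel n K r) (radial_part n K r)"
  unfolding radial_kernel_def
  by (rule hankel_inversion[OF has_hankel_transform_bounded_support[OF radial_part_L2 radial_part_eq_0]])

text \<open>By Parseval the pairing takes place between the transforms, where it is the integral of
  \<open>h\<close> against \<open>bessel_nat n (k * r)\<close> over the band: band limiting followed
  by the inverse transform, evaluated at \<open>r\<close>.\<close>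

lemma inner_radial_kernel:
  assumes "has_hankel_transform (real n) g h"
  shows "L2_inner rad g (radial_kernel n K r) = hankel n (cutoff K h) r"
proof -
  have "L2_inner rad g (radial_kernel n K r) = L2_inner rad h (radial_part n K r)"
    by (rule hankel_Parseval[OF assms hankel_radial_kernel, symmetric])
  also have "\<dots> = hankel n (cutoff K h) r"
    unfolding L2_inner_def hankel_def radial_part_def cutoff_def
    by (intro Bochner_Integration.integral_cong) (auto simp: mult_ac split: split_indicator)
  finally show ?thesis .
qed

text \<open>Written with the exponentials \<open>sph j\<close> rather than with a given basis of
  harmonics. The divisor \<open>2 * pi\<close> is their squared norm on the circle.\<close>

definition kernel :: "nat \<Rightarrow> real \<Rightarrow> real ^ 2 \<Rightarrow> real ^ 2 \<Rightarrow> complex" where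
  "kernel N K x y = (\<Sum>j=-int N..int N. sph j (dir x) * cnj (sph j (dir y)) *
     radial_kernel (nat \<bar>j\<bar>) K (norm x) (norm y)) / (2 * pi)"

text \<open>Although \<open>dir\<close> is discontinuous at the origin, the kernel is not: \<open>sph j (dir x) J\<^sub>j(k \<parallel>x\<parallel>)\<close> is
  a homogeneous polynomial in \<open>x\<close> times an entire function of \<open>\<parallel>x\<parallel>\<^sup>2\<close>.\<close>

lemma sph_bessel_nat:
  assumes "k \<ge> 0"
  shows "sph j (dir x) * of_real (bessel_nat (nat \<bar>j\<bar>) (k * norm x)) =
    sph j (k *\<^sub>R x) * of_real (bessel_entire (nat \<bar>j\<bar>) ((norm (k *\<^sub>R x))\<^sup>2))"
proof -
  have "sph j (k *\<^sub>R x) = sph j ((k * norm x) *\<^sub>R dir x)"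
    using norm_scaleR_dir[of x] by (simp flip: scaleR_scaleR)
  thus ?thesis
    using assms by (simp add: sph_scaleR bessel_nat_def mult_ac)
qed

text \<open>Each term is an integral over the band of a product of functions \<open>\<Psi> j\<close>
  that are continuous in the plane. They are bounded by 1 because Bessel functions are, so dominated
  convergence passes continuity to the integral.\<close>

lemma continuous_kernel: "continuous_on UNIV (\<lambda>(x, y). kernel N K x y)"
proof -
  define \<Psi> where "\<Psi> j x = sph j x * of_real (bessel_entire (nat \<bar>j\<bar>) ((norm x)\<^sup>2))" for j and x :: "real ^ 2"
  have cont: "continuous_on UNIV (\<Psi> j)" for j
    unfolding \<Psi>_def[abs_def] by (intro continuous_intros)
  define T where "T j x y k = indicator {..K} k *\<^sub>R (\<Psi> j (k *\<^sub>R x) * cnj (\<Psi> j (k *\<^sub>R y)))" for j x y and k :: real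
  have [measurable]: "T j x y \<in> borel_measurable borel" for j x y
    unfolding T_def[abs_def]
    by (intro borel_measurable_scaleR borel_measurable_indicator borel_measurable_continuous_onI continuous_intros
        continuous_on_compose2[OF cont]) auto
  have \<Psi>_eq: "\<Psi> j (k *\<^sub>R x) = sph j (dir x) * of_real (bessel_nat (nat \<bar>j\<bar>) (k * norm x))" if "k > 0" for j k x
    unfolding \<Psi>_def by (rule sph_bessel_nat[symmetric]) (use that in simp)
  have T: "sph j (dir x) * cnj (sph j (dir y)) * radial_kernel (nat \<bar>j\<bar>) K (norm x) (norm y) =
      integral\<^sup>L rad (T j x y)" for j x y
  proof -
    have "sph j (dir x) * cnj (sph j (dir y)) * radial_kernel (nat \<bar>j\<bar>) K (norm x) (norm y) =
        (\<integral>k. sph j (dir x) * cnj (sph j (dir y)) *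
          of_real (indicator {..K} k * (bessel_nat (nat \<bar>j\<bar>) (k * norm x) * bessel_nat (nat \<bar>j\<bar>) (k * norm y))) \<partial>rad)"
      unfolding radial_kernel_eq by simp
    also have "\<dots> = integral\<^sup>L rad (T j x y)"
    proof (rule integral_cong_AE)
      have "T j x y k = sph j (dir x) * cnj (sph j (dir y)) *
          of_real (indicator {..K} k * (bessel_nat (nat \<bar>j\<bar>) (k * norm x) * bessel_nat (nat \<bar>j\<bar>) (k * norm y)))" if "k > 0" for k
        unfolding T_def \<Psi>_eq[OF that] by (simp add: scaleR_conv_of_real mult_ac)
      thus "AE k in rad. sph j (dir x) * cnj (sph j (dir y)) *
          of_real (indicator {..K} k * (bessel_nat (nat \<bar>j\<bar>) (k * norm x) * bessel_nat (nat \<bar>j\<bar>) (k * norm y))) = T j x y k"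
        by (intro AE_radial_measureI) simp
    qed measurable
    finally show ?thesis .
  qed
  have \<Psi>_bound: "cmod (\<Psi> j (k *\<^sub>R x)) \<le> 1" if "k > 0" for j k x
    unfolding \<Psi>_eq[OF that] using abs_bessel_nat_le_1[of "nat \<bar>j\<bar>" "k * norm x"]
    by (simp add: norm_mult norm_sph)
  have "continuous_on UNIV (\<lambda>(x, y). integral\<^sup>L rad (T j x y))" for j
    unfolding continuous_on_sequentially
  proof (intro ballI allI impI, clarsimp simp: o_def)
    fix X :: "nat \<Rightarrow> (real ^ 2) \<times> (real ^ 2)" and a b
    assume X: "X \<longlonglongrightarrow> (a, b)"
    have "(\<lambda>i. integral\<^sup>L rad (T j (fst (X i)) (snd (X i)))) \<longlonglongrightarrow> integral\<^sup>L rad (T j a b)"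
    proof (rule integral_dominated_convergence[where w = "\<lambda>k. cmod (indicator {0..K} k)"])
      show "integrable rad (\<lambda>k. cmod (indicator {0..K} k))"
        using bounded_support_integrable[OF indicator_L2_radial_measure, of K] by (intro integrable_norm) simp
      have lim: "(\<lambda>i. \<Psi> j (k *\<^sub>R f (X i))) \<longlonglongrightarrow> \<Psi> j (k *\<^sub>R l)" if "(\<lambda>i. f (X i)) \<longlonglongrightarrow> l" for k f l
        by (rule continuous_on_tendsto_compose[OF cont]) (auto intro!: tendsto_intros that)
      show "AE k in rad. (\<lambda>i. T j (fst (X i)) (snd (X i)) k) \<longlonglongrightarrow> T j a b k"
        unfolding T_def using tendsto_fst[OF X] tendsto_snd[OF X]
        by (intro always_eventually allI tendsto_intros lim) auto
      show "AE k in rad. norm (T j (fst (X i)) (snd (X i)) k) \<le> cmod (indicator {0..K} k)" for i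
      proof (rule AE_radial_measureI)
        fix k :: real assume k: "k > 0"
        show "norm (T j (fst (X i)) (snd (X i)) k) \<le> cmod (indicator {0..K} k)"
          unfolding T_def using k mult_mono[OF \<Psi>_bound[OF k] \<Psi>_bound[OF k], of j "snd (X i)" j "fst (X i)"]
          by (auto simp: norm_mult mult.commute split: split_indicator)
      qed
    qed measurable
    thus "(\<lambda>i. case X i of (x, y) \<Rightarrow> integral\<^sup>L rad (T j x y)) \<longlonglongrightarrow> integral\<^sup>L rad (T j a b)"
      by (simp add: case_prod_unfold)
  qed
  hence "continuous_on UNIV (\<lambda>p. (\<Sum>j=-int N..int N. (\<lambda>(x, y). integral\<^sup>L rad (T j x y)) p) / (2 * pi))"
    by (intro continuous_intros) auto
  thus ?thesis
    unfolding kernel_def T by (simp add: case_prod_unfold)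
qed

lemma measurable_kernel [measurable]: "kernel N K x \<in> borel_measurable borel"
proof -
  have "continuous_on UNIV ((\<lambda>(x, y). kernel N K x y) \<circ> (\<lambda>y. (x, y)))"
    by (intro continuous_on_compose continuous_intros continuous_on_subset[OF continuous_kernel]) auto
  hence "continuous_on UNIV (kernel N K x)" by (simp add: o_def)
  thus ?thesis by (rule borel_measurable_continuous_onI)
qed

lemma kernel_diagonal:
  "kernel N K x x = of_real ((\<Sum>j=-int N..int N.
     \<integral>k. indicator {..K} k * (bessel_nat (nat \<bar>j\<bar>) (k * norm x))\<^sup>2 \<partial>rad) / (2 * pi))"
proof -
  have "sph j (dir x) * cnj (sph j (dir x)) = 1" for j
    by (simp add: complex_norm_square[symmetric] norm_sph)
  thus ?thesis
    unfolding kernel_def radial_kernel_real by (simp add: power2_eq_square)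
qed

section \<open>Uniqueness of the reproducing kernel\<close>

lemma orthogonal_projection_unique:
  assumes V: "V \<subseteq> L2 M" and f: "f \<in> L2 M"
    and p: "is_orthogonal_projection M V f p" and p': "is_orthogonal_projection M V f p'"
  shows "AE x in M. p x = p' x"
proof -
  have L: "p \<in> L2 M" "p' \<in> L2 M" and pV: "p \<in> V" "p' \<in> V"
    using p p' V by (auto simp: is_orthogonal_projection_def)
  let ?d = "\<lambda>x. p x - p' x"
  have eq: "?d = (\<lambda>x. (f x - p' x) - (f x - p x))" by auto
  have "L2_inner M ?d v = 0" if "v \<in> V" for v
    unfolding eq using that p p' V L f
    by (subst L2_inner_diff_left) (auto simp: is_orthogonal_projection_def intro!: L2_diff)
  hence "L2_inner M ?d ?d = 0"
    using pV L by (subst L2_inner_diff_right) (auto intro: L2_diff)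
  hence "L2_norm M ?d = 0" by (simp add: L2_inner_self)
  from L2_norm_eq_0[OF L2_diff[OF L] this] show ?thesis by simp
qed

text \<open>The set of disagreement is open, and a null open set is empty.\<close>

lemma AE_lborel_continuous_eq:
  fixes f g :: "'a :: euclidean_space \<Rightarrow> 'b :: t2_space"
  assumes "continuous_on UNIV f" "continuous_on UNIV g" "AE x in lborel. f x = g x"
  shows "f = g"
proof (rule ccontr)
  assume "f \<noteq> g"
  have op: "open {x. f x \<noteq> g x}"
    by (rule open_Collect_neq[OF assms(1,2)])
  have "{x. f x \<noteq> g x} \<in> null_sets lborel"
    using assms(3) op by (subst (asm) AE_iff_null) auto
  hence "negligible {x. f x \<noteq> g x}"
    by (simp add: negligible_iff_null_sets null_sets_completionI)
  hence "{x. f x \<noteq> g x} = {}"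
    using op open_not_negligible by blast
  thus False using \<open>f \<noteq> g\<close> by auto
qed

text \<open>Fix \<open>x0\<close> and project the restriction of \<open>cnj (d x0 y)\<close> to a
  box. The two kernels give projections that agree only for almost every \<open>x\<close>, but their
  difference is continuous in \<open>x\<close>, so it vanishes at \<open>x = x0\<close> too. There
  it is the integral of the squared modulus of \<open>d x0\<close> over the box.\<close>

lemma reproducing_kernel_unique:
  fixes k k' :: "'a :: euclidean_space \<Rightarrow> 'a \<Rightarrow> complex"
  assumes V: "V \<subseteq> L2 lborel" and k: "is_reproducing_kernel V k" and k': "is_reproducing_kernel V k'"
  shows "k = k'"
proof -
  define d where "d x y = cnj (k x y - k' x y)" for x y
  have cont: "continuous_on UNIV (\<lambda>(x, y). d x y)"
    using k k' unfolding d_def is_reproducing_kernel_def case_prod_unfold by (auto intro!: continuous_intros)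
  have cont_d: "continuous_on UNIV (d x)" for x
  proof -
    have "continuous_on UNIV ((\<lambda>(x, y). d x y) \<circ> (\<lambda>y. (x, y)))"
      by (intro continuous_on_compose continuous_intros continuous_on_subset[OF cont]) auto
    thus ?thesis by (simp add: o_def)
  qed
  have zero: "AE y in lborel. y \<in> cbox a b \<longrightarrow> d x0 y = 0" for a b x0
  proof -
    let ?f = "\<lambda>y. indicator (cbox a b) y *\<^sub>R cnj (d x0 y)"
    have int_cbox: "integrable lborel (\<lambda>y. indicator (cbox a b) y *\<^sub>R g y)"
      if "continuous_on UNIV g" for g :: "'a \<Rightarrow> 'c :: {banach, second_countable_topology}"
      by (rule borel_integrable_compact) (auto intro: continuous_on_subset[OF that])
    have cont_sq: "continuous_on UNIV (\<lambda>y. (cmod (d x0 y))\<^sup>2)"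
      by (intro continuous_intros cont_d)
    have f: "?f \<in> L2 lborel"
    proof (rule L2I)
      show "integrable lborel (\<lambda>y. (cmod (?f y))\<^sup>2)"
        using int_cbox[OF cont_sq]
        by (rule Bochner_Integration.integrable_cong[THEN iffD1, rotated 2]) (auto split: split_indicator)
      have "continuous_on UNIV (\<lambda>y. cnj (d x0 y))"
        by (intro continuous_intros cont_d)
      thus "?f \<in> borel_measurable lborel"
        using borel_measurable_integrable[OF int_cbox] by blast
    qed
    have "AE x in lborel. (\<integral>y. ?f y * cnj (k x y) \<partial>lborel) = (\<integral>y. ?f y * cnj (k' x y) \<partial>lborel)"
      by (rule orthogonal_projection_unique[OF V f]) (use k k' f in \<open>auto simp: is_reproducing_kernel_def\<close>)
    moreover have int: "integrable lborel (\<lambda>y. ?f y * cnj (k x y))" "integrable lborel (\<lambda>y. ?f y * cnj (k' x y))" for x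
      using k k' f by (auto simp: is_reproducing_kernel_def)
    let ?D = "\<lambda>x y. cnj (d x0 y) * d x y"
    have cont_D: "continuous_on UNIV (\<lambda>(x, y). ?D x y)"
    proof -
      have "continuous_on UNIV (\<lambda>p. cnj (d x0 (snd p)) * (\<lambda>(x, y). d x y) p)"
        by (intro continuous_intros cont continuous_on_compose2[OF cont_d]) auto
      thus ?thesis by (simp add: case_prod_unfold)
    qed
    have diff: "(\<integral>y. ?f y * cnj (k x y) \<partial>lborel) - (\<integral>y. ?f y * cnj (k' x y) \<partial>lborel) =
        (\<integral>y. indicator (cbox a b) y *\<^sub>R ?D x y \<partial>lborel)" for x
    proof -
      have "(\<integral>y. ?f y * cnj (k x y) \<partial>lborel) - (\<integral>y. ?f y * cnj (k' x y) \<partial>lborel) =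
          (\<integral>y. ?f y * cnj (k x y) - ?f y * cnj (k' x y) \<partial>lborel)"
        by (rule Bochner_Integration.integral_diff[symmetric]) (rule int)+
      also have "\<dots> = (\<integral>y. indicator (cbox a b) y *\<^sub>R ?D x y \<partial>lborel)"
        by (intro Bochner_Integration.integral_cong) (auto simp: d_def algebra_simps split: split_indicator)
      finally show ?thesis .
    qed
    \<comment> \<open>The gauge integral over the box is used because continuity in the parameter is
      then immediate from joint continuity.\<close>
    have HK: "(\<integral>y. indicator (cbox a b) y *\<^sub>R ?D x y \<partial>lborel) = integral (cbox a b) (?D x)" for x
    proof -
      have "continuous_on UNIV (?D x)"
        by (intro continuous_intros cont_d)
      hence "set_integrable lborel (cbox a b) (?D x)"
        unfolding set_integrable_def by (rule int_cbox)
      from set_borel_integral_eq_integral(2)[OF this] show ?thesis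
        by (simp add: set_lebesgue_integral_def)
    qed
    ultimately have "AE x in lborel. integral (cbox a b) (?D x) = 0"
      by (auto elim!: eventually_mono simp flip: HK diff)
    moreover have "continuous_on UNIV (\<lambda>x. integral (cbox a b) (?D x))"
      by (rule integral_continuous_on_param) (rule continuous_on_subset[OF cont_D], simp)
    ultimately have "(\<lambda>x. integral (cbox a b) (?D x)) = (\<lambda>x. 0)"
      by (intro AE_lborel_continuous_eq) auto
    hence "(\<integral>y. indicator (cbox a b) y *\<^sub>R ?D x0 y \<partial>lborel) = 0"
      unfolding HK by (rule fun_cong)
    also have "(\<lambda>y. indicator (cbox a b) y *\<^sub>R ?D x0 y) = (\<lambda>y. complex_of_real (indicator (cbox a b) y *\<^sub>R (cmod (d x0 y))\<^sup>2))"
      by (auto simp: fun_eq_iff complex_norm_square[symmetric] mult.commute[of "cnj _"] split: split_indicator simp del: of_real_power)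
    finally have "(\<integral>y. indicator (cbox a b) y *\<^sub>R (cmod (d x0 y))\<^sup>2 \<partial>lborel) = 0"
      unfolding integral_complex_of_real by simp
    hence "AE y in lborel. indicator (cbox a b) y *\<^sub>R (cmod (d x0 y))\<^sup>2 = 0"
      using integral_nonneg_eq_0_iff_AE[OF int_cbox[OF cont_sq]] by simp
    thus ?thesis by eventually_elim (auto split: split_indicator)
  qed
  have "d x y = 0" for x y
  proof -
    have "AE y in lborel. \<forall>i::nat. y \<in> cbox (- (real i *\<^sub>R One)) (real i *\<^sub>R One) \<longrightarrow> d x y = 0"
      by (subst AE_all_countable) (intro allI zero)
    hence "AE y in lborel. d x y = 0"
    proof eventually_elim
      case (elim y)
      have "y \<in> (\<Union>i::nat. box (- (real i *\<^sub>R One)) (real i *\<^sub>R One))"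
        by (simp only: UN_box_eq_UNIV UNIV_I)
      thus ?case using elim box_subset_cbox by blast
    qed
    from AE_lborel_continuous_eq[OF cont_d continuous_on_const this] show ?thesis by (rule fun_cong)
  qed
  thus ?thesis by (auto simp: d_def fun_eq_iff)
qed

section \<open>Arbitrary orthonormal bases of the circular harmonics\<close>

locale harmonic_basis =
  fixes M :: "nat \<Rightarrow> nat" and Y :: "nat \<Rightarrow> nat \<Rightarrow> real ^ 2 \<Rightarrow> complex"
  assumes onb: "is_harmonic_onb n (M n) (Y n)"
begin

definition acoeff :: "nat \<Rightarrow> nat \<Rightarrow> int \<Rightarrow> complex" where
  "acoeff n m = (SOME a. \<forall>\<xi>\<in>sphere 0 1. Y n m \<xi> = (\<Sum>k\<in>{int n, - int n}. a k * sph k \<xi>))"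

text \<open>An extension of \<open>Y n m\<close> from the circle to a continuous function.\<close>

definition P :: "nat \<Rightarrow> nat \<Rightarrow> real ^ 2 \<Rightarrow> complex" where
  "P n m x = (\<Sum>k\<in>{int n, - int n}. acoeff n m k * sph k x)"

lemma Y_eq_P:
  assumes "m \<in> {1..M n}" "\<xi> \<in> sphere 0 1"
  shows "Y n m \<xi> = P n m \<xi>"
proof -
  have "Y n m \<in> spherical_harmonics n"
    using onb assms(1) by (auto simp: is_harmonic_onb_def)
  from someI_ex[OF spherical_harmonics_repr[OF this]] show ?thesis
    using assms(2) unfolding P_def acoeff_def by blast
qed

lemma measurable_P [measurable]: "P n m \<in> borel_measurable borel"
  unfolding P_def[abs_def] by measurable

definition Pbound :: "nat \<Rightarrow> nat \<Rightarrow> real" where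
  "Pbound n m = (\<Sum>k\<in>{int n, - int n}. cmod (acoeff n m k))"

lemma P_bound: "\<xi> \<in> sphere 0 1 \<Longrightarrow> cmod (P n m \<xi>) \<le> Pbound n m"
  unfolding P_def Pbound_def by (rule norm_sum[THEN order_trans]) (simp add: norm_mult norm_sph)

lemma sph_circ_L2: "sph k \<in> L2 circ"
  by (rule circ_bounded_L2[where B = 1]) (auto intro: measurable_sphere_borel simp: norm_sph)

lemma P_L2: "P n m \<in> L2 circ"
  by (rule circ_bounded_L2[OF measurable_sphere_borel[OF measurable_P] P_bound])

lemma P_inner_sph:
  assumes k: "k \<in> {int n, - int n}"
  shows "L2_inner circ (P n m) (sph k) = 2 * pi * acoeff n m k"
proof -
  have "L2_inner circ (P n m) (sph k) = (\<Sum>j\<in>{int n, - int n}. acoeff n m j * L2_inner circ (sph j) (sph k))"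
    unfolding P_def[abs_def]
    by (subst L2_inner_sum_left)
      (auto intro!: L2_cmult sph_circ_L2 simp: L2_inner_cmult[where b = 1, simplified])
  also have "\<dots> = (\<Sum>j\<in>{int n, - int n}. if j = k then 2 * pi * acoeff n m j else 0)"
    by (intro sum.cong refl) (auto simp: sph_inner)
  also have "\<dots> = 2 * pi * acoeff n m k"
    using k by (subst sum.delta) auto
  finally show ?thesis .
qed

text \<open>Within one degree this is the assumed orthonormality; between different degrees it
  follows from the orthogonality of the exponentials.\<close>

lemma P_inner:
  assumes "m \<in> {1..M n}" "m' \<in> {1..M n'}"
  shows "L2_inner circ (P n m) (P n' m') = (if n = n' \<and> m = m' then 1 else 0)"
proof (cases "n = n'")
  case True
  have "L2_inner circ (P n m) (P n' m') = L2_inner circ (Y n m) (Y n m')"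
    unfolding L2_inner_def using assms True
    by (intro Bochner_Integration.integral_cong) (auto simp: Y_eq_P)
  thus ?thesis
    using onb[of n] assms True by (auto simp: is_harmonic_onb_def)
next
  case False
  have "L2_inner circ (P n m) (P n' m') =
      (\<Sum>k\<in>{int n', - int n'}. cnj (acoeff n' m' k) * L2_inner circ (P n m) (sph k))"
    unfolding P_def[of n', abs_def]
    by (subst L2_inner_sum_right)
      (auto intro!: L2_cmult sph_circ_L2 P_L2 simp: L2_inner_cmult[where a = 1, simplified])
  also have "\<dots> = 0"
  proof (intro sum.neutral ballI)
    fix k assume k: "k \<in> {int n', - int n'}"
    have "L2_inner circ (P n m) (sph k) =
        (\<Sum>j\<in>{int n, - int n}. acoeff n m j * L2_inner circ (sph j) (sph k))"
      unfolding P_def[abs_def]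
      by (subst L2_inner_sum_left)
        (auto intro!: L2_cmult sph_circ_L2 simp: L2_inner_cmult[where b = 1, simplified])
    also have "\<dots> = 0"
      using k False by (intro sum.neutral ballI) (auto simp: sph_inner)
    finally show "cnj (acoeff n' m' k) * L2_inner circ (P n m) (sph k) = 0" by simp
  qed
  finally show ?thesis using False by simp
qed

text \<open>The basis spans, so some coefficients exist; pairing with \<open>P n m\<close>
  identifies them. Up to the factor \<open>2 * pi\<close> the change of basis is inverted by
  conjugate transposition.\<close>

lemma sph_eq_sum_P:
  assumes "k \<in> {int n, - int n}" "\<xi> \<in> sphere 0 1"
  shows "sph k \<xi> = (\<Sum>m=1..M n. 2 * pi * cnj (acoeff n m k) * P n m \<xi>)"
proof -
  have "nat \<bar>k\<bar> = n" using assms(1) by auto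
  hence "sph k \<in> spherical_harmonics n"
    using sph_spherical_harmonic[of k] by simp
  then obtain b where "\<forall>\<xi>\<in>sphere 0 1. sph k \<xi> = (\<Sum>m=1..M n. b m * Y n m \<xi>)"
    using onb[of n] unfolding is_harmonic_onb_def by blast
  hence b: "sph k \<xi> = (\<Sum>m=1..M n. b m * P n m \<xi>)" if "\<xi> \<in> sphere 0 1" for \<xi>
    using that by (auto simp: Y_eq_P intro!: sum.cong)
  have "b m = 2 * pi * cnj (acoeff n m k)" if m: "m \<in> {1..M n}" for m
  proof -
    have "L2_inner circ (sph k) (P n m) = L2_inner circ (\<lambda>\<xi>. \<Sum>m=1..M n. b m * P n m \<xi>) (P n m)"
      unfolding L2_inner_def by (intro Bochner_Integration.integral_cong) (auto simp: b)
    also have "\<dots> = (\<Sum>m'=1..M n. b m' * L2_inner circ (P n m') (P n m))"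
      by (subst L2_inner_sum_left) (auto intro!: L2_cmult P_L2 simp: L2_inner_cmult[where b = 1, simplified])
    also have "\<dots> = (\<Sum>m'=1..M n. if m' = m then b m' else 0)"
      using m by (intro sum.cong refl) (auto simp: P_inner)
    also have "\<dots> = b m" using m by simp
    finally show ?thesis
      using P_inner_sph[OF assms(1), of m] L2_inner_commute[of circ "sph k" "P n m"] by simp
  qed
  thus ?thesis
    unfolding b[OF assms(2)] by (intro sum.cong refl) simp
qed

text \<open>In particular the left-hand side does not depend on the basis.\<close>

lemma addition_theorem:
  assumes \<xi>: "\<xi> \<in> sphere 0 1" and \<eta>: "\<eta> \<in> sphere 0 1"
  shows "(\<Sum>m=1..M n. P n m \<xi> * cnj (P n m \<eta>)) =
    (\<Sum>k\<in>{int n, - int n}. sph k \<xi> * cnj (sph k \<eta>)) / (2 * pi)"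
proof -
  have "(\<Sum>m=1..M n. P n m \<xi> * cnj (P n m \<eta>)) =
      (\<Sum>m=1..M n. \<Sum>k\<in>{int n, - int n}. acoeff n m k * sph k \<xi> * cnj (P n m \<eta>))"
    unfolding P_def[of n _ \<xi>] by (simp only: sum_distrib_right)
  also have "\<dots> = (\<Sum>k\<in>{int n, - int n}. \<Sum>m=1..M n. acoeff n m k * sph k \<xi> * cnj (P n m \<eta>))"
    by (rule sum.swap)
  also have "\<dots> = (\<Sum>k\<in>{int n, - int n}. sph k \<xi> * cnj (sph k \<eta>) / (2 * pi))"
  proof (intro sum.cong refl)
    fix k assume k: "k \<in> {int n, - int n}"
    have "cnj (sph k \<eta>) = (\<Sum>m=1..M n. 2 * pi * (acoeff n m k * cnj (P n m \<eta>)))"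
      unfolding sph_eq_sum_P[OF k \<eta>] by (simp add: mult.assoc)
    hence "cnj (sph k \<eta>) = 2 * pi * (\<Sum>m=1..M n. acoeff n m k * cnj (P n m \<eta>))"
      by (simp only: sum_distrib_left)
    moreover have "(\<Sum>m=1..M n. acoeff n m k * sph k \<xi> * cnj (P n m \<eta>)) =
        sph k \<xi> * (\<Sum>m=1..M n. acoeff n m k * cnj (P n m \<eta>))"
      by (simp add: sum_distrib_left mult_ac)
    ultimately show "(\<Sum>m=1..M n. acoeff n m k * sph k \<xi> * cnj (P n m \<eta>)) = sph k \<xi> * cnj (sph k \<eta>) / (2 * pi)"
      by simp
  qed
  finally show ?thesis by (simp only: sum_divide_distrib)
qed

abbreviation coeff :: "(real ^ 2 \<Rightarrow> complex) \<Rightarrow> nat \<Rightarrow> nat \<Rightarrow> real \<Rightarrow> complex" where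
  "coeff f n m \<equiv> harmonic_coeff (P n m) f"

lemma coeff_Y: "m \<in> {1..M n} \<Longrightarrow> harmonic_coeff (Y n m) f r = coeff f n m r"
  by (rule harmonic_coeff_cong) (rule Y_eq_P)

lemma coeff_L2: "f \<in> L2 lborel \<Longrightarrow> coeff f n m \<in> L2 rad"
  by (rule harmonic_coeff_L2[OF _ measurable_P P_bound])

lemma tensor_P_L2: "b \<in> L2 rad \<Longrightarrow> tensor b (P n m) \<in> L2 lborel"
  by (rule tensor_L2[OF _ measurable_P P_bound])

lemma inner_tensor_P:
  "f \<in> L2 lborel \<Longrightarrow> b \<in> L2 rad \<Longrightarrow>
    L2_inner lborel f (tensor b (P n m)) = L2_inner rad (coeff f n m) b"
  by (rule tensor_inner[OF _ _ measurable_P P_bound])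

text \<open>In dimension 2 the exponent \<open>(d - 2) / 2\<close> is 0, so the Hankel order is the
  degree and the radial weight \<open>r powr 0\<close> is 1 for \<open>r > 0\<close>. The basis
  functions are replaced by their measurable extensions \<open>P\<close>.\<close>

lemma fourier_bessel_space_iff:
  "f \<in> fourier_bessel_space M Y N K \<longleftrightarrow> f \<in> L2 lborel \<and>
    (\<forall>n>N. \<forall>m\<in>{1..M n}. AE r in rad. coeff f n m r = 0) \<and>
    (\<forall>n\<le>N. \<forall>m\<in>{1..M n}. \<exists>h. has_hankel_transform (real n) (coeff f n m) h \<and>
       (AE k in rad. k > K \<longrightarrow> h k = 0))"
proof -
  have "has_hankel_transform (real n + (real DIM(real ^ 2) - 2) / 2)
      (\<lambda>r. of_real (r powr ((real DIM(real ^ 2) - 2) / 2)) * harmonic_coeff (Y n m) f r) h \<longleftrightarrow>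
      has_hankel_transform (real n) (coeff f n m) h"
    if f: "f \<in> L2 lborel" and m: "m \<in> {1..M n}" for n m h
  proof -
    have [measurable]: "coeff f n m \<in> borel_measurable borel"
      using L2_measurable[OF coeff_L2[OF f]] by simp
    have "has_hankel_transform (real n) (\<lambda>r. of_real (r powr 0) * coeff f n m r) h \<longleftrightarrow>
        has_hankel_transform (real n) (coeff f n m) h"
    proof (rule has_hankel_transform_cong_left)
      show "AE r in rad. of_real (r powr 0) * coeff f n m r = coeff f n m r"
        by (rule AE_radial_measureI) simp
    qed measurable
    thus ?thesis
      using m by (simp add: coeff_Y)
  qed
  thus ?thesis
    unfolding fourier_bessel_space_def ess_supp_radial_measure
    by (auto simp: coeff_Y)
qed

abbreviation I :: "nat \<Rightarrow> (nat \<times> nat) set" where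
  "I N \<equiv> (SIGMA n:{..N}. {1..M n})"

text \<open>The difference of the two sides has vanishing coefficients along all
  \<open>P n m\<close>, hence along every \<open>sph k\<close>, and completeness of the circular
  harmonics applies.\<close>

lemma harmonic_expansion:
  assumes v: "v \<in> L2 lborel"
    and high: "\<And>n m. n > N \<Longrightarrow> m \<in> {1..M n} \<Longrightarrow> AE r in rad. coeff v n m r = 0"
  shows "AE x in lborel. v x = (\<Sum>(n, m)\<in>I N. tensor (coeff v n m) (P n m) x)"
proof -
  define S where "S x = (\<Sum>(n, m)\<in>I N. tensor (coeff v n m) (P n m) x)" for x
  have S: "S \<in> L2 lborel"
    unfolding S_def[abs_def] case_prod_unfold by (intro L2_sum tensor_P_L2 coeff_L2 v)
  define w where "w x = v x - S x" for x
  have w: "w \<in> L2 lborel"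
    unfolding w_def[abs_def] by (intro L2_diff v S)
  have coeff_w: "AE r in rad. coeff w n m r = 0" if m: "m \<in> {1..M n}" for n m
  proof -
    have "AE r in rad. n > N \<longrightarrow> coeff v n m r = 0"
      using high[OF _ m] by (cases "n > N") auto
    with AE_slice_L2[OF v] AE_slice_L2[OF S] AE_radial_measure_pos show ?thesis
    proof eventually_elim
      case (elim r)
      have S_slice: "L2_inner circ (\<lambda>\<xi>. S (r *\<^sub>R \<xi>)) (P n m) =
          (\<Sum>(n', m')\<in>I N. coeff v n' m' r * L2_inner circ (P n' m') (P n m))"
      proof -
        have "L2_inner circ (\<lambda>\<xi>. S (r *\<^sub>R \<xi>)) (P n m) =
            L2_inner circ (\<lambda>\<xi>. \<Sum>p\<in>I N. coeff v (fst p) (snd p) r * P (fst p) (snd p) \<xi>) (P n m)"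
          unfolding L2_inner_def S_def
          by (intro Bochner_Integration.integral_cong) (auto simp: tensor_polar[OF elim(3)] case_prod_unfold)
        also have "\<dots> = (\<Sum>p\<in>I N. coeff v (fst p) (snd p) r * L2_inner circ (P (fst p) (snd p)) (P n m))"
          by (subst L2_inner_sum_left) (auto intro!: L2_cmult P_L2 simp: L2_inner_cmult[where b = 1, simplified])
        finally show ?thesis by (simp add: case_prod_unfold)
      qed
      also have "\<dots> = (\<Sum>p\<in>I N. if p = (n, m) then coeff v n m r else 0)"
        by (intro sum.cong refl) (use m in \<open>auto simp: P_inner split: if_splits\<close>)
      also have "\<dots> = (if (n, m) \<in> I N then coeff v n m r else 0)"
        by simp
      also have "\<dots> = coeff v n m r"
        using elim(4) m by auto
      finally have "L2_inner circ (\<lambda>\<xi>. S (r *\<^sub>R \<xi>)) (P n m) = coeff v n m r" .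
      moreover have "coeff w n m r = L2_inner circ (\<lambda>\<xi>. v (r *\<^sub>R \<xi>)) (P n m) - L2_inner circ (\<lambda>\<xi>. S (r *\<^sub>R \<xi>)) (P n m)"
        unfolding L2_inner_diff_left[OF elim(1,2) P_L2, symmetric]
        by (simp add: w_def harmonic_coeff_def L2_inner_def)
      ultimately show ?case
        by (simp add: harmonic_coeff_def L2_inner_def)
    qed
  qed
  have "AE x in lborel. w x = 0"
  proof (rule AE_eq_0_if_coeffs_0[OF w])
    fix k :: int
    define n where "n = nat \<bar>k\<bar>"
    have k: "k \<in> {int n, - int n}" by (auto simp: n_def)
    have "AE r in rad. \<forall>m\<in>{1..M n}. coeff w n m r = 0"
      using coeff_w by (subst AE_ball_countable) auto
    with AE_slice_L2[OF w] show "AE r in rad. harmonic_coeff (sph k) w r = 0"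
    proof eventually_elim
      case (elim r)
      have "harmonic_coeff (sph k) w r = L2_inner circ (\<lambda>\<xi>. w (r *\<^sub>R \<xi>)) (\<lambda>\<xi>. \<Sum>m=1..M n. 2 * pi * cnj (acoeff n m k) * P n m \<xi>)"
        unfolding harmonic_coeff_def L2_inner_def
        by (intro Bochner_Integration.integral_cong) (auto simp: sph_eq_sum_P[OF k])
      also have "\<dots> = (\<Sum>m=1..M n. L2_inner circ (\<lambda>\<xi>. w (r *\<^sub>R \<xi>)) (\<lambda>\<xi>. 2 * pi * cnj (acoeff n m k) * P n m \<xi>))"
        by (rule L2_inner_sum_right[OF _ _ elim(1)]) (auto intro!: L2_cmult P_L2)
      also have "\<dots> = (\<Sum>m=1..M n. cnj (2 * pi * cnj (acoeff n m k)) * coeff w n m r)"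
        by (simp only: L2_inner_cmult[where a = 1, simplified] harmonic_coeff_def L2_inner_def)
      also have "\<dots> = 0" using elim(2) by (intro sum.neutral) auto
      finally show ?case .
    qed
  qed
  thus ?thesis by eventually_elim (simp add: w_def S_def)
qed

section \<open>The reproducing property\<close>

definition kernel_slice :: "nat \<Rightarrow> real \<Rightarrow> real ^ 2 \<Rightarrow> real ^ 2 \<Rightarrow> complex" where
  "kernel_slice N K x y = (\<Sum>(n, m)\<in>I N. cnj (P n m (dir x)) * tensor (radial_kernel n K (norm x)) (P n m) y)"

text \<open>The addition theorem, degree by degree, passes from exponentials to the given basis. The
  origin is excluded because \<open>dir\<close> and \<open>sgn\<close> differ there. The basis form
  is a finite sum of tensors in \<open>y\<close>, to which the adjointness of coefficients and
  tensors applies.\<close>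

lemma kernel_eq_slice:
  assumes "y \<noteq> 0"
  shows "kernel N K x y = kernel_slice N K x y"
proof -
  have dir: "dir y = sgn y" using assms by (simp add: dir_def)
  have sphere: "dir x \<in> sphere 0 1" "sgn y \<in> sphere 0 1"
    using assms by (auto simp: norm_sgn)
  have *: "(\<Sum>k\<in>{int n, - int n}. sph k (dir x) * cnj (sph k (sgn y))) / (2 * pi) =
      (\<Sum>m=1..M n. cnj (P n m (dir x)) * P n m (sgn y))" for n
  proof -
    \<comment> \<open>Conjugation exchanges the orders \<open>k\<close> and \<open>- k\<close>, so
      the sum over both signs is symmetric in its two arguments.\<close>
    have "(\<Sum>k\<in>{int n, - int n}. sph k (dir x) * cnj (sph k (sgn y))) =
        (\<Sum>k\<in>{int n, - int n}. sph k (sgn y) * cnj (sph k (dir x)))"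
      by (cases "n = 0") (auto simp: cnj_sph)
    thus ?thesis
      using addition_theorem[OF sphere(2,1), of n] by (simp only: mult.commute[of "cnj (P n _ _)"])
  qed
  have "kernel N K x y = (\<Sum>n\<le>N. \<Sum>k\<in>{int n, - int n}. sph k (dir x) * cnj (sph k (sgn y)) *
      radial_kernel (nat \<bar>k\<bar>) K (norm x) (norm y)) / (2 * pi)"
    unfolding kernel_def dir sum_symmetric_range[symmetric] ..
  also have "\<dots> = (\<Sum>n\<le>N. (\<Sum>k\<in>{int n, - int n}. sph k (dir x) * cnj (sph k (sgn y))) / (2 * pi) *
      radial_kernel n K (norm x) (norm y))"
    unfolding sum_divide_distrib[of _ "{..N}"]
  proof (intro sum.cong refl)
    fix n
    have "(\<Sum>k\<in>{int n, - int n}. sph k (dir x) * cnj (sph k (sgn y)) * radial_kernel (nat \<bar>k\<bar>) K (norm x) (norm y)) =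
        (\<Sum>k\<in>{int n, - int n}. sph k (dir x) * cnj (sph k (sgn y)) * radial_kernel n K (norm x) (norm y))"
      by (intro sum.cong refl) auto
    thus "(\<Sum>k\<in>{int n, - int n}. sph k (dir x) * cnj (sph k (sgn y)) * radial_kernel (nat \<bar>k\<bar>) K (norm x) (norm y)) / (2 * pi) =
        (\<Sum>k\<in>{int n, - int n}. sph k (dir x) * cnj (sph k (sgn y))) / (2 * pi) * radial_kernel n K (norm x) (norm y)"
      by (simp only: sum_distrib_right[symmetric]) simp
  qed
  also have "\<dots> = (\<Sum>n\<le>N. \<Sum>m=1..M n. cnj (P n m (dir x)) * tensor (radial_kernel n K (norm x)) (P n m) y)"
    unfolding * tensor_def sum_distrib_right by (intro sum.cong refl) (simp add: mult_ac)
  also have "\<dots> = kernel_slice N K x y"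
    unfolding kernel_slice_def by (subst sum.Sigma) auto
  finally show ?thesis .
qed

lemma kernel_AE_eq: "AE y in lborel. kernel N K x y = kernel_slice N K x y"
  using AE_lborel_singleton[of 0] by eventually_elim (rule kernel_eq_slice)

lemma kernel_slice_L2: "kernel_slice N K x \<in> L2 lborel"
  unfolding kernel_slice_def[abs_def] case_prod_unfold
  by (intro L2_sum L2_cmult tensor_P_L2 radial_kernel_L2)

lemma kernel_L2: "kernel N K x \<in> L2 lborel"
  by (rule L2_cong_AE[OF kernel_slice_L2]) (use kernel_AE_eq[of N K x] in \<open>auto simp: eq_commute\<close>)

text \<open>Pairing \<open>f\<close> with one tensor of the kernel is a radial pairing of its
  coefficient with \<open>radial_kernel\<close>, which was computed through the Hankel
  transform.\<close>

lemma projection_eq: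
  assumes f: "f \<in> L2 lborel"
    and h: "\<And>n m. has_hankel_transform (real n) (coeff f n m) (h n m)"
  shows "(\<integral>y. f y * cnj (kernel N K x y) \<partial>lborel) =
    (\<Sum>(n, m)\<in>I N. P n m (dir x) * hankel n (cutoff K (h n m)) (norm x))"
proof -
  have "(\<integral>y. f y * cnj (kernel N K x y) \<partial>lborel) = L2_inner lborel f (kernel_slice N K x)"
    unfolding L2_inner_def[symmetric]
    by (rule L2_inner_cong_AE) (use kernel_AE_eq[of N K x] L2_measurable[OF f] L2_measurable[OF kernel_slice_L2[of N K x]] in auto)
  also have "\<dots> = (\<Sum>p\<in>I N. L2_inner lborel f
      (\<lambda>y. cnj (P (fst p) (snd p) (dir x)) * tensor (radial_kernel (fst p) K (norm x)) (P (fst p) (snd p)) y))"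
    unfolding kernel_slice_def[abs_def] case_prod_unfold
    by (rule L2_inner_sum_right[OF _ _ f]) (auto intro!: L2_cmult tensor_P_L2 radial_kernel_L2)
  also have "\<dots> = (\<Sum>p\<in>I N. P (fst p) (snd p) (dir x) * hankel (fst p) (cutoff K (h (fst p) (snd p))) (norm x))"
    by (intro sum.cong refl)
      (simp add: L2_inner_cmult[where a = 1, simplified] inner_tensor_P[OF f radial_kernel_L2] inner_radial_kernel[OF h])
  finally show ?thesis by (simp add: case_prod_unfold)
qed

theorem is_reproducing_kernel_kernel: "is_reproducing_kernel (fourier_bessel_space M Y N K) (kernel N K)"
  unfolding is_reproducing_kernel_def
proof (intro conjI ballI allI continuous_kernel)
  fix f :: "real ^ 2 \<Rightarrow> complex" assume f: "f \<in> L2 lborel"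
  show "integrable lborel (\<lambda>y. f y * cnj (kernel N K x y))" for x
    by (rule L2_integrable_mult[OF f kernel_L2])
  define h where "h n m = (SOME h. has_hankel_transform (real n) (coeff f n m) h)" for n m
  have h: "has_hankel_transform (real n) (coeff f n m) (h n m)" for n m
    unfolding h_def by (rule someI_ex[OF has_hankel_transform_exists[OF coeff_L2[OF f]]])
  note hL2 = has_hankel_transform_L2(2)[OF h]
  define q where "q n m = hankel n (cutoff K (h n m))" for n m
  \<comment> \<open>By inversion, \<open>q n m\<close> is the radial function whose transform is
    exactly the part of \<open>h n m\<close> below \<open>K\<close>.\<close>
  have q: "has_hankel_transform (real n) (q n m) (cutoff K (h n m))" for n m
    unfolding q_def
    by (rule hankel_inversion[OF has_hankel_transform_bounded_support[OF cutoff_L2[OF hL2] cutoff_eq_0]])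
  note qL2 = has_hankel_transform_L2(1)[OF q]
  define p where "p x = (\<integral>y. f y * cnj (kernel N K x y) \<partial>lborel)" for x
  have p: "p x = (\<Sum>(n, m)\<in>I N. P n m (dir x) * q n m (norm x))" for x
    unfolding p_def q_def by (rule projection_eq[OF f h])
  have p_polar: "p (r *\<^sub>R \<xi>) = (\<Sum>(n, m)\<in>I N. q n m r * P n m \<xi>)" if "r > 0" "\<xi> \<in> sphere 0 1" for r \<xi>
    unfolding p using that by (auto simp: dir_polar[OF that] mult.commute intro!: sum.cong)
  have [measurable]: "q n m \<in> borel_measurable borel" for n m
    using L2_measurable[OF qL2] by simp
  have p_meas [measurable]: "p \<in> borel_measurable borel"
    unfolding p[abs_def] case_prod_unfold by measurable
  have pL2: "p \<in> L2 lborel"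
  proof (rule L2_cong_AE)
    show "(\<lambda>x. \<Sum>(n, m)\<in>I N. tensor (q n m) (P n m) x) \<in> L2 lborel"
      unfolding case_prod_unfold by (intro L2_sum tensor_P_L2 qL2)
    show "AE x in lborel. (\<Sum>(n, m)\<in>I N. tensor (q n m) (P n m) x) = p x"
      using AE_lborel_singleton[of 0]
      by eventually_elim (simp add: p tensor_def dir_def mult.commute)
  qed simp
  have coeff_p: "coeff p n m r = (if n \<le> N then q n m r else 0)" if m: "m \<in> {1..M n}" and r: "r > 0" for n m r
  proof -
    have "coeff p n m r = L2_inner circ (\<lambda>\<xi>. \<Sum>i\<in>I N. q (fst i) (snd i) r * P (fst i) (snd i) \<xi>) (P n m)"
      unfolding L2_inner_def harmonic_coeff_def
      by (intro Bochner_Integration.integral_cong) (auto simp: p_polar[OF r] case_prod_unfold)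
    also have "\<dots> = (\<Sum>i\<in>I N. q (fst i) (snd i) r * L2_inner circ (P (fst i) (snd i)) (P n m))"
      by (subst L2_inner_sum_left) (auto intro!: L2_cmult P_L2 simp: L2_inner_cmult[where b = 1, simplified])
    also have "\<dots> = (\<Sum>i\<in>I N. if i = (n, m) then q n m r else 0)"
      by (intro sum.cong refl) (use m in \<open>auto simp: P_inner split: if_splits\<close>)
    also have "\<dots> = (if (n, m) \<in> I N then q n m r else 0)" by simp
    also have "\<dots> = (if n \<le> N then q n m r else 0)" using m by auto
    finally show ?thesis .
  qed
  have coeff_p_AE: "AE r in rad. coeff p n m r = (if n \<le> N then q n m r else 0)" if "m \<in> {1..M n}" for n m
    by (rule AE_radial_measureI) (rule coeff_p[OF that])
  have [measurable]: "coeff p n m \<in> borel_measurable borel" for n m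
    using L2_measurable[OF coeff_L2[OF pL2]] by simp
  have pV: "p \<in> fourier_bessel_space M Y N K"
    unfolding fourier_bessel_space_iff
  proof (intro conjI allI impI ballI pL2)
    fix n m assume n: "N < n" and m: "m \<in> {1..M n}"
    show "AE r in rad. coeff p n m r = 0"
      using coeff_p_AE[OF m] n by simp
  next
    fix n m assume n: "n \<le> N" and m: "m \<in> {1..M n}"
    have "has_hankel_transform (real n) (coeff p n m) (cutoff K (h n m))"
      using coeff_p_AE[OF m] n q[of n m] by (subst has_hankel_transform_cong_left[where g' = "q n m"]) auto
    thus "\<exists>h. has_hankel_transform (real n) (coeff p n m) h \<and> (AE k in rad. k > K \<longrightarrow> h k = 0)"
      by (intro exI[of _ "cutoff K (h n m)"]) (auto simp: cutoff_eq_0)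
  qed
  \<comment> \<open>By the expansion of \<open>v\<close> it is enough to pair with tensors. Such a
    pairing is radial, and Parseval moves it to the transform side.\<close>
  have orth: "L2_inner lborel (\<lambda>x. f x - p x) v = 0" if v: "v \<in> fourier_bessel_space M Y N K" for v
  proof -
    have vL2: "v \<in> L2 lborel" and v_high: "\<And>n m. n > N \<Longrightarrow> m \<in> {1..M n} \<Longrightarrow> AE r in rad. coeff v n m r = 0"
      and v_low: "\<And>n m. n \<le> N \<Longrightarrow> m \<in> {1..M n} \<Longrightarrow>
        \<exists>h. has_hankel_transform (real n) (coeff v n m) h \<and> (AE k in rad. k > K \<longrightarrow> h k = 0)"
      using v unfolding fourier_bessel_space_iff by blast+
    have fp: "(\<lambda>x. f x - p x) \<in> L2 lborel" by (rule L2_diff[OF f pL2])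
    let ?S = "\<lambda>x. \<Sum>i\<in>I N. tensor (coeff v (fst i) (snd i)) (P (fst i) (snd i)) x"
    have S: "?S \<in> L2 lborel" by (intro L2_sum tensor_P_L2 coeff_L2 vL2)
    have "L2_inner lborel (\<lambda>x. f x - p x) v = L2_inner lborel (\<lambda>x. f x - p x) ?S"
    proof (rule L2_inner_cong_AE[OF _ _ L2_measurable[OF fp] L2_measurable[OF fp] L2_measurable[OF vL2] L2_measurable[OF S]])
      show "AE x in lborel. v x = ?S x"
        using harmonic_expansion[OF vL2 v_high, of N] by (simp add: case_prod_unfold)
    qed simp
    also have "\<dots> = (\<Sum>i\<in>I N. L2_inner lborel (\<lambda>x. f x - p x) (tensor (coeff v (fst i) (snd i)) (P (fst i) (snd i))))"
      by (rule L2_inner_sum_right[OF _ _ fp]) (auto intro!: tensor_P_L2 coeff_L2 vL2)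
    also have "\<dots> = 0"
    proof (intro sum.neutral ballI)
      fix i assume "i \<in> I N"
      then obtain n m where i: "i = (n, m)" "n \<le> N" "m \<in> {1..M n}" by auto
      obtain \<eta> where \<eta>: "has_hankel_transform (real n) (coeff v n m) \<eta>" "AE k in rad. k > K \<longrightarrow> \<eta> k = 0"
        using v_low[OF i(2,3)] by blast
      note \<eta>L2 = has_hankel_transform_L2(2)[OF \<eta>(1)]
      have cv: "coeff v n m \<in> L2 rad" by (rule coeff_L2[OF vL2])
      have "L2_inner rad (coeff p n m) (coeff v n m) = L2_inner rad (q n m) (coeff v n m)"
        using coeff_p_AE[OF i(3)] i(2)
        by (intro L2_inner_cong_AE) (auto intro: L2_measurable[OF cv])
      also have "\<dots> = L2_inner rad (cutoff K (h n m)) \<eta>"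
        by (rule hankel_Parseval[OF q \<eta>(1), symmetric])
      also have "\<dots> = L2_inner rad (h n m) \<eta>"
        unfolding L2_inner_def
      proof (rule integral_cong_AE)
        show "AE k in rad. cutoff K (h n m) k * cnj (\<eta> k) = h n m k * cnj (\<eta> k)"
          using \<eta>(2) by eventually_elim (auto simp: cutoff_def split: split_indicator)
      qed (use L2_measurable[OF cutoff_L2[OF hL2]] L2_measurable[OF hL2] L2_measurable[OF \<eta>L2] in measurable)
      also have "\<dots> = L2_inner rad (coeff f n m) (coeff v n m)"
        by (rule hankel_Parseval[OF h \<eta>(1)])
      finally show "L2_inner lborel (\<lambda>x. f x - p x) (tensor (coeff v (fst i) (snd i)) (P (fst i) (snd i))) = 0"
        by (simp add: i L2_inner_diff_left[OF f pL2 tensor_P_L2[OF cv]] inner_tensor_P[OF _ cv] f pL2)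
    qed
    finally show ?thesis .
  qed
  show "is_orthogonal_projection lborel (fourier_bessel_space M Y N K) f
      (\<lambda>x. \<integral>y. f y * cnj (kernel N K x y) \<partial>lborel)"
    unfolding is_orthogonal_projection_def p_def[symmetric] using pV orth by blast
qed

corollary reproducing_kernel_eq: "reproducing_kernel (fourier_bessel_space M Y N K) = kernel N K"
  unfolding reproducing_kernel_def
proof (rule the_equality)
  show "is_reproducing_kernel (fourier_bessel_space M Y N K) (kernel N K)"
    by (rule is_reproducing_kernel_kernel)
  have "fourier_bessel_space M Y N K \<subseteq> L2 lborel"
    by (auto simp: fourier_bessel_space_def)
  thus "k = kernel N K" if "is_reproducing_kernel (fourier_bessel_space M Y N K) k" for k
    by (rule reproducing_kernel_unique[OF _ that is_reproducing_kernel_kernel])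
qed

end

section \<open>The limit on the diagonal\<close>

text \<open>The substitution \<open>k = K s\<close> moves the band to the fixed interval from 0 to
  1; one factor \<open>K\<close> comes from \<open>dk\<close> and one from the weight
  \<open>k\<close>, which accounts for the division by \<open>K\<^sup>2\<close>.\<close>

lemma kernel_diagonal_scaled:
  assumes "K > 0"
  shows "kernel N K x x / of_real (K\<^sup>2) = of_real (1 / (2 * pi) *
    (\<integral>s. indicator {0<..1} s * (s * (\<Sum>j=-int N..int N. (bessel_int (K * s * norm x) j)\<^sup>2)) \<partial>lborel))"
proof -
  define S where "S z = (\<Sum>j=-int N..int N. (bessel_int z j)\<^sup>2)" for z
  have S_eq: "S z = (\<Sum>j=-int N..int N. (bessel_nat (nat \<bar>j\<bar>) z)\<^sup>2)" for z
    unfolding S_def by (simp add: bessel_int_power2)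
  have [measurable]: "S \<in> borel_measurable borel"
    unfolding S_eq[abs_def] by measurable
  have int: "integrable rad (\<lambda>k. indicator {..K} k * (bessel_nat n (k * norm x))\<^sup>2)" for n
  proof -
    have "integrable rad (\<lambda>k. (cmod (radial_part n K (norm x) k))\<^sup>2)"
      by (rule L2_integrable[OF radial_part_L2])
    thus ?thesis
      by (rule Bochner_Integration.integrable_cong[THEN iffD1, rotated 2])
        (auto simp: radial_part_def cutoff_def split: split_indicator)
  qed
  have "(\<Sum>j=-int N..int N. \<integral>k. indicator {..K} k * (bessel_nat (nat \<bar>j\<bar>) (k * norm x))\<^sup>2 \<partial>rad) =
      (\<integral>k. indicator {..K} k * S (k * norm x) \<partial>rad)"
    unfolding S_eq sum_distrib_left by (rule Bochner_Integration.integral_sum[symmetric]) (rule int)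
  also have "\<dots> = (\<integral>k. indicator {0<..} k *\<^sub>R (k *\<^sub>R (indicator {..K} k * S (k * norm x))) \<partial>lborel)"
  proof -
    have "integrable rad (\<lambda>k. indicator {..K} k * S (k * norm x))"
      unfolding S_eq sum_distrib_left by (rule Bochner_Integration.integrable_sum) (rule int)
    hence "has_bochner_integral rad (\<lambda>k. indicator {..K} k * S (k * norm x))
        (\<integral>k. indicator {..K} k * S (k * norm x) \<partial>rad)"
      by (rule has_bochner_integral_integrable)
    thus ?thesis
      by (subst (asm) has_bochner_integral_radial_measure) (auto simp: has_bochner_integral_iff)
  qed
  also have "\<dots> = \<bar>K\<bar> *\<^sub>R (\<integral>s. indicator {0<..} (0 + K * s) *\<^sub>R ((0 + K * s) *\<^sub>R (indicator {..K} (0 + K * s) *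
      S ((0 + K * s) * norm x))) \<partial>lborel)"
    by (rule lborel_integral_real_affine) (use assms in simp)
  also have "\<dots> = (\<integral>s. K\<^sup>2 * (indicator {0<..1} s * (s * S (K * s * norm x))) \<partial>lborel)"
    using assms by (subst integral_scaleR_right[symmetric], intro Bochner_Integration.integral_cong)
      (auto simp: power2_eq_square zero_less_mult_iff split: split_indicator)
  also have "\<dots> = K\<^sup>2 * (\<integral>s. indicator {0<..1} s * (s * S (K * s * norm x)) \<partial>lborel)"
    by simp
  finally show ?thesis
    unfolding kernel_diagonal S_def[symmetric] using assms by simp
qed

text \<open>A single formula for both branches, valid because \<open>arccos 1 = 0\<close>. It shows
  continuity at \<open>r = 1\<close>.\<close>

lemma U_altdef: "U r = 1 / 2 - 1 / pi * arccos (1 / max r 1)"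
  by (simp add: U_def arcsec_def max_def)

lemma continuous_on_U: "continuous_on S U"
  unfolding U_altdef[abs_def] by (intro continuous_intros) (auto simp: divide_simps max_def)

lemma measurable_U [measurable]: "U \<in> borel_measurable borel"
  by (rule borel_measurable_continuous_onI[OF continuous_on_U])

text \<open>The substitution \<open>t = r s\<close>; the Jacobian and the factor \<open>t\<close>
  contribute one power of \<open>r\<close> each.\<close>

lemma integral_U_rescaled:
  assumes "r > 0"
  shows "(\<integral>s. indicator {0<..1} s * (s * (2 * U (s * r / \<kappa>))) \<partial>lborel) =
    2 * (1 / r\<^sup>2 * integral {0..r} (\<lambda>t. t * U (t / \<kappa>)))"
proof -
  have "continuous_on {0..r} (\<lambda>t. t * U (t / \<kappa>))"
    unfolding divide_inverse
    by (intro continuous_intros continuous_on_compose2[OF continuous_on_U[of UNIV]]) auto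
  hence "set_integrable lborel {0..r} (\<lambda>t. t * U (t / \<kappa>))"
    unfolding set_integrable_def by (intro borel_integrable_compact) auto
  from set_borel_integral_eq_integral(2)[OF this]
  have "integral {0..r} (\<lambda>t. t * U (t / \<kappa>)) = (\<integral>t. indicator {0..r} t * (t * U (t / \<kappa>)) \<partial>lborel)"
    by (simp add: set_lebesgue_integral_def)
  also have "\<dots> = \<bar>r\<bar> *\<^sub>R (\<integral>s. indicator {0..r} (0 + r * s) * ((0 + r * s) * U ((0 + r * s) / \<kappa>)) \<partial>lborel)"
    by (rule lborel_integral_real_affine) (use assms in simp)
  also have "\<dots> = (\<integral>s. r\<^sup>2 / 2 * (indicator {0<..1} s * (s * (2 * U (s * r / \<kappa>)))) \<partial>lborel)"
    using assms by (subst integral_scaleR_right[symmetric], intro Bochner_Integration.integral_cong)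
      (auto simp: power2_eq_square zero_le_mult_iff mult.commute split: split_indicator)
  also have "\<dots> = r\<^sup>2 / 2 * (\<integral>s. indicator {0<..1} s * (s * (2 * U (s * r / \<kappa>))) \<partial>lborel)"
    by (rule integral_mult_right_zero)
  finally have *: "integral {0..r} (\<lambda>t. t * U (t / \<kappa>)) =
      r\<^sup>2 / 2 * (\<integral>s. indicator {0<..1} s * (s * (2 * U (s * r / \<kappa>))) \<partial>lborel)" .
  show ?thesis
    unfolding * using assms by (simp only: mult.assoc[symmetric]) simp
qed

lemma sum_bessel_int_0: "(\<Sum>j=-int N..int N. (bessel_int 0 j)\<^sup>2) = 1"
proof -
  have "(\<Sum>j=-int N..int N. (bessel_int 0 j)\<^sup>2) = (\<Sum>j=-int N..int N. if j = 0 then 1 else 0)"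
    by (intro sum.cong refl) (auto simp: bessel_int_power2 bessel_nat_0)
  thus ?thesis by simp
qed

text \<open>The limit law applies with \<open>z = K s r\<close>, for which the ratio of order to
  argument tends to \<open>\<kappa> / (s r)\<close>. For \<open>r = 0\<close> the argument is
  constantly 0 and the law is concentrated at order 0, so the sum is 1, which is
  \<open>2 U(0)\<close>.\<close>

lemma bessel_square_sum_scaled_tendsto:
  fixes N :: "nat \<Rightarrow> nat" and K :: "nat \<Rightarrow> real"
  assumes N: "filterlim N at_top sequentially" and lim: "(\<lambda>i. real (N i) / K i) \<longlonglongrightarrow> \<kappa>" "\<kappa> > 0"
    and "s > 0" "r \<ge> 0"
  shows "(\<lambda>i. \<Sum>j=-int (N i)..int (N i). (bessel_int (K i * s * r) j)\<^sup>2) \<longlonglongrightarrow> 2 * U (s * r / \<kappa>)"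
proof (cases "r = 0")
  case True
  thus ?thesis by (simp add: sum_bessel_int_0 U_def)
next
  case False
  have "(\<lambda>i. real (N i) / K i / (s * r)) \<longlonglongrightarrow> \<kappa> / (s * r)"
    using assms False by (intro tendsto_intros) auto
  hence "(\<lambda>i. real (N i) / (K i * s * r)) \<longlonglongrightarrow> \<kappa> / (s * r)"
    by (simp add: mult.assoc)
  from bessel_square_sum_tendsto[OF N this] show ?thesis
    using assms False by simp
qed

theorem theorem3p5:
  fixes M :: "nat \<Rightarrow> nat"
    and Y :: "nat \<Rightarrow> nat \<Rightarrow> real ^ 2 \<Rightarrow> complex"
    and N :: "nat \<Rightarrow> nat"
    and K :: "nat \<Rightarrow> real"
    and \<kappa> :: real
    and x :: "real ^ 2"
  assumes "\<And>n. is_harmonic_onb n (M n) (Y n)"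
    and "\<And>i. K i > 0"
    and "filterlim N at_top sequentially"
    and "filterlim K at_top sequentially"
    and "(\<lambda>i. real (N i) / K i) \<longlonglongrightarrow> \<kappa>"
    and "\<kappa> > 0"
  shows "(\<lambda>i. reproducing_kernel (fourier_bessel_space M Y (N i) (K i)) x x / of_real ((K i)\<^sup>2))
           \<longlonglongrightarrow> of_real (if x = 0 then 1 / (4 * pi)
                       else 1 / pi * (1 / (norm x)\<^sup>2) *
                              integral {0..norm x} (\<lambda>t. t * U (t / \<kappa>)))"
proof -
  interpret harmonic_basis M Y
    by unfold_locales (rule assms(1))
  define S where "S i s = (\<Sum>j=-int (N i)..int (N i). (bessel_int (K i * s * norm x) j)\<^sup>2)" for i s
  define L where "L = (\<integral>s. indicator {0<..1} s * (s * (2 * U (s * norm x / \<kappa>))) \<partial>lborel)"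
  have "reproducing_kernel (fourier_bessel_space M Y (N i) (K i)) x x / of_real ((K i)\<^sup>2) =
      of_real (1 / (2 * pi) * (\<integral>s. indicator {0<..1} s * (s * S i s) \<partial>lborel))" for i
    unfolding reproducing_kernel_eq S_def by (rule kernel_diagonal_scaled[OF assms(2)])
  \<comment> \<open>The sums \<open>S i s\<close> are probabilities, hence at most 1, so the
    indicator of the unit interval dominates for all \<open>i\<close>.\<close>
  moreover have "(\<lambda>i. \<integral>s. indicator {0<..1} s * (s * S i s) \<partial>lborel) \<longlonglongrightarrow> L"
    unfolding L_def
  proof (rule integral_dominated_convergence[where w = "indicator {0..1}"])
    show "integrable lborel (indicator {0..1} :: real \<Rightarrow> real)" by simp
    show "AE s in lborel. (\<lambda>i. indicator {0<..1} s * (s * S i s)) \<longlonglongrightarrow>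
        indicator {0<..1} s * (s * (2 * U (s * norm x / \<kappa>)))"
    proof (rule AE_I2)
      fix s :: real
      show "(\<lambda>i. indicator {0<..1} s * (s * S i s)) \<longlonglongrightarrow> indicator {0<..1} s * (s * (2 * U (s * norm x / \<kappa>)))"
      proof (cases "s > 0")
        case True
        have "(\<lambda>i. S i s) \<longlonglongrightarrow> 2 * U (s * norm x / \<kappa>)"
          unfolding S_def
          by (rule bessel_square_sum_scaled_tendsto[OF assms(3,5,6) True]) simp
        thus ?thesis by (intro tendsto_intros)
      qed simp
    qed
    show "AE s in lborel. norm (indicator {0<..1} s * (s * S i s)) \<le> indicator {0..1} s" for i
    proof (rule AE_I2)
      fix s :: real
      have "0 \<le> S i s" "S i s \<le> 1"
        unfolding S_def by (auto intro: sum_nonneg sum_bessel_int_power2_le_1)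
      thus "norm (indicator {0<..1} s * (s * S i s)) \<le> indicator {0..1} s"
        by (auto simp: abs_mult mult_le_one split: split_indicator)
    qed
    show "(\<lambda>s. indicator {0<..1} s * (s * S i s)) \<in> borel_measurable lborel" for i
      unfolding S_def bessel_int_power2 by measurable
  qed measurable
  ultimately have "(\<lambda>i. reproducing_kernel (fourier_bessel_space M Y (N i) (K i)) x x / of_real ((K i)\<^sup>2))
      \<longlonglongrightarrow> of_real (1 / (2 * pi) * L)"
    by (simp only:) (intro tendsto_intros)
  moreover have "1 / (2 * pi) * L = (if x = 0 then 1 / (4 * pi)
      else 1 / pi * (1 / (norm x)\<^sup>2) * integral {0..norm x} (\<lambda>t. t * U (t / \<kappa>)))"
  proof (cases "x = 0")
    case True
    \<comment> \<open>At the origin \<open>2 * U 0 = 1\<close>, so only the integral of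
      \<open>s\<close> over the unit interval remains; half of \<open>1 / (2 \<pi>)\<close> is the
      value \<open>1 / (4 \<pi>)\<close>.\<close>
    have "L = (\<integral>s. indicator {0<..1} s * s \<partial>lborel)"
      unfolding L_def True by (simp add: U_def)
    also have "\<dots> = (\<integral>s. indicator {0..1} s *\<^sub>R s \<partial>lborel)"
      by (intro Bochner_Integration.integral_cong) (auto split: split_indicator)
    also have "\<dots> = 1\<^sup>2 / 2 - 0\<^sup>2 / 2"
      by (rule integral_FTC_Icc[where F = "\<lambda>s. s\<^sup>2 / 2"])
        (auto intro!: derivative_eq_intros continuous_intros simp flip: has_real_derivative_iff_has_vector_derivative)
    finally have "L = 1 / 2" by simp
    thus ?thesis using True by (simp only: if_True) simp
  next
    case False
    hence "L = 2 * (1 / (norm x)\<^sup>2 * integral {0..norm x} (\<lambda>t. t * U (t / \<kappa>)))"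
      unfolding L_def by (intro integral_U_rescaled) simp
    thus ?thesis using False by simp
  qed
  ultimately show ?thesis by (simp only:)
qed

end
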